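(* Let $p\colon \overline{M}\to M$ be a smooth fiber bundle, let $\tau\colon A\to M$ be a Lie algebroid with anchor $\rho\colon A\to \mathrm{T}M$, and let $\overline{A}=\rho^*\mathrm{T}\overline{M}\to\overline{M}$ be the $p$-prolongation bundle of $A$. Then, using an Ehresmann connection $h\colon p^*\mathrm{T}M\to \mathrm{T}\overline{M}$ on $p$, the bundle $\overline{A}$ can be split as a vector bundle over $\overline{M}$: $$\overline{A}=\rho^*\mathrm{T}\overline{M}\;\simeq\; p^*A\oplus_{\overline{M}}\mathrm{V}p .$$
   Context: A Lie algebroid $(A,\llbracket\cdot,\cdot\rrbracket,\rho)$ over $M$ is a vector bundle $\tau\colon A\to M$ with a linear bundle map $\rho\colon A\to \mathrm{T}M$ (the anchor) and a Lie algebra bracket on $\Gamma(A)$ satisfying $\llbracket \sigma_1,f\sigma_2\rrbracket=\rho(\sigma_1)(f)\sigma_2+f\llbracket\sigma_1,\sigma_2\rrbracket$. The $p$-prolongation bundle of $A$ is $$\overline{A}=\rho^*\mathrm{T}\overline{M}=\{(a_m,\bar v_{\bar m})\in A\times \mathrm{T}\overline{M}\mid \rho(a_m)=\mathrm{T}p(\bar v_{\bar m})\},$$ (so $p(\bar m)=m$), with vector bundle projection $\bar\tau\colon\overline{A}\to\overline{M}$, $(a_m,\bar v_{\bar m})\mapsto\bar m$. $p^*A\to\overline{M}$ is the pullback bundle of $\tau$ by $p$, and $\mathrm{V}p=\ker \mathrm{T}p\subset \mathrm{T}\overline{M}$ is the vertical bundle of $p$. An Ehresmann connection on $p$ is a splitting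 $h\colon p^*\mathrm{T}M\to\mathrm{T}\overline{M}$ of the short exact sequence of vector bundles over $\overline M$, $0\to\mathrm{V}p\to\mathrm{T}\overline{M}\to p^*\mathrm{T}M\to 0$, i.e. a bundle map over $\overline M$, linear on fibers, with $\mathrm{T}p(h(\bar m,v_m))=v_m$. *)

theory Defs
  imports "HOL-Analysis.Analysis"
begin

text \<open>
  Model spaces. The axiom is that of \<^class>\<open>euclidean_space\<close> without the requirement that the basis
  be nonempty, so that manifolds of dimension 0 and vector bundles of rank 0 are not excluded.
\<close>

class fin_dim_inner = real_inner +
  assumes ex_orthonormal_basis:
    "\<exists>B. finite B \<and> (\<forall>u\<in>B. \<forall>v\<in>B. inner u v = (if u = v then 1 else 0)) \<and>
         (\<forall>x. (\<forall>u\<in>B. inner x u = 0) \<longleftrightarrow> x = 0)"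

instance euclidean_space \<subseteq> fin_dim_inner
proof
  show "\<exists>B::'a set. finite B \<and> (\<forall>u\<in>B. \<forall>v\<in>B. inner u v = (if u = v then 1 else 0)) \<and>
         (\<forall>x. (\<forall>u\<in>B. inner x u = 0) \<longleftrightarrow> x = 0)"
    by (intro exI[of _ Basis] conjI ballI allI finite_Basis inner_Basis euclidean_all_zero_iff)
qed

instance prod :: (fin_dim_inner, fin_dim_inner) fin_dim_inner
proof
  from ex_orthonormal_basis[where 'a = 'a] obtain B :: "'a set" where B: "finite B"
    "\<forall>u\<in>B. \<forall>v\<in>B. inner u v = (if u = v then 1 else 0)" "\<forall>x. (\<forall>u\<in>B. inner x u = 0) \<longleftrightarrow> x = 0"
    by (elim exE conjE)
  from ex_orthonormal_basis[where 'a = 'b] obtain C :: "'b set" where C: "finite C"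
    "\<forall>u\<in>C. \<forall>v\<in>C. inner u v = (if u = v then 1 else 0)" "\<forall>x. (\<forall>u\<in>C. inner x u = 0) \<longleftrightarrow> x = 0"
    by (elim exE conjE)
  let ?D = "(\<lambda>u. (u, 0)) ` B \<union> (\<lambda>v. (0, v)) ` C"
  have "0 \<notin> B" "0 \<notin> C"
    using B(2)[rule_format, of 0 0] C(2)[rule_format, of 0 0] by auto
  then have "inner u v = (if u = v then 1 else 0)" if "u \<in> ?D" "v \<in> ?D" for u v
    using that by (elim UnE imageE) (auto simp: inner_prod_def B(2)[rule_format] C(2)[rule_format])
  moreover have "(\<forall>u\<in>?D. inner x u = 0) \<longleftrightarrow> x = 0" for x
    using B(3)[rule_format, of "fst x"] C(3)[rule_format, of "snd x"]
    unfolding ball_Un ball_simps by (simp add: inner_prod_def prod_eq_iff)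
  ultimately show "\<exists>D::('a \<times> 'b) set. finite D \<and>
      (\<forall>u\<in>D. \<forall>v\<in>D. inner u v = (if u = v then 1 else 0)) \<and>
      (\<forall>x. (\<forall>u\<in>D. inner x u = 0) \<longleftrightarrow> x = 0)"
    using B(1) C(1) by (intro exI[of _ ?D] conjI ballI allI) simp_all
qed

primrec Ck_on :: "nat \<Rightarrow> 'a::real_normed_vector set \<Rightarrow> ('a \<Rightarrow> 'b::real_normed_vector) \<Rightarrow> bool"
  where
    "Ck_on 0 S f \<longleftrightarrow> continuous_on S f"
  | "Ck_on (Suc k) S f \<longleftrightarrow>
       (\<forall>x\<in>S. f differentiable (at x)) \<and> (\<forall>v. Ck_on k S (\<lambda>x. frechet_derivative f (at x) v))"

text \<open>Only meaningful for open \<open>S\<close>, the only sets to which it is applied.\<close>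

definition smooth_on :: "'a::real_normed_vector set \<Rightarrow> ('a \<Rightarrow> 'b::real_normed_vector) \<Rightarrow> bool"
  where "smooth_on S f \<longleftrightarrow> (\<forall>k. Ck_on k S f)"


section \<open>Manifolds and smooth maps\<close>

text \<open>
  A chart is a pair of its domain and its coordinate map; values of the coordinate map outside the
  domain are irrelevant. The atlas need not be maximal, and it determines the topology.
\<close>

type_synonym ('a, 'e) chart = "'a set \<times> ('a \<Rightarrow> 'e)"

record ('a, 'e) manifold =
  points :: "'a set"
  charts :: "('a, 'e) chart set"

definition mtop :: "('a, 'e::real_normed_vector) manifold \<Rightarrow> 'a topology"
  where "mtop M =
    topology (\<lambda>W. W \<subseteq> points M \<and> (\<forall>c\<in>charts M. open (snd c ` (W \<inter> fst c))))"

lemma openin_mtop: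
  assumes "\<And>c. c \<in> charts M \<Longrightarrow> inj_on (snd c) (fst c)"
  shows "openin (mtop M) W \<longleftrightarrow> W \<subseteq> points M \<and> (\<forall>c\<in>charts M. open (snd c ` (W \<inter> fst c)))"
proof -
  have "istopology (\<lambda>W. W \<subseteq> points M \<and> (\<forall>c\<in>charts M. open (snd c ` (W \<inter> fst c))))"
    unfolding istopology_def
  proof (intro conjI allI impI)
    fix S T
    assume S: "S \<subseteq> points M \<and> (\<forall>c\<in>charts M. open (snd c ` (S \<inter> fst c)))"
      and T: "T \<subseteq> points M \<and> (\<forall>c\<in>charts M. open (snd c ` (T \<inter> fst c)))"
    have "snd c ` (S \<inter> T \<inter> fst c) = snd c ` (S \<inter> fst c) \<inter> snd c ` (T \<inter> fst c)"
      if "c \<in> charts M" for c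
      using assms[OF that] by (auto simp: inj_on_def)
    then show "\<forall>c\<in>charts M. open (snd c ` (S \<inter> T \<inter> fst c))"
      using S T by auto
    show "S \<inter> T \<subseteq> points M" using S by auto
  next
    fix K
    assume K: "\<forall>W\<in>K. W \<subseteq> points M \<and> (\<forall>c\<in>charts M. open (snd c ` (W \<inter> fst c)))"
    show "\<forall>c\<in>charts M. open (snd c ` (\<Union>K \<inter> fst c))"
    proof
      fix c
      assume "c \<in> charts M"
      then have "open (\<Union>W\<in>K. snd c ` (W \<inter> fst c))"
        using K by (intro open_UN) blast
      moreover have "snd c ` (\<Union>K \<inter> fst c) = (\<Union>W\<in>K. snd c ` (W \<inter> fst c))"
        by auto
      ultimately show "open (snd c ` (\<Union>K \<inter> fst c))"
        by simp
    qed
    show "\<Union>K \<subseteq> points M" using K by auto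
  qed
  then show ?thesis
    by (simp add: mtop_def)
qed

definition chart_rep :: "('a, 'e) chart \<Rightarrow> ('b, 'g) chart \<Rightarrow> ('a \<Rightarrow> 'b) \<Rightarrow> 'e \<Rightarrow> 'g"
  where "chart_rep c d f = snd d \<circ> f \<circ> inv_into (fst c) (snd c)"

definition smooth_manifold :: "('a, 'e::fin_dim_inner) manifold \<Rightarrow> bool"
  where "smooth_manifold M \<longleftrightarrow>
    (\<Union>c\<in>charts M. fst c) = points M \<and>
    (\<forall>c\<in>charts M. inj_on (snd c) (fst c) \<and> open (snd c ` fst c)) \<and>
    (\<forall>c\<in>charts M. \<forall>d\<in>charts M.
       open (snd c ` (fst c \<inter> fst d)) \<and> smooth_on (snd c ` (fst c \<inter> fst d)) (chart_rep c d id)) \<and>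
    Hausdorff_space (mtop M) \<and> second_countable (mtop M)"

text \<open>
  The openness condition, together with continuity of the coordinate representations, expresses
  continuity of \<open>f\<close>.
\<close>

definition smooth_map ::
    "('a, 'e::real_normed_vector) manifold \<Rightarrow> ('b, 'g::real_normed_vector) manifold \<Rightarrow> ('a \<Rightarrow> 'b) \<Rightarrow> bool"
  where "smooth_map M N f \<longleftrightarrow>
    f \<in> points M \<rightarrow> points N \<and>
    (\<forall>c\<in>charts M. \<forall>d\<in>charts N.
       open (snd c ` (fst c \<inter> f -` fst d)) \<and>
       smooth_on (snd c ` (fst c \<inter> f -` fst d)) (chart_rep c d f))"

definition diffeo ::
    "('a, 'e::real_normed_vector) manifold \<Rightarrow> ('b, 'g::real_normed_vector) manifold \<Rightarrow> ('a \<Rightarrow> 'b) \<Rightarrow> bool"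
  where "diffeo M N f \<longleftrightarrow>
    bij_betw f (points M) (points N) \<and> smooth_map M N f \<and> smooth_map N M (inv_into (points M) f)"

definition euclid :: "('e, 'e) manifold"
  where "euclid = \<lparr>points = UNIV, charts = {(UNIV, id)}\<rparr>"

definition open_sub :: "('a, 'e) manifold \<Rightarrow> 'a set \<Rightarrow> ('a, 'e) manifold"
  where "open_sub M W =
    \<lparr>points = points M \<inter> W, charts = (\<lambda>c. (fst c \<inter> W, snd c)) ` charts M\<rparr>"

definition prod_manifold ::
    "('a, 'e) manifold \<Rightarrow> ('b, 'g) manifold \<Rightarrow> ('a \<times> 'b, 'e \<times> 'g) manifold"
  where "prod_manifold M N =
    \<lparr>points = points M \<times> points N,
     charts = (\<lambda>(c, d). (fst c \<times> fst d, map_prod (snd c) (snd d))) ` (charts M \<times> charts N)\<rparr>"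

text \<open>
  The smooth structure induced on a subset \<open>S\<close> of a manifold \<open>N\<close>: the charts are the bijections from
  relatively open subsets of \<open>S\<close> onto open subsets of the model space which locally extend to smooth
  maps on \<open>N\<close> and whose inverse is smooth as a map to \<open>N\<close>. These charts cover \<open>S\<close> if and only if
  \<open>S\<close> is an embedded submanifold, of the dimension of the model space \<open>'g\<close>.
\<close>

definition submanifold ::
    "('a, 'e::real_normed_vector) manifold \<Rightarrow> 'a set \<Rightarrow> ('a, 'g::real_normed_vector) manifold"
  where "submanifold N S =
    \<lparr>points = S,
     charts = {c. (\<exists>W. openin (mtop N) W \<and> fst c = S \<inter> W) \<and>
       inj_on (snd c) (fst c) \<and> open (snd c ` fst c) \<and>
       (\<forall>x\<in>fst c. \<exists>W g. openin (mtop N) W \<and> x \<in> W \<and> smooth_map (open_sub N W) euclid g \<and>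
                        (\<forall>y\<in>fst c \<inter> W. g y = snd c y)) \<and>
       smooth_map (open_sub euclid (snd c ` fst c)) N (inv_into (fst c) (snd c))}\<rparr>"

definition fiber_bundle ::
    "('b, 'n::fin_dim_inner) manifold \<Rightarrow> ('a, 'm::fin_dim_inner) manifold \<Rightarrow>
     ('d, 'k::fin_dim_inner) manifold \<Rightarrow> ('b \<Rightarrow> 'a) \<Rightarrow> bool"
  where "fiber_bundle N M F p \<longleftrightarrow>
    smooth_manifold N \<and> smooth_manifold M \<and> smooth_manifold F \<and>
    smooth_map N M p \<and> p ` points N = points M \<and>
    (\<forall>x\<in>points M. \<exists>U \<Psi>. openin (mtop M) U \<and> x \<in> U \<and>
       diffeo (open_sub N (p -` U)) (prod_manifold (open_sub M U) F) \<Psi> \<and>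
       (\<forall>y\<in>points N \<inter> p -` U. fst (\<Psi> y) = p y))"


section \<open>Vector bundles\<close>

record ('x, 'b, 'm, 'f) vbundle =
  tspace :: "('x, 'm \<times> 'f) manifold"
  bproj :: "'x \<Rightarrow> 'b"
  vadd :: "'x \<Rightarrow> 'x \<Rightarrow> 'x"
  vscale :: "real \<Rightarrow> 'x \<Rightarrow> 'x"
  vzero :: "'b \<Rightarrow> 'x"

definition fiber :: "('x, 'b, 'm, 'f) vbundle \<Rightarrow> 'b \<Rightarrow> 'x set"
  where "fiber E x = {a \<in> points (tspace E). bproj E a = x}"

text \<open>
  The fibrewise vector space axioms need not be listed: a local trivialization restricts to a
  bijection from each fibre onto \<open>'f\<close> that respects all the operations.
\<close>

definition vector_bundle ::
    "('b, 'm::fin_dim_inner) manifold \<Rightarrow> ('x, 'b, 'm, 'f::fin_dim_inner) vbundle \<Rightarrow> bool"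
  where "vector_bundle M E \<longleftrightarrow>
    smooth_manifold M \<and> smooth_manifold (tspace E) \<and> smooth_map (tspace E) M (bproj E) \<and>
    (\<forall>x\<in>points M. vzero E x \<in> fiber E x \<and>
       (\<forall>a\<in>fiber E x. (\<forall>b\<in>fiber E x. vadd E a b \<in> fiber E x) \<and> (\<forall>r. vscale E r a \<in> fiber E x))) \<and>
    (\<forall>x\<in>points M. \<exists>U \<Phi>. openin (mtop M) U \<and> x \<in> U \<and>
       diffeo (open_sub (tspace E) (bproj E -` U)) (prod_manifold (open_sub M U) (euclid :: ('f, 'f) manifold)) \<Phi> \<and>
       (\<forall>y\<in>U. snd (\<Phi> (vzero E y)) = 0 \<and>
          (\<forall>a\<in>fiber E y. fst (\<Phi> a) = y \<and>
             (\<forall>b\<in>fiber E y. snd (\<Phi> (vadd E a b)) = snd (\<Phi> a) + snd (\<Phi> b)) \<and>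
             (\<forall>r. snd (\<Phi> (vscale E r a)) = r *\<^sub>R snd (\<Phi> a)))))"

definition vb_morphism ::
    "('x, 'b, 'm::real_normed_vector, 'f::real_normed_vector) vbundle \<Rightarrow>
     ('y, 'b, 'm, 'g::real_normed_vector) vbundle \<Rightarrow> ('x \<Rightarrow> 'y) \<Rightarrow> bool"
  where "vb_morphism E E' \<phi> \<longleftrightarrow>
    smooth_map (tspace E) (tspace E') \<phi> \<and>
    (\<forall>a\<in>points (tspace E). bproj E' (\<phi> a) = bproj E a \<and>
       (\<forall>b\<in>fiber E (bproj E a). \<phi> (vadd E a b) = vadd E' (\<phi> a) (\<phi> b)) \<and>
       (\<forall>r. \<phi> (vscale E r a) = vscale E' r (\<phi> a)))"

definition vb_iso ::
    "('b, 'm::fin_dim_inner) manifold \<Rightarrow> ('x, 'b, 'm, 'f::fin_dim_inner) vbundle \<Rightarrow>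
     ('y, 'b, 'm, 'f) vbundle \<Rightarrow> ('x \<Rightarrow> 'y) \<Rightarrow> bool"
  where "vb_iso M E E' \<phi> \<longleftrightarrow>
    vector_bundle M E \<and> vector_bundle M E' \<and>
    vb_morphism E E' \<phi> \<and> diffeo (tspace E) (tspace E') \<phi>"

definition pullback_bundle ::
    "('b, 'n::real_normed_vector) manifold \<Rightarrow> ('b \<Rightarrow> 'a) \<Rightarrow>
     ('x, 'a, 'm::real_normed_vector, 'f::real_normed_vector) vbundle \<Rightarrow> ('b \<times> 'x, 'b, 'n, 'f) vbundle"
  where "pullback_bundle N p E =
    \<lparr>tspace = submanifold (prod_manifold N (tspace E))
       {(x, a) \<in> points N \<times> points (tspace E). p x = bproj E a},
     bproj = fst,
     vadd = (\<lambda>(x, a) (_, b). (x, vadd E a b)),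
     vscale = (\<lambda>r (x, a). (x, vscale E r a)),
     vzero = (\<lambda>x. (x, vzero E (p x)))\<rparr>"

definition whitney_sum ::
    "('x, 'b, 'n::real_normed_vector, 'f::real_normed_vector) vbundle \<Rightarrow>
     ('y, 'b, 'n, 'g::real_normed_vector) vbundle \<Rightarrow> ('x \<times> 'y, 'b, 'n, 'f \<times> 'g) vbundle"
  where "whitney_sum E E' =
    \<lparr>tspace = submanifold (prod_manifold (tspace E) (tspace E'))
       {(a, b) \<in> points (tspace E) \<times> points (tspace E'). bproj E a = bproj E' b},
     bproj = (\<lambda>(a, _). bproj E a),
     vadd = (\<lambda>(a, b) (a', b'). (vadd E a a', vadd E' b b')),
     vscale = (\<lambda>r (a, b). (vscale E r a, vscale E' r b)),
     vzero = (\<lambda>x. (vzero E x, vzero E' x))\<rparr>"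


section \<open>Tangent bundle and vertical bundle\<close>

text \<open>
  A tangent vector at \<open>x\<close> is given by its components in all charts around \<open>x\<close>, related by the
  Jacobians of the transition maps; the components are set to 0 at all other arguments so that
  tangent vectors are equal if and only if their components agree in all charts around \<open>x\<close>.
\<close>

type_synonym ('a, 'e) tvec = "'a \<times> (('a, 'e) chart \<Rightarrow> 'e)"

definition charts_at :: "('a, 'e) manifold \<Rightarrow> 'a \<Rightarrow> ('a, 'e) chart set"
  where "charts_at M x = {c \<in> charts M. x \<in> fst c}"

definition tvecs :: "('a, 'e::real_normed_vector) manifold \<Rightarrow> ('a, 'e) tvec set"
  where "tvecs M = {(x, v). x \<in> points M \<and> (\<forall>c. c \<notin> charts_at M x \<longrightarrow> v c = 0) \<and>
    (\<forall>c\<in>charts_at M x. \<forall>d\<in>charts_at M x.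
       v d = frechet_derivative (chart_rep c d id) (at (snd c x)) (v c))}"

definition tangent_bundle ::
    "('a, 'e::real_normed_vector) manifold \<Rightarrow> (('a, 'e) tvec, 'a, 'e, 'e) vbundle"
  where "tangent_bundle M =
    \<lparr>tspace = \<lparr>points = tvecs M,
       charts = (\<lambda>c. ({(x, v) \<in> tvecs M. x \<in> fst c}, \<lambda>(x, v). (snd c x, v c))) ` charts M\<rparr>,
     bproj = fst,
     vadd = (\<lambda>(x, v) (_, w). (x, \<lambda>c. v c + w c)),
     vscale = (\<lambda>r (x, v). (x, \<lambda>c. r *\<^sub>R v c)),
     vzero = (\<lambda>x. (x, \<lambda>_. 0))\<rparr>"

text \<open>By the chain rule the chart chosen around the base point does not matter.\<close>

definition tangent_map ::
    "('a, 'e::real_normed_vector) manifold \<Rightarrow> ('b, 'g::real_normed_vector) manifold \<Rightarrow>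
     ('a \<Rightarrow> 'b) \<Rightarrow> ('a, 'e) tvec \<Rightarrow> ('b, 'g) tvec"
  where "tangent_map M N f = (\<lambda>(x, v). (f x,
    \<lambda>d. if d \<in> charts_at N (f x)
        then let c = (SOME c. c \<in> charts_at M x)
             in frechet_derivative (chart_rep c d f) (at (snd c x)) (v c)
        else 0))"

text \<open>The derivative of a real function along a tangent vector: the component of its image under
  the tangent map in the standard chart of \<open>\<real>\<close>.\<close>

definition deriv_along ::
    "('a, 'e::real_normed_vector) manifold \<Rightarrow> ('a, 'e) tvec \<Rightarrow> ('a \<Rightarrow> real) \<Rightarrow> real"
  where "deriv_along M v f = snd (tangent_map M euclid f v) (UNIV, id)"

definition vertical_bundle ::
    "('b, 'n::real_normed_vector) manifold \<Rightarrow> ('a, 'm::real_normed_vector) manifold \<Rightarrow> ('b \<Rightarrow> 'a) \<Rightarrow>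
     (('b, 'n) tvec, 'b, 'n, 'k::real_normed_vector) vbundle"
  where "vertical_bundle N M p =
    \<lparr>tspace = submanifold (tspace (tangent_bundle N))
       {v \<in> tvecs N. tangent_map N M p v = vzero (tangent_bundle M) (p (fst v))},
     bproj = bproj (tangent_bundle N),
     vadd = vadd (tangent_bundle N),
     vscale = vscale (tangent_bundle N),
     vzero = vzero (tangent_bundle N)\<rparr>"

definition ehresmann_connection ::
    "('b, 'n::real_normed_vector) manifold \<Rightarrow> ('a, 'm::real_normed_vector) manifold \<Rightarrow> ('b \<Rightarrow> 'a) \<Rightarrow>
     ('b \<times> ('a, 'm) tvec \<Rightarrow> ('b, 'n) tvec) \<Rightarrow> bool"
  where "ehresmann_connection N M p h \<longleftrightarrow>
    vb_morphism (pullback_bundle N p (tangent_bundle M)) (tangent_bundle N) h \<and>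
    (\<forall>(x, v)\<in>points (tspace (pullback_bundle N p (tangent_bundle M))). tangent_map N M p (h (x, v)) = v)"


section \<open>Lie algebroids and their prolongations\<close>

definition sections ::
    "('b, 'm::real_normed_vector) manifold \<Rightarrow> ('x, 'b, 'm, 'f::real_normed_vector) vbundle \<Rightarrow> ('b \<Rightarrow> 'x) set"
  where "sections M E =
    {\<sigma> \<in> extensional (points M). smooth_map M (tspace E) \<sigma> \<and> (\<forall>x\<in>points M. bproj E (\<sigma> x) = x)}"

definition sec_add ::
    "('b, 'm) manifold \<Rightarrow> ('x, 'b, 'm, 'f) vbundle \<Rightarrow> ('b \<Rightarrow> 'x) \<Rightarrow> ('b \<Rightarrow> 'x) \<Rightarrow> 'b \<Rightarrow> 'x"
  where "sec_add M E \<sigma> \<tau> = restrict (\<lambda>x. vadd E (\<sigma> x) (\<tau> x)) (points M)"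

definition sec_scale ::
    "('b, 'm) manifold \<Rightarrow> ('x, 'b, 'm, 'f) vbundle \<Rightarrow> ('b \<Rightarrow> real) \<Rightarrow> ('b \<Rightarrow> 'x) \<Rightarrow> 'b \<Rightarrow> 'x"
  where "sec_scale M E f \<sigma> = restrict (\<lambda>x. vscale E (f x) (\<sigma> x)) (points M)"

definition sec_zero :: "('b, 'm) manifold \<Rightarrow> ('x, 'b, 'm, 'f) vbundle \<Rightarrow> 'b \<Rightarrow> 'x"
  where "sec_zero M E = restrict (vzero E) (points M)"

definition lie_bracket_on_sections ::
    "('a, 'm::real_normed_vector) manifold \<Rightarrow> ('x, 'a, 'm, 'f::real_normed_vector) vbundle \<Rightarrow>
     (('a \<Rightarrow> 'x) \<Rightarrow> ('a \<Rightarrow> 'x) \<Rightarrow> ('a \<Rightarrow> 'x)) \<Rightarrow> bool"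
  where "lie_bracket_on_sections M A br \<longleftrightarrow>
    (\<forall>s\<in>sections M A. \<forall>t\<in>sections M A. br s t \<in> sections M A) \<and>
    (\<forall>s\<in>sections M A. \<forall>t\<in>sections M A. \<forall>u\<in>sections M A.
       br (sec_add M A s t) u = sec_add M A (br s u) (br t u) \<and>
       br u (sec_add M A s t) = sec_add M A (br u s) (br u t)) \<and>
    (\<forall>s\<in>sections M A. \<forall>t\<in>sections M A. \<forall>r.
       br (sec_scale M A (\<lambda>_. r) s) t = sec_scale M A (\<lambda>_. r) (br s t) \<and>
       br s (sec_scale M A (\<lambda>_. r) t) = sec_scale M A (\<lambda>_. r) (br s t)) \<and>
    (\<forall>s\<in>sections M A. br s s = sec_zero M A) \<and>
    (\<forall>s\<in>sections M A. \<forall>t\<in>sections M A. \<forall>u\<in>sections M A.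
       sec_add M A (br s (br t u)) (sec_add M A (br t (br u s)) (br u (br s t))) = sec_zero M A)"

definition lie_algebroid ::
    "('a, 'm::fin_dim_inner) manifold \<Rightarrow> ('x, 'a, 'm, 'f::fin_dim_inner) vbundle \<Rightarrow>
     (('a \<Rightarrow> 'x) \<Rightarrow> ('a \<Rightarrow> 'x) \<Rightarrow> ('a \<Rightarrow> 'x)) \<Rightarrow> ('x \<Rightarrow> ('a, 'm) tvec) \<Rightarrow> bool"
  where "lie_algebroid M A br \<rho> \<longleftrightarrow>
    vector_bundle M A \<and> vb_morphism A (tangent_bundle M) \<rho> \<and> lie_bracket_on_sections M A br \<and>
    (\<forall>s\<in>sections M A. \<forall>t\<in>sections M A. \<forall>f. smooth_map M euclid f \<longrightarrow>
       br s (sec_scale M A f t) =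
         sec_add M A (sec_scale M A (\<lambda>x. deriv_along M (\<rho> (s x)) f) t) (sec_scale M A f (br s t)))"

definition prolongation_bundle ::
    "('b, 'n::real_normed_vector) manifold \<Rightarrow> ('a, 'm::real_normed_vector) manifold \<Rightarrow> ('b \<Rightarrow> 'a) \<Rightarrow>
     ('x, 'a, 'm, 'f::real_normed_vector) vbundle \<Rightarrow> ('x \<Rightarrow> ('a, 'm) tvec) \<Rightarrow>
     ('x \<times> ('b, 'n) tvec, 'b, 'n, 'g::real_normed_vector) vbundle"
  where "prolongation_bundle N M p A \<rho> =
    \<lparr>tspace = submanifold (prod_manifold (tspace A) (tspace (tangent_bundle N)))
       {(a, v) \<in> points (tspace A) \<times> tvecs N. \<rho> a = tangent_map N M p v},
     bproj = (\<lambda>(_, v). bproj (tangent_bundle N) v),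
     vadd = (\<lambda>(a, v) (b, w). (vadd A a b, vadd (tangent_bundle N) v w)),
     vscale = (\<lambda>r (a, v). (vscale A r a, vscale (tangent_bundle N) r v)),
     vzero = (\<lambda>x. (vzero A (p x), vzero (tangent_bundle N) x))\<rparr>"

text \<open>The map determined by an Ehresmann connection \<open>h\<close>:
  \<open>(a, v) \<mapsto> ((x, a), v - h (x, \<rho> a))\<close>, where \<open>x\<close> is the base point of \<open>v\<close>.\<close>

definition connection_splitting ::
    "('b, 'n::real_normed_vector) manifold \<Rightarrow> ('x \<Rightarrow> ('a, 'm) tvec) \<Rightarrow>
     ('b \<times> ('a, 'm) tvec \<Rightarrow> ('b, 'n) tvec) \<Rightarrow> 'x \<times> ('b, 'n) tvec \<Rightarrow> ('b \<times> 'x) \<times> ('b, 'n) tvec"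
  where "connection_splitting N \<rho> h = (\<lambda>(a, v). ((fst v, a),
    vadd (tangent_bundle N) v (vscale (tangent_bundle N) (- 1) (h (fst v, \<rho> a)))))"

end

theory Submission
  imports Defs
begin

text \<open>
  A local trivialization of \<open>p\<close> straightens it to the first projection \<open>'m \<times> 'k \<rightarrow> 'm\<close>. In such
  coordinates a tangent vector \<open>v\<close> of the total space is a pair of its image under the tangent map of
  \<open>p\<close> and a free component in \<open>'k\<close>. This trivializes the vertical bundle by the free component, and
  the prolongation bundle by the fibre coordinate of \<open>a\<close> and the free component of \<open>v\<close>, because
  \<open>\<rho> a = Tp v\<close> determines the rest of \<open>v\<close>. As all trivializations have explicit smooth inverses, no
  inverse function theorem is needed to obtain the submanifold charts. The splitting
  \<open>(a, v) \<mapsto> ((x, a), v - h (x, \<rho> a))\<close> and its inverse \<open>((x, a), w) \<mapsto> (a, w + h (x, \<rho> a))\<close> are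
  compositions of smooth maps into the ambient manifolds, hence smooth for the induced structures.
\<close>

section \<open>Smooth maps between model spaces\<close>

text \<open>The obstacle is less the formula of the splitting than the smooth structures on both
  sides of it. \<open>vb_iso\<close> demands two vector bundles, and their total spaces are
  \<open>submanifold\<close>s, whose atlas consists of all admissible charts and might fail to
  cover. Pullback, vertical, prolongation and Whitney sum bundles are all treated by one criterion,
  \<open>ambient_bundle\<close>: fibre coordinates and inverses that are smooth with respect to a
  surrounding manifold. It produces the charts, and separation and countability are then inherited
  from the base. The definition of \<open>smooth_map\<close> quantifies over all charts and contains
  openness conditions, which is awkward for composites; \<open>smooth_at\<close> replaces it by a
  condition on germs. The manifold \<open>Mbar\<close> is modelled on \<open>'n\<close>, its local
  product structure on \<open>'m \<times> 'k\<close>. These types are never identified: only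
  derivatives of the coordinate changes between them occur, so no dimension count is made.\<close>

lemma orthonormal_basis_expansion:
  obtains B :: "'a::fin_dim_inner set" where "finite B" "\<And>x. (\<Sum>b\<in>B. inner x b *\<^sub>R b) = x"
proof -
  obtain B :: "'a set" where B: "finite B"
    "\<forall>u\<in>B. \<forall>v\<in>B. inner u v = (if u = v then 1 else 0)" "\<forall>x. (\<forall>u\<in>B. inner x u = 0) \<longleftrightarrow> x = 0"
    using ex_orthonormal_basis by (elim exE conjE)
  \<comment> \<open>The remainder of the expansion is orthogonal to all of \<open>B\<close>, so the
    completeness clause of the class axiom makes it zero.\<close>
  have "inner (x - (\<Sum>b\<in>B. inner x b *\<^sub>R b)) u = 0" if "u \<in> B" for x u
  proof -
    have "(\<Sum>b\<in>B. inner x b * inner b u) = (\<Sum>b\<in>B. if b = u then inner x u else 0)"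
      using B(2) that by (intro sum.cong) auto
    then show ?thesis
      using that B(1) by (simp add: inner_diff_left inner_sum_left)
  qed
  then have "(\<Sum>b\<in>B. inner x b *\<^sub>R b) = x" for x
    using B(3)[rule_format, of "x - (\<Sum>b\<in>B. inner x b *\<^sub>R b)"] by auto
  with B(1) show ?thesis by (rule that)
qed

text \<open>A finite orthonormal basis embeds the space into the second countable space of real
  sequences: \<open>g\<close> lists the coordinates, padded with 0 outside the indices in use, and
  the continuous left inverse \<open>f\<close> reassembles the vector. Preimages under
  \<open>g\<close> of a countable base then form a base. Sequences indexed by \<open>nat\<close> are
  taken because the size of the basis is not visible in the type.\<close>

lemma countable_base_fin_dim_inner:
  obtains \<B> :: "'a::fin_dim_inner set set" where "countable \<B>" "\<And>V. V \<in> \<B> \<Longrightarrow> open V"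
    "\<And>U x. open U \<Longrightarrow> x \<in> U \<Longrightarrow> \<exists>V\<in>\<B>. x \<in> V \<and> V \<subseteq> U"
proof -
  obtain B :: "'a set" where B: "finite B" "\<And>x. (\<Sum>b\<in>B. inner x b *\<^sub>R b) = x"
    by (rule orthonormal_basis_expansion) blast
  obtain i :: "'a \<Rightarrow> nat" and n where i: "inj_on i B"
    using finite_imp_inj_to_nat_seg[OF B(1)] by metis
  define f :: "(nat \<Rightarrow> real) \<Rightarrow> 'a" where "f q = (\<Sum>b\<in>B. q (i b) *\<^sub>R b)" for q
  define g :: "'a \<Rightarrow> nat \<Rightarrow> real" where
    "g x k = (if k \<in> i ` B then inner x (inv_into B i k) else 0)" for x k
  have fg: "f (g x) = x" for x
  proof -
    have "f (g x) = (\<Sum>b\<in>B. inner x b *\<^sub>R b)"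
      unfolding f_def g_def using i by (intro sum.cong) auto
    then show ?thesis by (simp add: B(2))
  qed
  have f: "continuous_on UNIV f"
    unfolding f_def
    by (intro continuous_intros continuous_on_subset[OF continuous_on_product_coordinates]) auto
  have "continuous_on UNIV (\<lambda>x. g x k)" for k
    by (cases "k \<in> i ` B") (auto simp: g_def intro!: continuous_intros)
  then have g: "continuous_on UNIV g"
    by (rule continuous_on_coordinatewise_then_product)
  obtain \<C> :: "(nat \<Rightarrow> real) set set" where C: "countable \<C>" "\<And>V. V \<in> \<C> \<Longrightarrow> open V"
    "\<And>U. open U \<Longrightarrow> \<exists>X. X \<subseteq> \<C> \<and> \<Union>X = U"
    using univ_second_countable[where 'a = "nat \<Rightarrow> real"] by metis
  show ?thesis
  proof (rule that[of "vimage g ` \<C>"])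
    show "countable (vimage g ` \<C>)" using C(1) by simp
    show "open V" if "V \<in> vimage g ` \<C>" for V
      using that C(2) open_vimage[OF _ g] by auto
    fix U and x :: 'a
    assume U: "open U" "x \<in> U"
    \<comment> \<open>Open sets are pulled back along \<open>f\<close>, base sets along
      \<open>g\<close>; the identity \<open>f (g x) = x\<close> makes the two fit together.\<close>
    have "\<exists>X. X \<subseteq> \<C> \<and> \<Union>X = f -` U"
      by (rule C(3)[OF open_vimage[OF U(1) f]])
    then obtain X where X: "X \<subseteq> \<C>" "\<Union>X = f -` U"
      by (elim exE conjE)
    have "g x \<in> \<Union>X"
      using U fg by (simp add: X)
    then obtain V where V: "V \<in> X" "g x \<in> V"
      by (elim UnionE)
    have "g -` V \<subseteq> g -` (f -` U)"
      unfolding X(2)[symmetric] using V(1) by (intro vimage_mono Union_upper)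
    also have "\<dots> \<subseteq> U"
      by (simp add: subset_iff fg)
    finally have "g -` V \<subseteq> U" .
    then show "\<exists>V\<in>vimage g ` \<C>. x \<in> V \<and> V \<subseteq> U"
      using V X by blast
  qed
qed

section \<open>Calculus of C^k maps\<close>

lemma Ck_on_Suc_has_derivative:
  "Ck_on (Suc k) S f \<Longrightarrow> x \<in> S \<Longrightarrow> (f has_derivative frechet_derivative f (at x)) (at x)"
  by (metis Ck_on.simps(2) frechet_derivative_works)

lemma Ck_on_Suc_frechet_derivative:
  "Ck_on (Suc k) S f \<Longrightarrow> Ck_on k S (\<lambda>x. frechet_derivative f (at x) v)"
  by simp

lemma Ck_on_SucI:
  assumes "\<And>x. x \<in> S \<Longrightarrow> (f has_derivative D x) (at x)"
    and "\<And>v. Ck_on k S (\<lambda>x. frechet_derivative f (at x) v)"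
  shows "Ck_on (Suc k) S f"
  using assms unfolding Ck_on.simps differentiable_def by blast

text \<open>On an open set, equality of functions passes to their Frechet derivatives and so, by
  induction, to all orders. The rules for sums, products and composites use this to replace
  \<open>frechet_derivative\<close> by an explicit formula.\<close>

lemma Ck_on_cong:
  assumes "open S" "\<And>x. x \<in> S \<Longrightarrow> f x = g x" "Ck_on k S f"
  shows "Ck_on k S g"
  using assms(2,3)
proof (induction k arbitrary: f g)
  case 0
  then show ?case using continuous_on_cong[of S S f g] by simp
next
  case (Suc k)
  have d: "(g has_derivative frechet_derivative f (at x)) (at x)" if "x \<in> S" for x
    using has_derivative_transform_within_open[OF Ck_on_Suc_has_derivative[OF Suc.prems(2) that] assms(1) that]
      Suc.prems(1) by blast
  have "Ck_on k S (\<lambda>x. frechet_derivative g (at x) v)" for v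
  proof (rule Suc.IH)
    show "frechet_derivative f (at x) v = frechet_derivative g (at x) v" if "x \<in> S" for x
      using fun_cong[OF frechet_derivative_at[OF d[OF that]]] .
    show "Ck_on k S (\<lambda>x. frechet_derivative f (at x) v)"
      by (rule Ck_on_Suc_frechet_derivative[OF Suc.prems(2)])
  qed
  from Ck_on_SucI[OF d this] show ?case by simp
qed

lemma Ck_on_SucD: "Ck_on (Suc k) S f \<Longrightarrow> Ck_on k S f"
proof (induction k arbitrary: f)
  case 0
  then show ?case
    by (simp add: continuous_at_imp_continuous_on differentiable_imp_continuous_within)
next
  case (Suc k)
  show ?case
    by (rule Ck_on_SucI[OF Ck_on_Suc_has_derivative[OF Suc.prems] Suc.IH[OF Ck_on_Suc_frechet_derivative[OF Suc.prems]]])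
qed

lemma Ck_on_subset: "Ck_on k S f \<Longrightarrow> T \<subseteq> S \<Longrightarrow> Ck_on k T f"
  by (induction k arbitrary: f) (auto intro: continuous_on_subset)

lemma Ck_on_locally:
  assumes "\<And>x. x \<in> S \<Longrightarrow> \<exists>T. open T \<and> x \<in> T \<and> Ck_on k T f"
  shows "Ck_on k S f"
  using assms
proof (induction k arbitrary: f)
  case 0
  have "isCont f x" if x: "x \<in> S" for x
  proof -
    from 0[OF x] obtain T where "open T" "x \<in> T" "continuous_on T f"
      by auto
    then show ?thesis by (simp add: continuous_on_eq_continuous_at)
  qed
  then show ?case
    by (simp add: continuous_at_imp_continuous_on)
next
  case (Suc k)
  have "f differentiable at x" if "x \<in> S" for x
    using Suc.prems[OF that] by auto
  moreover have "Ck_on k S (\<lambda>x. frechet_derivative f (at x) v)" for v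
  proof (rule Suc.IH)
    show "\<exists>T. open T \<and> x \<in> T \<and> Ck_on k T (\<lambda>x. frechet_derivative f (at x) v)" if "x \<in> S" for x
      using Suc.prems[OF that] by auto
  qed
  ultimately show ?case by simp
qed

lemma Ck_on_const: "Ck_on k S (\<lambda>_. c)"
  by (induction k arbitrary: c) simp_all

lemma Ck_on_add: "Ck_on k S f \<Longrightarrow> Ck_on k S g \<Longrightarrow> open S \<Longrightarrow> Ck_on k S (\<lambda>x. f x + g x)"
proof (induction k arbitrary: f g)
  case 0
  then show ?case by (simp add: continuous_on_add)
next
  case (Suc k)
  have d: "((\<lambda>x. f x + g x) has_derivative
      (\<lambda>v. frechet_derivative f (at x) v + frechet_derivative g (at x) v)) (at x)"
    if "x \<in> S" for x
    by (intro has_derivative_add Ck_on_Suc_has_derivative[OF Suc.prems(1) that] Ck_on_Suc_has_derivative[OF Suc.prems(2) that])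
  have "Ck_on k S (\<lambda>x. frechet_derivative (\<lambda>x. f x + g x) (at x) v)" for v
  proof (rule Ck_on_cong[OF Suc.prems(3)])
    show "Ck_on k S (\<lambda>x. frechet_derivative f (at x) v + frechet_derivative g (at x) v)"
      using Suc by auto
    show "frechet_derivative f (at x) v + frechet_derivative g (at x) v =
        frechet_derivative (\<lambda>x. f x + g x) (at x) v" if "x \<in> S" for x
      using fun_cong[OF frechet_derivative_at[OF d[OF that]]] .
  qed
  from Ck_on_SucI[OF d this] show ?case by simp
qed

text \<open>By the product rule the derivative is a sum of two products of C^k factors, to which the
  induction hypothesis applies; \<open>Ck_on_SucD\<close> supplies the factor that is not
  differentiated.\<close>

lemma (in bounded_bilinear) Ck_on:
  "Ck_on k S f \<Longrightarrow> Ck_on k S g \<Longrightarrow> open S \<Longrightarrow> Ck_on k S (\<lambda>x. prod (f x) (g x))"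
proof (induction k arbitrary: f g)
  case 0
  from continuous_on[OF 0(1,2)[unfolded Ck_on.simps]] show ?case by simp
next
  case (Suc k)
  have d: "((\<lambda>x. prod (f x) (g x)) has_derivative
      (\<lambda>v. prod (f x) (frechet_derivative g (at x) v) + prod (frechet_derivative f (at x) v) (g x))) (at x)"
    if "x \<in> S" for x
    by (rule FDERIV[OF Ck_on_Suc_has_derivative[OF Suc.prems(1) that] Ck_on_Suc_has_derivative[OF Suc.prems(2) that]])
  have "Ck_on k S (\<lambda>x. frechet_derivative (\<lambda>x. prod (f x) (g x)) (at x) v)" for v
  proof (rule Ck_on_cong[OF Suc.prems(3)])
    show "Ck_on k S (\<lambda>x. prod (f x) (frechet_derivative g (at x) v) +
        prod (frechet_derivative f (at x) v) (g x))"
      using Suc.prems Ck_on_SucD[OF Suc.prems(1)] Ck_on_SucD[OF Suc.prems(2)]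
      by (intro Ck_on_add Suc.IH) auto
    show "prod (f x) (frechet_derivative g (at x) v) + prod (frechet_derivative f (at x) v) (g x) =
        frechet_derivative (\<lambda>x. prod (f x) (g x)) (at x) v" if "x \<in> S" for x
      using fun_cong[OF frechet_derivative_at[OF d[OF that]]] .
  qed
  from Ck_on_SucI[OF d this] show ?case by simp
qed

lemma (in bounded_linear) Ck_on:
  "Ck_on k S g \<Longrightarrow> open S \<Longrightarrow> Ck_on k S (\<lambda>x. f (g x))"
proof (induction k arbitrary: g)
  case 0
  from 0(1) show ?case unfolding Ck_on.simps by (rule continuous_on)
next
  case (Suc k)
  have d: "((\<lambda>x. f (g x)) has_derivative (\<lambda>v. f (frechet_derivative g (at x) v))) (at x)"
    if "x \<in> S" for x
    by (rule has_derivative[OF Ck_on_Suc_has_derivative[OF Suc.prems(1) that]])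
  have "Ck_on k S (\<lambda>x. frechet_derivative (\<lambda>x. f (g x)) (at x) v)" for v
  proof (rule Ck_on_cong[OF Suc.prems(2)])
    show "Ck_on k S (\<lambda>x. f (frechet_derivative g (at x) v))"
      by (rule Suc.IH[OF Ck_on_Suc_frechet_derivative[OF Suc.prems(1)] Suc.prems(2)])
    show "f (frechet_derivative g (at x) v) = frechet_derivative (\<lambda>x. f (g x)) (at x) v"
      if "x \<in> S" for x
      using fun_cong[OF frechet_derivative_at[OF d[OF that]]] .
  qed
  from Ck_on_SucI[OF d this] show ?case by simp
qed

lemma Ck_on_sum:
  assumes "finite B" "open S" "\<And>b. b \<in> B \<Longrightarrow> Ck_on k S (f b)"
  shows "Ck_on k S (\<lambda>x. \<Sum>b\<in>B. f b x)"
  using assms(1,3)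
proof (induction B)
  case empty
  then show ?case by (simp add: Ck_on_const)
next
  case (insert b B)
  then have "Ck_on k S (\<lambda>x. f b x + (\<Sum>b\<in>B. f b x))"
    by (intro Ck_on_add assms(2)) blast+
  with insert.hyps show ?case by simp
qed

lemma linear_expansion:
  assumes "linear L" "\<And>x. (\<Sum>b\<in>B. inner x b *\<^sub>R b) = x"
  shows "L x = (\<Sum>b\<in>B. inner x b *\<^sub>R L b)"
proof -
  have "L x = L (\<Sum>b\<in>B. inner x b *\<^sub>R b)" by (simp only: assms(2))
  also have "\<dots> = (\<Sum>b\<in>B. inner x b *\<^sub>R L b)"
    by (simp add: linear_sum[OF assms(1)] linear_cmul[OF assms(1)])
  finally show ?thesis .
qed

text \<open>\<open>Ck_on\<close> controls derivatives in fixed directions only, whereas the chain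
  rule evaluates the derivative of \<open>g\<close> in a direction that varies with
  \<open>x\<close>. Expanding that direction over an orthonormal basis gives a finite sum of scalar
  functions times derivatives of \<open>g\<close> in fixed directions, and these are covered by the
  induction hypothesis. Hence the finite dimension of the middle space.\<close>

lemma Ck_on_compose:
  fixes g :: "'b::fin_dim_inner \<Rightarrow> 'c::real_normed_vector"
  assumes "open S" "open T" "\<And>x. x \<in> S \<Longrightarrow> f x \<in> T"
  shows "Ck_on k S f \<Longrightarrow> Ck_on k T g \<Longrightarrow> Ck_on k S (\<lambda>x. g (f x))"
proof (induction k arbitrary: g)
  case 0
  then show ?case
    using assms(3) by (auto intro!: continuous_on_compose2[of T g S f])
next
  case (Suc k)
  obtain B :: "'b set" where B: "finite B" "\<And>x. (\<Sum>b\<in>B. inner x b *\<^sub>R b) = x"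
    by (rule orthonormal_basis_expansion) blast
  have d: "((\<lambda>x. g (f x)) has_derivative
      (\<lambda>v. frechet_derivative g (at (f x)) (frechet_derivative f (at x) v))) (at x)"
    if "x \<in> S" for x
    by (intro has_derivative_compose[OF Ck_on_Suc_has_derivative[OF Suc.prems(1) that]]
        Ck_on_Suc_has_derivative[OF Suc.prems(2)] assms(3) that)
  have "Ck_on k S (\<lambda>x. frechet_derivative (\<lambda>x. g (f x)) (at x) v)" for v
  proof (rule Ck_on_cong[OF assms(1)])
    have "Ck_on k S (\<lambda>x. frechet_derivative g (at (f x)) b)" for b
      using Suc.prems(2) by (intro Suc.IH[OF Ck_on_SucD[OF Suc.prems(1)]]) simp
    moreover have "Ck_on k S (\<lambda>x. inner (frechet_derivative f (at x) v) b)" for b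
      using Suc.prems by (intro bounded_linear.Ck_on[OF bounded_linear_inner_left] assms) auto
    ultimately show "Ck_on k S (\<lambda>x. \<Sum>b\<in>B. inner (frechet_derivative f (at x) v) b *\<^sub>R
        frechet_derivative g (at (f x)) b)"
      by (intro Ck_on_sum B assms bounded_bilinear.Ck_on[OF bounded_bilinear_scaleR])
    fix x
    assume x: "x \<in> S"
    then have "linear (frechet_derivative g (at (f x)))"
      using Suc.prems assms(3) by (auto intro: linear_frechet_derivative)
    from linear_expansion[OF this B(2)] fun_cong[OF frechet_derivative_at[OF d[OF x]], of v]
    show "(\<Sum>b\<in>B. inner (frechet_derivative f (at x) v) b *\<^sub>R frechet_derivative g (at (f x)) b) =
        frechet_derivative (\<lambda>x. g (f x)) (at x) v" by metis
  qed
  from Ck_on_SucI[OF d this] show ?case by simp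
qed

lemma Ck_on_ident: "Ck_on k S (\<lambda>x. x)"
  by (cases k) (simp_all add: Ck_on_const)

lemma smooth_on_cong:
  "smooth_on S f \<Longrightarrow> open S \<Longrightarrow> (\<And>x. x \<in> S \<Longrightarrow> f x = g x) \<Longrightarrow> smooth_on S g"
  unfolding smooth_on_def by (blast intro: Ck_on_cong)

lemma smooth_on_subset: "smooth_on S f \<Longrightarrow> T \<subseteq> S \<Longrightarrow> smooth_on T f"
  unfolding smooth_on_def by (blast intro: Ck_on_subset)

lemma smooth_on_locally:
  assumes "\<And>x. x \<in> S \<Longrightarrow> \<exists>T. open T \<and> x \<in> T \<and> smooth_on T f"
  shows "smooth_on S f"
  unfolding smooth_on_def
proof (intro allI Ck_on_locally)
  show "\<exists>T. open T \<and> x \<in> T \<and> Ck_on k T f" if "x \<in> S" for x k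
    using assms[OF that] unfolding smooth_on_def by blast
qed

lemma smooth_on_ident: "smooth_on S (\<lambda>x. x)"
  by (simp add: smooth_on_def Ck_on_ident)

lemma smooth_on_bounded_linear: "bounded_linear f \<Longrightarrow> smooth_on UNIV f"
  unfolding smooth_on_def by (blast intro: bounded_linear.Ck_on[OF _ Ck_on_ident open_UNIV])

lemma smooth_on_compose:
  fixes g :: "'b::fin_dim_inner \<Rightarrow> 'c::real_normed_vector"
  assumes "smooth_on S f" "smooth_on T g" "open S" "open T" "\<And>x. x \<in> S \<Longrightarrow> f x \<in> T"
  shows "smooth_on S (\<lambda>x. g (f x))"
proof -
  have "Ck_on k S (\<lambda>x. g (f x))" for k
    using assms Ck_on_compose[of S T f k g] unfolding smooth_on_def by blast
  then show ?thesis by (simp add: smooth_on_def)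
qed

lemma smooth_on_Pair:
  assumes "smooth_on S f" "smooth_on S g" "open S"
  shows "smooth_on S (\<lambda>x. (f x, g x))"
proof -
  have "Ck_on k S (\<lambda>x. (f x, 0) + (0, g x))" for k
  proof (intro Ck_on_add assms(3))
    show "Ck_on k S (\<lambda>x. (f x, 0))" "Ck_on k S (\<lambda>x. (0, g x))"
      using assms(1,2) unfolding smooth_on_def
      by (auto intro!: bounded_linear.Ck_on[of "\<lambda>x. (x, 0)"] bounded_linear.Ck_on[of "\<lambda>x. (0, x)"]
          bounded_linear_Pair bounded_linear_ident bounded_linear_zero assms(3))
  qed
  then show ?thesis by (simp add: smooth_on_def)
qed

lemma smooth_on_fst: "smooth_on UNIV fst"
  by (rule smooth_on_bounded_linear[OF bounded_linear_fst])

lemma smooth_on_snd: "smooth_on UNIV snd"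
  by (rule smooth_on_bounded_linear[OF bounded_linear_snd])

lemma smooth_on_imp_continuous_on: "smooth_on S f \<Longrightarrow> continuous_on S f"
  unfolding smooth_on_def by (drule spec[of _ 0]) simp

lemma smooth_on_has_derivative:
  "smooth_on S f \<Longrightarrow> x \<in> S \<Longrightarrow> (f has_derivative frechet_derivative f (at x)) (at x)"
  unfolding smooth_on_def by (blast intro: Ck_on_Suc_has_derivative)

text \<open>The same expansion of the direction over a basis gives smoothness jointly in point and
  direction. In coordinates this is the fibre part of a tangent map, hence also of the transition
  maps of a tangent bundle.\<close>

lemma smooth_on_derivative:
  fixes f :: "'a::fin_dim_inner \<Rightarrow> 'b::real_normed_vector"
  assumes "smooth_on S f" "open S"
  shows "smooth_on (S \<times> UNIV) (\<lambda>z. frechet_derivative f (at (fst z)) (snd z))"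
proof -
  obtain B :: "'a set" where B: "finite B" "\<And>x. (\<Sum>b\<in>B. inner x b *\<^sub>R b) = x"
    by (rule orthonormal_basis_expansion) blast
  have o: "open (S \<times> (UNIV :: 'a set))" by (simp add: open_Times assms)
  have "Ck_on k (S \<times> (UNIV :: 'a set))
      (\<lambda>z. \<Sum>b\<in>B. inner (snd z) b *\<^sub>R frechet_derivative f (at (fst z)) b)" for k
  proof (intro Ck_on_sum B o bounded_bilinear.Ck_on[OF bounded_bilinear_scaleR])
    fix b :: 'a
    show "Ck_on k (S \<times> UNIV) (\<lambda>z. inner (snd z) b)"
      by (intro bounded_linear.Ck_on[OF bounded_linear_inner_left] o bounded_linear.Ck_on[OF bounded_linear_snd] Ck_on_ident)
    have "Ck_on k S (\<lambda>x. frechet_derivative f (at x) b)"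
      using assms(1) unfolding smooth_on_def by (intro Ck_on_Suc_frechet_derivative) blast
    from Ck_on_compose[OF o assms(2) _ bounded_linear.Ck_on[OF bounded_linear_fst Ck_on_ident o] this]
    show "Ck_on k (S \<times> (UNIV :: 'a set)) (\<lambda>z. frechet_derivative f (at (fst z)) b)"
      by auto
  qed
  then have "smooth_on (S \<times> UNIV)
      (\<lambda>z. \<Sum>b\<in>B. inner (snd z) b *\<^sub>R frechet_derivative f (at (fst z)) b)"
    by (simp add: smooth_on_def)
  then show ?thesis
  proof (rule smooth_on_cong[OF _ o])
    fix z
    assume "z \<in> S \<times> (UNIV :: 'a set)"
    then have "linear (frechet_derivative f (at (fst z)))"
      using has_derivative_linear[OF smooth_on_has_derivative[OF assms(1)]] by auto
    from linear_expansion[OF this B(2), symmetric]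
    show "(\<Sum>b\<in>B. inner (snd z) b *\<^sub>R frechet_derivative f (at (fst z)) b) =
        frechet_derivative f (at (fst z)) (snd z)" .
  qed
qed

section \<open>Pointwise smoothness of maps between manifolds\<close>

text \<open>A smooth manifold without the two global axioms. Everything local needs only this much,
  so it can be used for an induced structure before the Hausdorff property and second countability
  have been established for it.\<close>

definition smooth_atlas :: "('a, 'e::fin_dim_inner) manifold \<Rightarrow> bool"
  where "smooth_atlas M \<longleftrightarrow>
    (\<Union>c\<in>charts M. fst c) = points M \<and>
    (\<forall>c\<in>charts M. inj_on (snd c) (fst c) \<and> open (snd c ` fst c)) \<and>
    (\<forall>c\<in>charts M. \<forall>d\<in>charts M.
       open (snd c ` (fst c \<inter> fst d)) \<and> smooth_on (snd c ` (fst c \<inter> fst d)) (chart_rep c d id))"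

lemma smooth_manifold_iff_atlas:
  "smooth_manifold M \<longleftrightarrow> smooth_atlas M \<and> Hausdorff_space (mtop M) \<and> second_countable (mtop M)"
  unfolding smooth_manifold_def smooth_atlas_def by blast

abbreviation cinv :: "('a, 'e) chart \<Rightarrow> 'e \<Rightarrow> 'a"
  where "cinv c \<equiv> inv_into (fst c) (snd c)"

lemma smooth_atlasD:
  assumes "smooth_atlas M" "c \<in> charts M"
  shows "inj_on (snd c) (fst c)" "open (snd c ` fst c)" "fst c \<subseteq> points M"
    "d \<in> charts M \<Longrightarrow> open (snd c ` (fst c \<inter> fst d))"
    "d \<in> charts M \<Longrightarrow> smooth_on (snd c ` (fst c \<inter> fst d)) (chart_rep c d id)"
  using assms unfolding smooth_atlas_def by blast+

lemma smooth_atlas_chart: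
  assumes "smooth_atlas M" "x \<in> points M"
  obtains c where "c \<in> charts M" "x \<in> fst c"
  using assms unfolding smooth_atlas_def by blast

lemma cinv_chart [simp]: "smooth_atlas M \<Longrightarrow> c \<in> charts M \<Longrightarrow> x \<in> fst c \<Longrightarrow> cinv c (snd c x) = x"
  by (simp add: smooth_atlasD(1))

lemma openin_mtop_atlas:
  "smooth_atlas M \<Longrightarrow>
    openin (mtop M) W \<longleftrightarrow> W \<subseteq> points M \<and> (\<forall>c\<in>charts M. open (snd c ` (W \<inter> fst c)))"
  by (intro openin_mtop smooth_atlasD(1))

lemma openin_mtop_subset: "smooth_atlas M \<Longrightarrow> openin (mtop M) W \<Longrightarrow> W \<subseteq> points M"
  by (simp add: openin_mtop_atlas)

lemma openin_mtop_Int_points: "smooth_atlas M \<Longrightarrow> openin (mtop M) W \<Longrightarrow> points M \<inter> W = W"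
  using openin_mtop_subset by blast

lemma openin_mtop_chart:
  assumes "smooth_atlas M" "c \<in> charts M"
  shows "openin (mtop M) (fst c)"
  using assms smooth_atlasD[OF assms(1)] by (auto simp: openin_mtop_atlas Int_commute)

lemma openin_mtop_points: "smooth_atlas M \<Longrightarrow> openin (mtop M) (points M)"
  using smooth_atlasD[of M] by (auto simp: openin_mtop_atlas Int_absorb1)

lemma topspace_mtop [simp]: "smooth_atlas M \<Longrightarrow> topspace (mtop M) = points M"
  by (meson openin_mtop_points openin_mtop_subset openin_subset openin_topspace subset_antisym)

text \<open>\<open>mtop\<close> tests a set in every chart; in another chart \<open>d\<close> the
  set appears as a preimage under the transition map, which is continuous on an open set.\<close>

lemma openin_mtop_chart_preimage:
  assumes M: "smooth_atlas M" and c: "c \<in> charts M" and V: "open V"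
  shows "openin (mtop M) (fst c \<inter> snd c -` V)"
  unfolding openin_mtop_atlas[OF M]
proof (intro conjI ballI)
  fix d
  assume d: "d \<in> charts M"
  let ?A = "snd d ` (fst d \<inter> fst c)"
  have "open (?A \<inter> chart_rep d c id -` V)"
    using smooth_atlasD(4,5)[OF M d c] V
    by (intro continuous_open_preimage smooth_on_imp_continuous_on)
  also have "?A \<inter> chart_rep d c id -` V = snd d ` (fst c \<inter> snd c -` V \<inter> fst d)"
    using M d by (auto simp: chart_rep_def image_iff)
  finally show "open (snd d ` (fst c \<inter> snd c -` V \<inter> fst d))" .
qed (use smooth_atlasD(3)[OF M c] in auto)

text \<open>The neighbourhood \<open>U\<close> is required to be mapped into the domain of
  \<open>d\<close>. This builds continuity into the condition, since the representation carries no
  information at points whose image leaves \<open>fst d\<close>.\<close>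

definition smooth_rep_at ::
    "('a, 'e::real_normed_vector) chart \<Rightarrow> ('b, 'g::real_normed_vector) chart \<Rightarrow> ('a \<Rightarrow> 'b) \<Rightarrow> 'a \<Rightarrow> bool"
  where "smooth_rep_at c d f x \<longleftrightarrow> x \<in> fst c \<and>
    (\<exists>U. open U \<and> snd c x \<in> U \<and> U \<subseteq> snd c ` fst c \<and> (\<forall>y\<in>U. f (cinv c y) \<in> fst d) \<and>
         smooth_on U (chart_rep c d f))"

definition smooth_at ::
    "('a, 'e::fin_dim_inner) manifold \<Rightarrow> ('b, 'g::fin_dim_inner) manifold \<Rightarrow> ('a \<Rightarrow> 'b) \<Rightarrow> 'a \<Rightarrow> bool"
  where "smooth_at M N f x \<longleftrightarrow> (\<exists>c\<in>charts M. \<exists>d\<in>charts N. smooth_rep_at c d f x)"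

text \<open>Near the point the new representation is the old one composed with a transition map on
  either side. This makes the existential choice of charts in \<open>smooth_at\<close>
  harmless.\<close>

lemma smooth_rep_at_change:
  assumes M: "smooth_atlas M" and N: "smooth_atlas N"
    and c: "c \<in> charts M" "c' \<in> charts M" and d: "d \<in> charts N" "d' \<in> charts N"
    and f: "smooth_rep_at c d f x" and x: "x \<in> fst c'" "f x \<in> fst d'"
  shows "smooth_rep_at c' d' f x"
proof -
  from f obtain U where xc: "x \<in> fst c" and U: "open U" "snd c x \<in> U" "U \<subseteq> snd c ` fst c"
    "\<forall>y\<in>U. f (cinv c y) \<in> fst d" "smooth_on U (chart_rep c d f)"
    unfolding smooth_rep_at_def by blast
  define A where "A = snd c' ` (fst c' \<inter> fst c)"
  define B where "B = snd d ` (fst d \<inter> fst d')"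
  have A: "open A" "smooth_on A (chart_rep c' c id)"
    unfolding A_def using smooth_atlasD(4,5)[OF M c(2,1)] by auto
  have B: "open B" "smooth_on B (chart_rep d d' id)"
    unfolding B_def using smooth_atlasD(4,5)[OF N d] by auto
  define U2 where "U2 = U \<inter> chart_rep c d f -` B"
  have U2: "open U2"
    unfolding U2_def using U(1,5) B(1) by (intro continuous_open_preimage smooth_on_imp_continuous_on)
  \<comment> \<open>Here all three maps of the composite are defined: the change from
    \<open>c'\<close> to \<open>c\<close> lands in \<open>U\<close>, and the values of
    \<open>f\<close> lie in the overlap of \<open>d\<close> and \<open>d'\<close>.\<close>
  define V where "V = A \<inter> chart_rep c' c id -` U2"
  have V: "open V"
    unfolding V_def using A U2 by (intro continuous_open_preimage smooth_on_imp_continuous_on)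
  have Vx: "\<exists>z\<in>fst c' \<inter> fst c. y = snd c' z \<and> cinv c' y = z \<and> snd c z \<in> U \<and> f z \<in> fst d \<inter> fst d'"
    if y: "y \<in> V" for y
  proof -
    from y obtain z where z: "z \<in> fst c'" "z \<in> fst c" "y = snd c' z" "snd c z \<in> U2"
      using M c by (auto simp: V_def A_def chart_rep_def)
    then have "snd c z \<in> U" "snd d (f z) \<in> B"
      using M c by (auto simp: U2_def chart_rep_def)
    moreover from this have "f z \<in> fst d"
      using U(4) M c z by force
    ultimately have "f z \<in> fst d \<inter> fst d'"
      using smooth_atlasD(1)[OF N d(1)] unfolding B_def by (auto dest: inj_onD)
    then show ?thesis
      using z M c \<open>snd c z \<in> U\<close> by auto
  qed
  have fxd: "f x \<in> fst d"
    using U(2,4) M c xc by force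
  have "snd c' x \<in> V"
    using x xc U(2) M c fxd by (auto simp: V_def A_def U2_def B_def chart_rep_def)
  moreover have "smooth_on V (chart_rep c' d' f)"
  proof -
    have 1: "smooth_on U2 (\<lambda>y. chart_rep d d' id (chart_rep c d f y))"
      by (rule smooth_on_compose[OF smooth_on_subset[OF U(5)] B(2) U2 B(1)]) (auto simp: U2_def)
    have "smooth_on V (\<lambda>y. chart_rep d d' id (chart_rep c d f (chart_rep c' c id y)))"
      by (rule smooth_on_compose[OF smooth_on_subset[OF A(2)] 1 V U2]) (auto simp: V_def)
    then show ?thesis
    proof (rule smooth_on_cong[OF _ V])
      fix y
      assume "y \<in> V"
      then show "chart_rep d d' id (chart_rep c d f (chart_rep c' c id y)) = chart_rep c' d' f y"
        using Vx[of y] M N c d by (auto simp: chart_rep_def)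
    qed
  qed
  moreover have "V \<subseteq> snd c' ` fst c'"
    by (auto simp: V_def A_def)
  moreover have "\<forall>y\<in>V. f (cinv c' y) \<in> fst d'"
    using Vx by fastforce
  ultimately show ?thesis
    unfolding smooth_rep_at_def using x V by blast
qed

lemma smooth_at_chartsD:
  assumes "smooth_atlas M" "smooth_atlas N" "smooth_at M N f x"
    and "c \<in> charts M" "x \<in> fst c" "d \<in> charts N" "f x \<in> fst d"
  shows "smooth_rep_at c d f x"
  using assms unfolding smooth_at_def by (blast intro: smooth_rep_at_change)

lemma smooth_rep_at_in:
  "smooth_rep_at c d f x \<Longrightarrow> inj_on (snd c) (fst c) \<Longrightarrow> f x \<in> fst d"
  unfolding smooth_rep_at_def by force

lemma smooth_at_obtain:
  assumes "smooth_atlas M" "smooth_atlas N" "smooth_at M N f x"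
  obtains c d where "c \<in> charts M" "x \<in> fst c" "d \<in> charts N" "f x \<in> fst d" "smooth_rep_at c d f x"
proof -
  from assms(3) obtain c d where cd: "c \<in> charts M" "d \<in> charts N" "smooth_rep_at c d f x"
    unfolding smooth_at_def by blast
  then have "x \<in> fst c" by (simp add: smooth_rep_at_def)
  with cd smooth_rep_at_in[OF cd(3) smooth_atlasD(1)[OF assms(1) cd(1)]] show ?thesis
    by (intro that)
qed

lemma smooth_at_points:
  assumes "smooth_atlas M" "smooth_atlas N" "smooth_at M N f x"
  shows "x \<in> points M" "f x \<in> points N"
proof -
  from assms(3) obtain c d where cd: "c \<in> charts M" "d \<in> charts N" "smooth_rep_at c d f x"
    unfolding smooth_at_def by blast
  then show "x \<in> points M"
    using smooth_atlasD(3)[OF assms(1) cd(1)] by (auto simp: smooth_rep_at_def)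
  show "f x \<in> points N"
    using smooth_rep_at_in[OF cd(3)] smooth_atlasD(1)[OF assms(1)] smooth_atlasD(3)[OF assms(2)] cd by blast
qed

text \<open>The representation is continuous and the values near \<open>x\<close> stay in the domain
  of \<open>d\<close>, where injectivity of the coordinate map turns a condition on coordinates into
  one on points.\<close>

lemma smooth_at_continuous:
  assumes M: "smooth_atlas M" and N: "smooth_atlas N" and f: "smooth_at M N f x"
    and V: "openin (mtop N) V" "f x \<in> V"
  obtains W where "openin (mtop M) W" "x \<in> W" "\<And>y. y \<in> W \<Longrightarrow> f y \<in> V"
proof -
  obtain c d where cd: "c \<in> charts M" "x \<in> fst c" "d \<in> charts N" "f x \<in> fst d" "smooth_rep_at c d f x"
    by (rule smooth_at_obtain[OF M N f])
  then obtain U where U: "open U" "snd c x \<in> U" "U \<subseteq> snd c ` fst c"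
    "\<forall>y\<in>U. f (cinv c y) \<in> fst d" "smooth_on U (chart_rep c d f)"
    unfolding smooth_rep_at_def by blast
  define Q where "Q = U \<inter> chart_rep c d f -` (snd d ` (V \<inter> fst d))"
  have "open (snd d ` (V \<inter> fst d))"
    using V(1) cd(3) by (simp add: openin_mtop_atlas[OF N])
  then have Q: "open Q"
    unfolding Q_def using U by (intro continuous_open_preimage smooth_on_imp_continuous_on)
  show ?thesis
  proof (rule that)
    show "openin (mtop M) (fst c \<inter> snd c -` Q)"
      by (rule openin_mtop_chart_preimage[OF M cd(1) Q])
    show "x \<in> fst c \<inter> snd c -` Q"
      using cd U V M by (auto simp: Q_def chart_rep_def)
    fix y
    assume y: "y \<in> fst c \<inter> snd c -` Q"
    then have "f y \<in> fst d"
      using U(4) M cd by (force simp: Q_def)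
    moreover obtain z where "z \<in> V" "z \<in> fst d" "snd d (f y) = snd d z"
      using y M cd by (auto simp: Q_def chart_rep_def)
    ultimately show "f y \<in> V"
      using smooth_atlasD(1)[OF N cd(3)] by (auto dest: inj_onD)
  qed
qed

lemma smooth_at_cong:
  assumes M: "smooth_atlas M" and f: "smooth_at M N f x"
    and W: "openin (mtop M) W" "x \<in> W" "\<And>y. y \<in> W \<Longrightarrow> f y = g y"
  shows "smooth_at M N g x"
proof -
  from f obtain c d where cd: "c \<in> charts M" "d \<in> charts N" "smooth_rep_at c d f x"
    unfolding smooth_at_def by blast
  then obtain U where xc: "x \<in> fst c" and U: "open U" "snd c x \<in> U" "U \<subseteq> snd c ` fst c"
    "\<forall>y\<in>U. f (cinv c y) \<in> fst d" "smooth_on U (chart_rep c d f)"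
    unfolding smooth_rep_at_def by blast
  define V where "V = U \<inter> snd c ` (W \<inter> fst c)"
  have V: "open V"
    using W(1) cd(1) U(1) by (auto simp: V_def openin_mtop_atlas[OF M])
  have eq: "f (cinv c y) = g (cinv c y)" if "y \<in> V" for y
    using that W(3) M cd(1) by (auto simp: V_def)
  have "smooth_on V (chart_rep c d g)"
    by (rule smooth_on_cong[OF smooth_on_subset[OF U(5)] V])
      (auto simp: chart_rep_def eq, auto simp: V_def)
  moreover have "\<forall>y\<in>V. g (cinv c y) \<in> fst d"
    using U(4) by (auto simp: eq[symmetric]) (auto simp: V_def)
  moreover have "snd c x \<in> V" "V \<subseteq> snd c ` fst c"
    using U W(2) xc by (auto simp: V_def)
  ultimately show ?thesis
    unfolding smooth_at_def smooth_rep_at_def using cd(1,2) xc V by blast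
qed

lemma smooth_at_compose:
  assumes M: "smooth_atlas M" and N: "smooth_atlas N" and P: "smooth_atlas P"
    and f: "smooth_at M N f x" and g: "smooth_at N P g (f x)"
  shows "smooth_at M P (\<lambda>x. g (f x)) x"
proof -
  obtain c d where cd: "c \<in> charts M" "x \<in> fst c" "d \<in> charts N" "f x \<in> fst d" "smooth_rep_at c d f x"
    by (rule smooth_at_obtain[OF M N f])
  obtain e where e: "e \<in> charts P" "g (f x) \<in> fst e"
    using smooth_atlas_chart[OF P] smooth_at_points(2)[OF N P g] by metis
  have g': "smooth_rep_at d e g (f x)"
    by (rule smooth_at_chartsD[OF N P g cd(3,4) e])
  from cd obtain U where U: "open U" "snd c x \<in> U" "U \<subseteq> snd c ` fst c"
    "\<forall>y\<in>U. f (cinv c y) \<in> fst d" "smooth_on U (chart_rep c d f)"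
    unfolding smooth_rep_at_def by blast
  from g' obtain V where V: "open V" "snd d (f x) \<in> V" "V \<subseteq> snd d ` fst d"
    "\<forall>y\<in>V. g (cinv d y) \<in> fst e" "smooth_on V (chart_rep d e g)"
    unfolding smooth_rep_at_def by blast
  define W where "W = U \<inter> chart_rep c d f -` V"
  have W: "open W"
    unfolding W_def using U V by (intro continuous_open_preimage smooth_on_imp_continuous_on)
  have Wy: "cinv d (chart_rep c d f y) = f (cinv c y)" if "y \<in> W" for y
    using that U(4) N cd by (auto simp: W_def chart_rep_def)
  have "smooth_on W (\<lambda>y. chart_rep d e g (chart_rep c d f y))"
    by (rule smooth_on_compose[OF smooth_on_subset[OF U(5)] V(5) W V(1)]) (auto simp: W_def)
  then have "smooth_on W (chart_rep c e (\<lambda>x. g (f x)))"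
    by (rule smooth_on_cong[OF _ W]) (use Wy in \<open>simp add: chart_rep_def\<close>)
  moreover have "\<forall>y\<in>W. g (f (cinv c y)) \<in> fst e"
    using Wy V(4) by (metis IntD2 W_def vimageD)
  moreover have "snd c x \<in> W" "W \<subseteq> snd c ` fst c"
    using U V M cd by (auto simp: W_def chart_rep_def)
  ultimately have "smooth_rep_at c e (\<lambda>x. g (f x)) x"
    unfolding smooth_rep_at_def using cd W by blast
  then show ?thesis
    unfolding smooth_at_def using cd e by blast
qed

text \<open>Smoothness of a representation and openness of its domain are both local, so the
  neighbourhoods provided by \<open>smooth_at\<close> can be glued. This bridge is used at the two
  ends of the argument, to unfold hypotheses and to restore the official notion.\<close>

lemma smooth_map_iff_smooth_at:
  assumes M: "smooth_atlas M" and N: "smooth_atlas N"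
  shows "smooth_map M N f \<longleftrightarrow> (\<forall>x\<in>points M. smooth_at M N f x)"
proof
  assume f: "smooth_map M N f"
  show "\<forall>x\<in>points M. smooth_at M N f x"
  proof
    fix x
    assume x: "x \<in> points M"
    obtain c where c: "c \<in> charts M" "x \<in> fst c"
      by (rule smooth_atlas_chart[OF M x])
    have "f x \<in> points N" using f x by (auto simp: smooth_map_def)
    then obtain d where d: "d \<in> charts N" "f x \<in> fst d"
      by (rule smooth_atlas_chart[OF N])
    have "open (snd c ` (fst c \<inter> f -` fst d))" "smooth_on (snd c ` (fst c \<inter> f -` fst d)) (chart_rep c d f)"
      using f c d by (auto simp: smooth_map_def)
    then have "smooth_rep_at c d f x"
      unfolding smooth_rep_at_def using c d M
      by (intro conjI exI[of _ "snd c ` (fst c \<inter> f -` fst d)"]) auto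
    then show "smooth_at M N f x"
      unfolding smooth_at_def using c d by blast
  qed
next
  assume f: "\<forall>x\<in>points M. smooth_at M N f x"
  show "smooth_map M N f"
    unfolding smooth_map_def
  proof (intro conjI ballI)
    show "f \<in> points M \<rightarrow> points N"
      using f smooth_at_points(2)[OF M N] by blast
    fix c d
    assume c: "c \<in> charts M" and d: "d \<in> charts N"
    have "\<exists>U. open U \<and> y \<in> U \<and> U \<subseteq> snd c ` (fst c \<inter> f -` fst d) \<and> smooth_on U (chart_rep c d f)"
      if y: "y \<in> snd c ` (fst c \<inter> f -` fst d)" for y
    proof -
      obtain x where x: "x \<in> fst c" "f x \<in> fst d" "y = snd c x" using y by auto
      then have "smooth_rep_at c d f x"
        using f c d M smooth_atlasD(3)[OF M c] by (intro smooth_at_chartsD[OF M N]) auto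
      then obtain U where U: "open U" "snd c x \<in> U" "U \<subseteq> snd c ` fst c"
        "\<forall>y\<in>U. f (cinv c y) \<in> fst d" "smooth_on U (chart_rep c d f)"
        unfolding smooth_rep_at_def by blast
      then have "U \<subseteq> snd c ` (fst c \<inter> f -` fst d)"
        using M c by force
      with U x show ?thesis by blast
    qed
    then show "open (snd c ` (fst c \<inter> f -` fst d))"
      "smooth_on (snd c ` (fst c \<inter> f -` fst d)) (chart_rep c d f)"
      using open_subopen[of "snd c ` (fst c \<inter> f -` fst d)"]
        smooth_on_locally[of "snd c ` (fst c \<inter> f -` fst d)" "chart_rep c d f"] by meson+
  qed
qed

lemma smooth_at_ident:
  assumes M: "smooth_atlas M" and x: "x \<in> points M"
  shows "smooth_at M M (\<lambda>x. x) x"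
proof -
  obtain c where c: "c \<in> charts M" "x \<in> fst c"
    by (rule smooth_atlas_chart[OF M x])
  have "smooth_on (snd c ` fst c) (chart_rep c c (\<lambda>x. x))"
    by (rule smooth_on_cong[OF smooth_on_ident smooth_atlasD(2)[OF M c(1)]])
      (use M c in \<open>auto simp: chart_rep_def\<close>)
  then have "smooth_rep_at c c (\<lambda>x. x) x"
    unfolding smooth_rep_at_def using c M smooth_atlasD(2)[OF M c(1)]
    by (intro conjI exI[of _ "snd c ` fst c"]) auto
  then show ?thesis
    unfolding smooth_at_def using c by blast
qed

section \<open>The model space as a manifold\<close>

lemma charts_euclid [simp]: "charts euclid = {(UNIV, id)}"
  and points_euclid [simp]: "points euclid = UNIV"
  by (simp_all add: euclid_def)

lemma smooth_atlas_euclid [simp]: "smooth_atlas euclid"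
proof -
  have "smooth_on UNIV (id :: 'a \<Rightarrow> 'a)"
    using smooth_on_ident[of UNIV] by (simp add: id_def)
  then show ?thesis by (simp add: smooth_atlas_def chart_rep_def)
qed

lemma openin_mtop_euclid [simp]: "openin (mtop (euclid :: ('e::fin_dim_inner, 'e) manifold)) W \<longleftrightarrow> open W"
  by (simp add: openin_mtop_atlas)

lemma smooth_at_euclid_iff: "smooth_at euclid euclid f x \<longleftrightarrow> (\<exists>U. open U \<and> x \<in> U \<and> smooth_on U f)"
  by (simp add: smooth_at_def smooth_rep_at_def chart_rep_def)

lemma smooth_at_chart:
  assumes M: "smooth_atlas M" and c: "c \<in> charts M" "x \<in> fst c"
  shows "smooth_at M euclid (snd c) x"
proof -
  have "smooth_on (snd c ` fst c) (chart_rep c (UNIV, id) (snd c))"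
    by (rule smooth_on_cong[OF smooth_on_ident smooth_atlasD(2)[OF M c(1)]])
      (use M c in \<open>auto simp: chart_rep_def\<close>)
  then have "smooth_rep_at c (UNIV, id) (snd c) x"
    unfolding smooth_rep_at_def using c smooth_atlasD(2)[OF M c(1)]
    by (intro conjI exI[of _ "snd c ` fst c"]) auto
  then show ?thesis
    unfolding smooth_at_def using c by auto
qed

lemma smooth_at_cinv:
  assumes M: "smooth_atlas M" and c: "c \<in> charts M" "y \<in> snd c ` fst c"
  shows "smooth_at euclid M (cinv c) y"
proof -
  have "smooth_on (snd c ` fst c) (chart_rep (UNIV, id) c (cinv c))"
    by (rule smooth_on_cong[OF smooth_on_ident smooth_atlasD(2)[OF M c(1)]])
      (use M c in \<open>auto simp: chart_rep_def\<close>)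
  then have "smooth_rep_at (UNIV, id) c (cinv c) y"
    unfolding smooth_rep_at_def using c M smooth_atlasD(2)[OF M c(1)]
    by (intro conjI exI[of _ "snd c ` fst c"]) auto
  then show ?thesis
    unfolding smooth_at_def using c by auto
qed

lemma smooth_at_compose_smooth_on:
  assumes "smooth_atlas M" "smooth_at M euclid f x" "smooth_on U g" "open U" "f x \<in> U"
  shows "smooth_at M euclid (\<lambda>x. g (f x)) x"
  by (rule smooth_at_compose[OF assms(1) _ _ assms(2)])
    (use assms in \<open>auto simp: smooth_at_euclid_iff\<close>)

lemma smooth_at_Pair_euclid:
  assumes M: "smooth_atlas M" and f: "smooth_at M euclid f x" and g: "smooth_at M euclid g x"
  shows "smooth_at M euclid (\<lambda>x. (f x, g x)) x"
proof -
  obtain c where c: "c \<in> charts M" "x \<in> fst c"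
    using smooth_atlas_chart[OF M] smooth_at_points(1)[OF M _ f] by auto
  have "smooth_rep_at c (UNIV, id) f x" "smooth_rep_at c (UNIV, id) g x"
    using smooth_at_chartsD[OF M _ f c] smooth_at_chartsD[OF M _ g c] by auto
  then obtain U V where U: "open U" "snd c x \<in> U" "U \<subseteq> snd c ` fst c" "smooth_on U (chart_rep c (UNIV, id) f)"
    and V: "open V" "snd c x \<in> V" "V \<subseteq> snd c ` fst c" "smooth_on V (chart_rep c (UNIV, id) g)"
    unfolding smooth_rep_at_def by blast
  have "smooth_on (U \<inter> V) (\<lambda>y. (chart_rep c (UNIV, id) f y, chart_rep c (UNIV, id) g y))"
    using U V by (intro smooth_on_Pair) (auto intro: smooth_on_subset)
  then have "smooth_rep_at c (UNIV, id) (\<lambda>x. (f x, g x)) x"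
    unfolding smooth_rep_at_def using U V c
    by (intro conjI exI[of _ "U \<inter> V"]) (auto simp: chart_rep_def comp_def)
  then show ?thesis
    unfolding smooth_at_def using c by auto
qed

lemma smooth_at_add:
  fixes f :: "'a \<Rightarrow> 'g::fin_dim_inner"
  assumes M: "smooth_atlas M" and f: "smooth_at M euclid f x" and g: "smooth_at M euclid g x"
  shows "smooth_at M euclid (\<lambda>x. f x + g x) x"
proof -
  have "smooth_on UNIV (\<lambda>z :: 'g \<times> 'g. fst z + snd z)"
    by (intro smooth_on_bounded_linear bounded_linear_add bounded_linear_fst bounded_linear_snd)
  from smooth_at_compose_smooth_on[OF M smooth_at_Pair_euclid[OF M f g] this]
  show ?thesis by simp
qed

lemma smooth_at_scaleR:
  assumes M: "smooth_atlas M" and f: "smooth_at M euclid f x"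
  shows "smooth_at M euclid (\<lambda>x. r *\<^sub>R f x) x"
  using smooth_at_compose_smooth_on[OF M f smooth_on_bounded_linear[OF bounded_linear_scaleR_right]] by simp

subsection \<open>Open submanifolds and products\<close>

lemma points_open_sub [simp]: "points (open_sub M W) = points M \<inter> W"
  by (simp add: open_sub_def)

lemma cinv_restrict:
  assumes "inj_on f A" "y \<in> f ` (A \<inter> W)"
  shows "inv_into (A \<inter> W) f y = inv_into A f y"
  using assms by (auto simp: inv_into_f_f inj_on_Int)

lemma charts_open_sub: "charts (open_sub M W) = (\<lambda>c. (fst c \<inter> W, snd c)) ` charts M"
  by (simp add: open_sub_def)

text \<open>Only the trace of \<open>W\<close> on the manifold is assumed open: the sets that occur
  are preimages under bundle projections, which may contain elements of the type outside
  \<open>points M\<close>.\<close>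

lemma smooth_atlas_open_sub:
  assumes M: "smooth_atlas M" and W: "openin (mtop M) (points M \<inter> W)"
  shows "smooth_atlas (open_sub M W)"
proof -
  have op: "open (snd c ` (fst c \<inter> W))" if c: "c \<in> charts M" for c
  proof -
    have "points M \<inter> W \<inter> fst c = fst c \<inter> W"
      using smooth_atlasD(3)[OF M c] by blast
    moreover have "open (snd c ` (points M \<inter> W \<inter> fst c))"
      using W c by (simp add: openin_mtop_atlas[OF M])
    ultimately show ?thesis by simp
  qed
  have op2: "open (snd c ` (fst c \<inter> W \<inter> (fst d \<inter> W)))"
    and sm2: "smooth_on (snd c ` (fst c \<inter> W \<inter> (fst d \<inter> W))) (chart_rep (fst c \<inter> W, snd c) (fst d \<inter> W, snd d) id)"
    if c: "c \<in> charts M" and d: "d \<in> charts M" for c d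
  proof -
    have "snd c ` (fst c \<inter> W) \<inter> snd c ` (fst c \<inter> fst d) = snd c ` (fst c \<inter> W \<inter> (fst d \<inter> W))"
      using smooth_atlasD(1)[OF M c] by (auto dest: inj_onD)
    then show o: "open (snd c ` (fst c \<inter> W \<inter> (fst d \<inter> W)))"
      using op[OF c] smooth_atlasD(4)[OF M c d] by (metis open_Int)
    show "smooth_on (snd c ` (fst c \<inter> W \<inter> (fst d \<inter> W))) (chart_rep (fst c \<inter> W, snd c) (fst d \<inter> W, snd d) id)"
    proof (rule smooth_on_cong[OF smooth_on_subset[OF smooth_atlasD(5)[OF M c d]] o])
      fix y
      assume "y \<in> snd c ` (fst c \<inter> W \<inter> (fst d \<inter> W))"
      then show "chart_rep c d id y = chart_rep (fst c \<inter> W, snd c) (fst d \<inter> W, snd d) id y"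
        by (auto simp: chart_rep_def cinv_restrict[OF smooth_atlasD(1)[OF M c]])
    qed auto
  qed
  show ?thesis
    unfolding smooth_atlas_def charts_open_sub points_open_sub
    using smooth_atlasD(1)[OF M] op op2 sm2 M
    by (auto simp: smooth_atlas_def intro: inj_on_subset)
qed

lemma smooth_at_open_sub_dom:
  fixes N :: "('b, 'g::fin_dim_inner) manifold"
  assumes M: "smooth_atlas M" and W: "openin (mtop M) (points M \<inter> W)"
  shows "smooth_at (open_sub M W) N f x \<longleftrightarrow> smooth_at M N f x \<and> x \<in> W"
proof -
  have "smooth_rep_at (fst c \<inter> W, snd c) d f x \<longleftrightarrow> smooth_rep_at c d f x \<and> x \<in> W"
    if c: "c \<in> charts M" for c and d :: "('b, 'g) chart"
  proof
    assume "smooth_rep_at (fst c \<inter> W, snd c) d f x"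
    then obtain U where x: "x \<in> fst c" "x \<in> W" and
      U: "open U" "snd c x \<in> U" "U \<subseteq> snd c ` (fst c \<inter> W)" 
        "\<forall>y\<in>U. f (inv_into (fst c \<inter> W) (snd c) y) \<in> fst d" "smooth_on U (chart_rep (fst c \<inter> W, snd c) d f)"
      unfolding smooth_rep_at_def by auto
    have eq: "inv_into (fst c \<inter> W) (snd c) y = cinv c y" if "y \<in> U" for y
      using that U(3) cinv_restrict[OF smooth_atlasD(1)[OF M c]] by blast
    have "smooth_on U (chart_rep c d f)"
      by (rule smooth_on_cong[OF U(5,1)]) (simp add: chart_rep_def eq)
    then show "smooth_rep_at c d f x \<and> x \<in> W"
      unfolding smooth_rep_at_def using x U eq by (intro conjI exI[of _ U]) auto
  next
    assume a: "smooth_rep_at c d f x \<and> x \<in> W"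
    then obtain U where x: "x \<in> fst c" "x \<in> W" and
      U: "open U" "snd c x \<in> U" "U \<subseteq> snd c ` fst c" 
        "\<forall>y\<in>U. f (cinv c y) \<in> fst d" "smooth_on U (chart_rep c d f)"
      unfolding smooth_rep_at_def by auto
    define V where "V = U \<inter> snd c ` (fst c \<inter> W)"
    have "points M \<inter> W \<inter> fst c = fst c \<inter> W"
      using smooth_atlasD(3)[OF M c] by blast
    moreover have "open (snd c ` (points M \<inter> W \<inter> fst c))"
      using W c by (simp add: openin_mtop_atlas[OF M])
    ultimately have V: "open V"
      using U(1) by (simp add: V_def open_Int)
    have eq: "inv_into (fst c \<inter> W) (snd c) y = cinv c y" if "y \<in> V" for y
      using that cinv_restrict[OF smooth_atlasD(1)[OF M c]] by (auto simp: V_def)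
    have "smooth_on V (chart_rep (fst c \<inter> W, snd c) d f)"
      by (rule smooth_on_cong[OF smooth_on_subset[OF U(5)] V]) (auto simp: chart_rep_def eq, auto simp: V_def)
    moreover have "\<forall>y\<in>V. f (cinv c y) \<in> fst d" "snd c x \<in> V" "V \<subseteq> snd c ` (fst c \<inter> W)"
      using U x by (auto simp: V_def)
    ultimately show "smooth_rep_at (fst c \<inter> W, snd c) d f x"
      unfolding smooth_rep_at_def using x V eq by (intro conjI exI[of _ V]) auto
  qed
  then show ?thesis
    unfolding smooth_at_def charts_open_sub by blast
qed

lemma smooth_at_open_sub_cod:
  assumes M: "smooth_atlas M" and N: "smooth_atlas N" and W: "openin (mtop N) (points N \<inter> W)"
  shows "smooth_at M (open_sub N W) f x \<longleftrightarrow> smooth_at M N f x \<and> f x \<in> W"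
proof
  note NW = smooth_atlas_open_sub[OF N W]
  assume f: "smooth_at M (open_sub N W) f x"
  have fx: "f x \<in> points N \<inter> W"
    using smooth_at_points(2)[OF M NW f] by simp
  then have "smooth_at (open_sub N W) N (\<lambda>x. x) (f x)"
    by (simp add: smooth_at_open_sub_dom[OF N W] smooth_at_ident[OF N])
  from smooth_at_compose[OF M NW N f this] fx
  show "smooth_at M N f x \<and> f x \<in> W" by simp
next
  assume f: "smooth_at M N f x \<and> f x \<in> W"
  then obtain c d where cd: "c \<in> charts M" "x \<in> fst c" "d \<in> charts N" "f x \<in> fst d" "smooth_rep_at c d f x"
    using smooth_at_obtain[OF M N] by blast
  then obtain U where U: "open U" "snd c x \<in> U" "U \<subseteq> snd c ` fst c"
    "\<forall>y\<in>U. f (cinv c y) \<in> fst d" "smooth_on U (chart_rep c d f)"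
    unfolding smooth_rep_at_def by blast
  define V where "V = U \<inter> chart_rep c d f -` (snd d ` (points N \<inter> W \<inter> fst d))"
  have "open (snd d ` (points N \<inter> W \<inter> fst d))"
    using W cd(3) by (simp add: openin_mtop_atlas[OF N])
  then have V: "open V"
    unfolding V_def using U by (intro continuous_open_preimage smooth_on_imp_continuous_on)
  have "snd c x \<in> V"
    using f cd U M smooth_atlasD(3)[OF N cd(3)] by (auto simp: V_def chart_rep_def)
  moreover have "f (cinv c y) \<in> fst d \<inter> W" if y: "y \<in> V" for y
  proof -
    have "f (cinv c y) \<in> fst d" using y U by (auto simp: V_def)
    then show ?thesis
      using y smooth_atlasD(1)[OF N cd(3)] by (auto simp: V_def chart_rep_def dest: inj_onD)
  qed
  moreover have "smooth_on V (chart_rep c (fst d \<inter> W, snd d) f)"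
    by (rule smooth_on_cong[OF smooth_on_subset[OF U(5)] V]) (auto simp: chart_rep_def V_def)
  ultimately have "smooth_rep_at c (fst d \<inter> W, snd d) f x"
    unfolding smooth_rep_at_def using cd U V
    by (intro conjI exI[of _ V]) (auto simp: V_def)
  then show "smooth_at M (open_sub N W) f x"
    unfolding smooth_at_def charts_open_sub using cd by blast
qed

section \<open>Products\<close>

lemma points_prod_manifold [simp]: "points (prod_manifold M N) = points M \<times> points N"
  by (simp add: prod_manifold_def)

lemma charts_prod_manifold:
  "charts (prod_manifold M N) = (\<lambda>(c, d). (fst c \<times> fst d, map_prod (snd c) (snd d))) ` (charts M \<times> charts N)"
  by (simp add: prod_manifold_def)

lemma inv_into_map_prod:
  assumes "inj_on f A" "inj_on g B" "y \<in> f ` A" "z \<in> g ` B"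
  shows "inv_into (A \<times> B) (map_prod f g) (y, z) = (inv_into A f y, inv_into B g z)"
  using assms by (intro inv_into_f_eq) (auto simp: map_prod_inj_on inv_into_into f_inv_into_f)

lemma smooth_atlas_prod:
  fixes M :: "('a, 'e::fin_dim_inner) manifold" and N :: "('b, 'g::fin_dim_inner) manifold"
  assumes M: "smooth_atlas M" and N: "smooth_atlas N"
  shows "smooth_atlas (prod_manifold M N)"
proof -
  let ?P = "\<lambda>c d. (fst c \<times> fst d, map_prod (snd c) (snd d))"
  have img: "map_prod (snd c) (snd d) ` (A \<times> B) = snd c ` A \<times> snd d ` B"
    for c :: "('a, 'e) chart" and d :: "('b, 'g) chart" and A B by auto
  have "smooth_on (snd c ` (fst c \<inter> fst c') \<times> snd d ` (fst d \<inter> fst d')) (chart_rep (?P c d) (?P c' d') id)"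
    if c: "c \<in> charts M" "c' \<in> charts M" and d: "d \<in> charts N" "d' \<in> charts N" for c c' d d'
  proof -
    let ?A = "snd c ` (fst c \<inter> fst c')" and ?B = "snd d ` (fst d \<inter> fst d')"
    have o: "open (?A \<times> ?B)"
      using smooth_atlasD(4)[OF M c] smooth_atlasD(4)[OF N d] by (rule open_Times)
    have "smooth_on (?A \<times> ?B) (\<lambda>z. (chart_rep c c' id (fst z), chart_rep d d' id (snd z)))"
    proof (rule smooth_on_Pair[OF _ _ o])
      show "smooth_on (?A \<times> ?B) (\<lambda>z. chart_rep c c' id (fst z))"
        by (rule smooth_on_compose[OF smooth_on_subset[OF smooth_on_fst] smooth_atlasD(5)[OF M c] o smooth_atlasD(4)[OF M c]]) auto
      show "smooth_on (?A \<times> ?B) (\<lambda>z. chart_rep d d' id (snd z))"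
        by (rule smooth_on_compose[OF smooth_on_subset[OF smooth_on_snd] smooth_atlasD(5)[OF N d] o smooth_atlasD(4)[OF N d]]) auto
    qed
    then show ?thesis
    proof (rule smooth_on_cong[OF _ o])
      fix z
      assume "z \<in> ?A \<times> ?B"
      then show "(chart_rep c c' id (fst z), chart_rep d d' id (snd z)) = chart_rep (?P c d) (?P c' d') id z"
        using inv_into_map_prod[OF smooth_atlasD(1)[OF M c(1)] smooth_atlasD(1)[OF N d(1)]]
        by (auto simp: chart_rep_def)
    qed
  qed
  moreover have "(\<Union>c\<in>charts (prod_manifold M N). fst c) = points (prod_manifold M N)"
  proof -
    have "points M = (\<Union>c\<in>charts M. fst c)" "points N = (\<Union>c\<in>charts N. fst c)"
      using M N by (simp_all add: smooth_atlas_def)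
    then show ?thesis
      unfolding charts_prod_manifold points_prod_manifold by force
  qed
  moreover have "open (map_prod (snd c) (snd d) ` (fst c \<times> fst d \<inter> fst c' \<times> fst d'))"
    "open (map_prod (snd c) (snd d) ` (fst c \<times> fst d))"
    "inj_on (map_prod (snd c) (snd d)) (fst c \<times> fst d)"
    if "c \<in> charts M" "c' \<in> charts M" "d \<in> charts N" "d' \<in> charts N" for c c' d d'
    using smooth_atlasD(1,2)[OF M that(1)] smooth_atlasD(1,2)[OF N that(3)]
      smooth_atlasD(4)[OF M that(1,2)] smooth_atlasD(4)[OF N that(3,4)]
    by (simp_all add: img Times_Int_Times map_prod_inj_on open_Times)
  ultimately show ?thesis
    unfolding smooth_atlas_def charts_prod_manifold
    by (simp add: split_beta img Times_Int_Times)
qed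

lemma smooth_at_prod_projections:
  assumes M: "smooth_atlas M" and N: "smooth_atlas N" and z: "z \<in> points M \<times> points N"
  shows smooth_at_fst: "smooth_at (prod_manifold M N) M fst z"
    and smooth_at_snd: "smooth_at (prod_manifold M N) N snd z"
proof -
  obtain c where c: "c \<in> charts M" "fst z \<in> fst c"
    using z smooth_atlas_chart[OF M, of "fst z"] by (metis mem_Times_iff)
  obtain d where d: "d \<in> charts N" "snd z \<in> fst d"
    using z smooth_atlas_chart[OF N, of "snd z"] by (metis mem_Times_iff)
  let ?P = "(fst c \<times> fst d, map_prod (snd c) (snd d))"
  let ?U = "snd c ` fst c \<times> snd d ` fst d"
  have o: "open ?U"
    using smooth_atlasD(2)[OF M c(1)] smooth_atlasD(2)[OF N d(1)] by (rule open_Times)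
  have inv: "inv_into (fst c \<times> fst d) (map_prod (snd c) (snd d)) y = (cinv c (fst y), cinv d (snd y))"
    if "y \<in> ?U" for y
    using that inv_into_map_prod[OF smooth_atlasD(1)[OF M c(1)] smooth_atlasD(1)[OF N d(1)]]
    by (metis mem_Times_iff prod.collapse)
  have P: "?P \<in> charts (prod_manifold M N)"
    unfolding charts_prod_manifold using c(1) d(1) by force
  have "smooth_on ?U (chart_rep ?P c fst)" "smooth_on ?U (chart_rep ?P d snd)"
    by (rule smooth_on_cong[OF smooth_on_subset[OF smooth_on_fst] o]
          smooth_on_cong[OF smooth_on_subset[OF smooth_on_snd] o]; auto simp: chart_rep_def inv f_inv_into_f)+
  then have "smooth_rep_at ?P c fst z" "smooth_rep_at ?P d snd z"
    unfolding smooth_rep_at_def using c d o inv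
    by (intro conjI exI[of _ ?U];
        auto simp: mem_Times_iff inv_into_into map_prod_def split_beta image_iff)+
  then show "smooth_at (prod_manifold M N) M fst z" "smooth_at (prod_manifold M N) N snd z"
    unfolding smooth_at_def using c(1) d(1) P by blast+
qed

lemma smooth_at_Pair:
  assumes X: "smooth_atlas X" and M: "smooth_atlas M" and N: "smooth_atlas N"
    and f: "smooth_at X M f x" and g: "smooth_at X N g x"
  shows "smooth_at X (prod_manifold M N) (\<lambda>x. (f x, g x)) x"
proof -
  obtain b c where bc: "b \<in> charts X" "x \<in> fst b" "c \<in> charts M" "f x \<in> fst c" "smooth_rep_at b c f x"
    by (rule smooth_at_obtain[OF X M f])
  obtain d where d: "d \<in> charts N" "g x \<in> fst d"
    using smooth_atlas_chart[OF N] smooth_at_points(2)[OF X N g] by metis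
  have g': "smooth_rep_at b d g x"
    by (rule smooth_at_chartsD[OF X N g bc(1,2) d])
  let ?P = "(fst c \<times> fst d, map_prod (snd c) (snd d))"
  from bc g' obtain U V where
    U: "open U" "snd b x \<in> U" "U \<subseteq> snd b ` fst b" "\<forall>y\<in>U. f (cinv b y) \<in> fst c" "smooth_on U (chart_rep b c f)" and
    V: "open V" "snd b x \<in> V" "V \<subseteq> snd b ` fst b" "\<forall>y\<in>V. g (cinv b y) \<in> fst d" "smooth_on V (chart_rep b d g)"
    unfolding smooth_rep_at_def by blast
  have "smooth_on (U \<inter> V) (\<lambda>y. (chart_rep b c f y, chart_rep b d g y))"
    using U V by (intro smooth_on_Pair) (auto intro: smooth_on_subset)
  then have "smooth_rep_at b ?P (\<lambda>x. (f x, g x)) x"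
    unfolding smooth_rep_at_def using U V bc
    by (intro conjI exI[of _ "U \<inter> V"]) (auto simp: chart_rep_def comp_def)
  then show ?thesis
    unfolding smooth_at_def charts_prod_manifold using bc d by (intro bexI[of _ b] bexI[of _ ?P]) auto
qed

lemma openin_mtop_Times:
  fixes M :: "('a, 'e::fin_dim_inner) manifold" and N :: "('b, 'g::fin_dim_inner) manifold"
  assumes M: "smooth_atlas M" and N: "smooth_atlas N" and U: "openin (mtop M) U" and V: "openin (mtop N) V"
  shows "openin (mtop (prod_manifold M N)) (U \<times> V)"
proof -
  have "map_prod (snd c) (snd d) ` (A \<times> B) = snd c ` A \<times> snd d ` B"
    for c :: "('a, 'e) chart" and d :: "('b, 'g) chart" and A B by auto
  with U V show ?thesis
    unfolding openin_mtop_atlas[OF M] openin_mtop_atlas[OF N] openin_mtop_atlas[OF smooth_atlas_prod[OF M N]]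
      charts_prod_manifold
    by (auto simp: Times_Int_Times open_Times)
qed

section \<open>Embedded submanifolds\<close>

lemma smooth_at_open_preimage:
  assumes M: "smooth_atlas M" and N: "smooth_atlas N" and W: "openin (mtop M) W"
    and f: "\<And>x. x \<in> W \<Longrightarrow> smooth_at M N f x" and V: "openin (mtop N) V"
  shows "openin (mtop M) {x \<in> W. f x \<in> V}"
proof (subst openin_subopen, intro ballI)
  fix x
  assume x: "x \<in> {x \<in> W. f x \<in> V}"
  obtain T where "openin (mtop M) T" "x \<in> T" "\<And>y. y \<in> T \<Longrightarrow> f y \<in> V"
    by (rule smooth_at_continuous[OF M N f V, of x]) (use x in auto)
  then show "\<exists>T. openin (mtop M) T \<and> x \<in> T \<and> T \<subseteq> {x \<in> W. f x \<in> V}"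
    using x W by (intro exI[of _ "T \<inter> W"]) auto
qed

lemma smooth_openin_vimage:
  assumes "smooth_atlas M" "smooth_atlas N" "\<And>x. x \<in> points M \<Longrightarrow> smooth_at M N f x" "openin (mtop N) V"
  shows "openin (mtop M) (points M \<inter> f -` V)"
  using smooth_at_open_preimage[OF assms(1,2) openin_mtop_points[OF assms(1)] assms(3,4)]
  by (simp add: vimage_def Int_def)

text \<open>The open set of coordinates that witnesses smoothness at \<open>x\<close> serves as
  witness at each of its points.\<close>

lemma smooth_at_nhd:
  assumes M: "smooth_atlas M" and f: "smooth_at M N f x"
  obtains W where "openin (mtop M) W" "x \<in> W" "\<And>y. y \<in> W \<Longrightarrow> smooth_at M N f y"
proof -
  from f obtain c d where cd: "c \<in> charts M" "d \<in> charts N" "smooth_rep_at c d f x"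
    unfolding smooth_at_def by blast
  then obtain U where xc: "x \<in> fst c" and U: "open U" "snd c x \<in> U" "U \<subseteq> snd c ` fst c"
    "\<forall>y\<in>U. f (cinv c y) \<in> fst d" "smooth_on U (chart_rep c d f)"
    unfolding smooth_rep_at_def by blast
  show ?thesis
  proof (rule that)
    show "openin (mtop M) (fst c \<inter> snd c -` U)"
      by (rule openin_mtop_chart_preimage[OF M cd(1) U(1)])
    show "x \<in> fst c \<inter> snd c -` U"
      using xc U by simp
    show "smooth_at M N f y" if "y \<in> fst c \<inter> snd c -` U" for y
      unfolding smooth_at_def smooth_rep_at_def using that cd U by blast
  qed
qed

lemma points_submanifold [simp]: "points (submanifold N S) = S"
  by (simp add: submanifold_def)

text \<open>Smoothness on an open submanifold is \<open>smooth_at\<close> of the surrounding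
  manifold at each of its points; this removes \<open>open_sub\<close> from the chart
  conditions.\<close>

lemma charts_submanifold_iff:
  fixes N :: "('a, 'e::fin_dim_inner) manifold"
  assumes N: "smooth_atlas N"
  shows "c \<in> charts (submanifold N S :: ('a, 'g::fin_dim_inner) manifold) \<longleftrightarrow>
    (\<exists>W. openin (mtop N) W \<and> fst c = S \<inter> W) \<and> inj_on (snd c) (fst c) \<and> open (snd c ` fst c) \<and>
    (\<forall>x\<in>fst c. \<exists>W g. openin (mtop N) W \<and> x \<in> W \<and> (\<forall>y\<in>W. smooth_at N euclid g y) \<and>
        (\<forall>y\<in>fst c \<inter> W. g y = snd c y)) \<and>
    (\<forall>y\<in>snd c ` fst c. smooth_at euclid N (cinv c) y)"
proof -
  have 1: "smooth_map (open_sub N W) euclid g \<longleftrightarrow> (\<forall>y\<in>W. smooth_at N euclid g y)"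
    if "openin (mtop N) W" for W and g :: "'a \<Rightarrow> 'g"
  proof -
    note W = openin_mtop_Int_points[OF N that]
    with that have "openin (mtop N) (points N \<inter> W)" by simp
    note sub = smooth_map_iff_smooth_at[OF smooth_atlas_open_sub[OF N this]] smooth_at_open_sub_dom[OF N this]
    show ?thesis by (simp add: sub W)
  qed
  have 2: "smooth_map (open_sub euclid A) N k \<longleftrightarrow> (\<forall>y\<in>A. smooth_at euclid N k y)"
    if "open A" for A and k :: "'g \<Rightarrow> 'a"
  proof -
    have "openin (mtop euclid) (points euclid \<inter> A)" using that by simp
    note sub = smooth_map_iff_smooth_at[OF smooth_atlas_open_sub[OF _ this] N] smooth_at_open_sub_dom[OF _ this]
    show ?thesis by (simp add: sub)
  qed
  have 3: "(\<exists>W g. openin (mtop N) W \<and> x \<in> W \<and> smooth_map (open_sub N W) euclid g \<and> (\<forall>y\<in>fst c \<inter> W. g y = snd c y)) \<longleftrightarrow>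
    (\<exists>W g. openin (mtop N) W \<and> x \<in> W \<and> (\<forall>y\<in>W. smooth_at N euclid g y) \<and> (\<forall>y\<in>fst c \<inter> W. g y = snd c y))"
    for x
    using 1 by blast
  show ?thesis
    unfolding submanifold_def manifold.select_convs mem_Collect_eq 3 using 2 by blast
qed

lemma submanifold_chartD:
  fixes N :: "('a, 'e::fin_dim_inner) manifold"
  assumes "smooth_atlas N" "c \<in> charts (submanifold N S :: ('a, 'g::fin_dim_inner) manifold)"
  shows "\<exists>W. openin (mtop N) W \<and> fst c = S \<inter> W" "inj_on (snd c) (fst c)" "open (snd c ` fst c)"
    "x \<in> fst c \<Longrightarrow> \<exists>W g. openin (mtop N) W \<and> x \<in> W \<and> (\<forall>y\<in>W. smooth_at N euclid g y) \<and>
        (\<forall>y\<in>fst c \<inter> W. g y = snd c y)"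
    "y \<in> snd c ` fst c \<Longrightarrow> smooth_at euclid N (cinv c) y"
  using assms(2) unfolding charts_submanifold_iff[OF assms(1)] by blast+

text \<open>A transition map factors locally through the surrounding manifold: the inverse of the
  first chart is smooth into \<open>N\<close>, and the second chart extends to a smooth map on an
  open part of \<open>N\<close>. Only covering has to be assumed; compatibility of the charts comes
  for free.\<close>

lemma smooth_atlas_submanifold:
  fixes N :: "('a, 'e::fin_dim_inner) manifold"
  defines "X \<equiv> \<lambda>S. submanifold N S :: ('a, 'g::fin_dim_inner) manifold"
  assumes N: "smooth_atlas N" and S: "S \<subseteq> (\<Union>c\<in>charts (X S). fst c)"
  shows "smooth_atlas (X S)"
proof -
  note D = submanifold_chartD[OF N, where 'g = 'g and S = S, folded X_def]
  have *: "\<exists>T. open T \<and> y \<in> T \<and> T \<subseteq> snd c ` (fst c \<inter> fst e) \<and> smooth_on T (chart_rep c e id)"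
    if c: "c \<in> charts (X S)" and e: "e \<in> charts (X S)" and y: "y \<in> snd c ` (fst c \<inter> fst e)" for c e y
  proof -
    from y obtain x where x: "x \<in> fst c" "x \<in> fst e" "y = snd c x" by auto
    then have xy: "cinv c y = x"
      using D(2)[OF c] by simp
    obtain We where We: "openin (mtop N) We" "fst e = S \<inter> We" using D(1)[OF e] by blast
    obtain W g where W: "openin (mtop N) W" "x \<in> W" "\<forall>y\<in>W. smooth_at N euclid g y" "\<forall>y\<in>fst e \<inter> W. g y = snd e y"
      using D(4)[OF e x(2)] by blast
    have sc: "smooth_at euclid N (cinv c) y"
      using D(5)[OF c] x by blast
    have "openin (mtop N) (We \<inter> W)" "cinv c y \<in> We \<inter> W"
      using W We x xy by auto
    then obtain T where T: "openin (mtop euclid) T" "y \<in> T" "\<And>z. z \<in> T \<Longrightarrow> cinv c z \<in> We \<inter> W"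
      using smooth_at_continuous[OF smooth_atlas_euclid N sc] by blast
    \<comment> \<open>On \<open>Q\<close> the inverse of \<open>c\<close> stays in the domain of
      \<open>e\<close> and in the region \<open>W\<close> where \<open>g\<close> extends the
      coordinates of \<open>e\<close>.\<close>
    define Q where "Q = T \<inter> snd c ` fst c"
    have Q: "open Q" "y \<in> Q"
      using T D(3)[OF c] x by (auto simp: Q_def)
    have Qc: "cinv c z \<in> fst c \<inter> fst e \<inter> W" if "z \<in> Q" for z
    proof -
      have "cinv c z \<in> fst c" using that by (auto simp: Q_def inv_into_into)
      moreover have "fst c \<subseteq> S" using D(1)[OF c] by blast
      ultimately show ?thesis
        using that T(3)[of z] We(2) by (auto simp: Q_def)
    qed
    have "Q \<subseteq> snd c ` (fst c \<inter> fst e)"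
    proof
      fix z
      assume z: "z \<in> Q"
      then have "snd c (cinv c z) = z" by (simp add: Q_def f_inv_into_f)
      with Qc[OF z] show "z \<in> snd c ` (fst c \<inter> fst e)" by (metis IntD1 imageI)
    qed
    moreover have "smooth_at euclid euclid (\<lambda>z. g (cinv c z)) y"
      by (rule smooth_at_compose[OF _ N _ sc]) (use W xy in auto)
    then obtain O' where O': "open O'" "y \<in> O'" "smooth_on O' (\<lambda>z. g (cinv c z))"
      unfolding smooth_at_euclid_iff by blast
    have "smooth_on (Q \<inter> O') (chart_rep c e id)"
      by (rule smooth_on_cong[OF smooth_on_subset[OF O'(3)]])
        (use Q O' Qc W(4) in \<open>auto simp: chart_rep_def\<close>)
    ultimately show ?thesis
      using Q O' by (intro exI[of _ "Q \<inter> O'"]) auto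
  qed
  have "open (snd c ` (fst c \<inter> fst e))" "smooth_on (snd c ` (fst c \<inter> fst e)) (chart_rep c e id)"
    if c: "c \<in> charts (X S)" and e: "e \<in> charts (X S)" for c e
    using open_subopen[of "snd c ` (fst c \<inter> fst e)"]
      smooth_on_locally[of "snd c ` (fst c \<inter> fst e)" "chart_rep c e id"] *[OF c e] by meson+
  moreover have "(\<Union>c\<in>charts (X S). fst c) = points (X S)"
    using S D(1) by (fastforce simp: X_def)
  ultimately show ?thesis
    unfolding smooth_atlas_def using D(2,3) by blast
qed

text \<open>On a chart domain the inclusion is the coordinate map followed by its inverse, and the
  latter is smooth into \<open>N\<close> by the definition of the induced charts.\<close>

lemma smooth_at_submanifold_inclusion:
  assumes N: "smooth_atlas N" and X: "smooth_atlas X" "X = submanifold N S" and x: "x \<in> S"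
  shows "smooth_at X N (\<lambda>x. x) x"
proof -
  obtain c where c: "c \<in> charts X" "x \<in> fst c"
    by (rule smooth_atlas_chart[OF X(1), of x]) (use x X(2) in auto)
  have "smooth_at X N (\<lambda>x. cinv c (snd c x)) x"
    by (rule smooth_at_compose[OF X(1) _ N smooth_at_chart[OF X(1) c]])
      (use submanifold_chartD(5)[OF N c(1)[unfolded X(2)]] c in auto)
  then show ?thesis
    by (rule smooth_at_cong[OF X(1) _ openin_mtop_chart[OF X(1) c(1)] c(2)])
      (rule cinv_chart[OF X(1) c(1)])
qed

text \<open>The universal property of an embedded submanifold: composing \<open>f\<close> with a
  local extension of a chart gives its coordinates as a smooth function. Since
  \<open>smooth_at\<close> concerns germs, values in \<open>S\<close> are required only near
  \<open>y\<close>.\<close>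

lemma smooth_at_into_submanifold:
  assumes Y: "smooth_atlas Y" and N: "smooth_atlas N" and X: "smooth_atlas X" "X = submanifold N S"
    and f: "smooth_at Y N f y" and V: "openin (mtop Y) V" "y \<in> V" "\<And>z. z \<in> V \<Longrightarrow> f z \<in> S"
  shows "smooth_at Y X f y"
proof -
  obtain c where c: "c \<in> charts X" "f y \<in> fst c"
    by (rule smooth_atlas_chart[OF X(1), of "f y"]) (use V X(2) in auto)
  note D = submanifold_chartD[OF N c(1)[unfolded X(2)]]
  obtain Wc where Wc: "openin (mtop N) Wc" "fst c = S \<inter> Wc" using D(1) by blast
  obtain W g where W: "openin (mtop N) W" "f y \<in> W" "\<forall>y\<in>W. smooth_at N euclid g y" "\<forall>y\<in>fst c \<inter> W. g y = snd c y"
    using D(4)[OF c(2)] by blast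
  have "openin (mtop N) (Wc \<inter> W)" "f y \<in> Wc \<inter> W"
    using W Wc c by auto
  then obtain T where T: "openin (mtop Y) T" "y \<in> T" "\<And>z. z \<in> T \<Longrightarrow> f z \<in> Wc \<inter> W"
    using smooth_at_continuous[OF Y N f] by blast
  have o: "openin (mtop Y) (T \<inter> V)" "y \<in> T \<inter> V"
    using T V by auto
  have fc: "f z \<in> fst c \<inter> W" if "z \<in> T \<inter> V" for z
    using that T(3)[of z] V(3)[of z] Wc(2) by auto
  have "smooth_at Y euclid (\<lambda>z. g (f z)) y"
    by (rule smooth_at_compose[OF Y N _ f]) (use W in auto)
  then have "smooth_at Y euclid (\<lambda>z. snd c (f z)) y"
    by (rule smooth_at_cong[OF Y _ o]) (use fc W(4) in auto)
  from smooth_at_compose[OF Y smooth_atlas_euclid X(1) this smooth_at_cinv[OF X(1) c(1)]] c(2)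
  have "smooth_at Y X (\<lambda>z. cinv c (snd c (f z))) y" by simp
  then show ?thesis
    by (rule smooth_at_cong[OF Y _ o]) (use fc X(1) c in auto)
qed

lemma smooth_at_restrict_submanifold:
  assumes "smooth_atlas N" "smooth_atlas X" "X = submanifold N S" "smooth_atlas P"
    and "smooth_at N P f x" "x \<in> S"
  shows "smooth_at X P f x"
  by (rule smooth_at_compose[OF assms(2,1,4) smooth_at_submanifold_inclusion[OF assms(1-3,6)] assms(5)])

section \<open>Countability and separation\<close>

lemma second_countable_mtop:
  fixes X :: "('a, 'e::fin_dim_inner) manifold"
  assumes X: "smooth_atlas X" and C: "countable C" "C \<subseteq> charts X" "points X \<subseteq> (\<Union>c\<in>C. fst c)"
  shows "second_countable (mtop X)"
proof -
  obtain \<B> :: "'e set set" where B: "countable \<B>" "\<And>V. V \<in> \<B> \<Longrightarrow> open V"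
    "\<And>U x. open U \<Longrightarrow> x \<in> U \<Longrightarrow> \<exists>V\<in>\<B>. x \<in> V \<and> V \<subseteq> U"
    by (rule countable_base_fin_dim_inner) blast
  \<comment> \<open>Preimages of a countable base of the model space, taken in each chart of a
    countable family that covers the manifold.\<close>
  let ?S = "(\<lambda>(c, V). fst c \<inter> snd c -` V) ` (C \<times> \<B>)"
  show ?thesis
    unfolding second_countable_def
  proof (intro exI[of _ ?S] conjI ballI allI impI)
    show "countable ?S" using B(1) C(1) by simp
    show "openin (mtop X) V" if "V \<in> ?S" for V
      using that C(2) B(2) by (auto intro!: openin_mtop_chart_preimage[OF X])
    fix U x
    assume U: "openin (mtop X) U \<and> x \<in> U"
    then have "x \<in> points X"
      using openin_mtop_subset[OF X] by blast
    then obtain c where c: "c \<in> C" "x \<in> fst c" using C(3) by blast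
    have cX: "c \<in> charts X" using c C by blast
    then have "open (snd c ` (U \<inter> fst c))" "snd c x \<in> snd c ` (U \<inter> fst c)"
      using U c by (auto simp: openin_mtop_atlas[OF X])
    then obtain V where V: "V \<in> \<B>" "snd c x \<in> V" "V \<subseteq> snd c ` (U \<inter> fst c)"
      using B(3) by blast
    have "fst c \<inter> snd c -` V \<subseteq> U"
    proof
      fix z
      assume z: "z \<in> fst c \<inter> snd c -` V"
      then obtain u where "u \<in> U" "u \<in> fst c" "snd c z = snd c u" using V by blast
      then show "z \<in> U"
        using z smooth_atlasD(1)[OF X cX] by (auto dest: inj_onD)
    qed
    then show "\<exists>V\<in>?S. x \<in> V \<and> V \<subseteq> U"
      using V(1,2) c by (intro bexI[of _ "fst c \<inter> snd c -` V"]) auto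
  qed
qed

text \<open>Points over different base points are separated by preimages from \<open>B\<close>;
  points of the same fibre lie in a common chart and are separated there.\<close>

lemma Hausdorff_space_mtop_fibred:
  assumes X: "smooth_atlas X" and B: "smooth_atlas B" "Hausdorff_space (mtop B)"
    and f: "\<And>x. x \<in> points X \<Longrightarrow> smooth_at X B f x"
    and c: "\<And>x y. x \<in> points X \<Longrightarrow> y \<in> points X \<Longrightarrow> f x = f y \<Longrightarrow> \<exists>c\<in>charts X. x \<in> fst c \<and> y \<in> fst c"
  shows "Hausdorff_space (mtop X)"
  unfolding Hausdorff_space_def topspace_mtop[OF X]
proof (intro allI impI)
  fix x y
  assume xy: "x \<in> points X \<and> y \<in> points X \<and> x \<noteq> y"
  have "\<exists>U V. openin (mtop X) U \<and> openin (mtop X) V \<and> x \<in> U \<and> y \<in> V \<and> disjnt U V"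
  proof (cases "f x = f y")
    case True
    then obtain c where c: "c \<in> charts X" "x \<in> fst c" "y \<in> fst c" using c xy by blast
    then have "snd c x \<noteq> snd c y"
      using xy smooth_atlasD(1)[OF X c(1)] by (auto dest: inj_onD)
    then obtain U V where "open U" "open V" "snd c x \<in> U" "snd c y \<in> V" "U \<inter> V = {}"
      using hausdorff by metis
    then show ?thesis
      using c by (intro exI[of _ "fst c \<inter> snd c -` U"] exI[of _ "fst c \<inter> snd c -` V"])
        (auto intro!: openin_mtop_chart_preimage[OF X] simp: disjnt_def)
  next
    case False
    have "f x \<in> points B" "f y \<in> points B"
      using smooth_at_points(2)[OF X B(1) f] xy by auto
    with False B obtain U V where "openin (mtop B) U" "openin (mtop B) V" "f x \<in> U" "f y \<in> V" "disjnt U V"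
      unfolding Hausdorff_space_def topspace_mtop[OF B(1)] by blast
    then show ?thesis
      using xy smooth_at_open_preimage[OF X B(1) openin_mtop_points[OF X] f]
      by (intro exI[of _ "{x \<in> points X. f x \<in> U}"] exI[of _ "{x \<in> points X. f x \<in> V}"])
        (auto simp: disjnt_def)
  qed
  then show "\<exists>U V. openin (mtop X) U \<and> openin (mtop X) V \<and> x \<in> U \<and> y \<in> V \<and> disjnt U V" .
qed

section \<open>Local trivializations\<close>

text \<open>
  \<open>G\<close> is the fibre coordinate over \<open>U\<close> and \<open>H\<close> its inverse. The total space is the subset \<open>S\<close> of an
  ambient manifold \<open>N\<close>; the component \<open>tspace E\<close> plays no role here.
\<close>

locale local_triv =
  fixes B :: "('b, 'm::fin_dim_inner) manifold" and N :: "('x, 'n::fin_dim_inner) manifold"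
    and S :: "'x set" and E :: "('x, 'b, 'm, 'f::fin_dim_inner) vbundle"
    and U :: "'b set" and G :: "'x \<Rightarrow> 'f" and H :: "'b \<Rightarrow> 'f \<Rightarrow> 'x"
  assumes smooth: "a \<in> S \<Longrightarrow> bproj E a \<in> U \<Longrightarrow> smooth_at N euclid G a"
    and inverse: "a \<in> S \<Longrightarrow> bproj E a \<in> U \<Longrightarrow> H (bproj E a) (G a) = a"
    and vadd: "a \<in> S \<Longrightarrow> bproj E a \<in> U \<Longrightarrow> b \<in> S \<Longrightarrow> bproj E b = bproj E a \<Longrightarrow>
      G (vadd E a b) = G a + G b"
    and vscale: "a \<in> S \<Longrightarrow> bproj E a \<in> U \<Longrightarrow> G (vscale E r a) = r *\<^sub>R G a"
    and vzero: "y \<in> U \<Longrightarrow> G (vzero E y) = 0"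
    and smooth_inverse: "y \<in> U \<Longrightarrow>
      smooth_at (prod_manifold B euclid) N (\<lambda>z. H (fst z) (snd z)) (y, w)"
    and inverse_in: "y \<in> U \<Longrightarrow> H y w \<in> S"
    and inverse_bproj: "y \<in> U \<Longrightarrow> bproj E (H y w) = y"
    and coordinate_inverse: "y \<in> U \<Longrightarrow> G (H y w) = w"

lemmas local_trivD = local_triv.smooth local_triv.inverse local_triv.vadd local_triv.vscale
  local_triv.vzero local_triv.smooth_inverse local_triv.inverse_in local_triv.inverse_bproj
  local_triv.coordinate_inverse

text \<open>A vector bundle structure on the subset \<open>S\<close> of \<open>N\<close>, with
  smoothness measured in \<open>N\<close>. With \<open>N\<close> the total space and
  \<open>S\<close> all of its points it describes an ordinary vector bundle; with \<open>N\<close> a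
  surrounding manifold it describes what has to be verified before the induced structure on
  \<open>S\<close> is known to be a manifold.\<close>

locale ambient_bundle =
  fixes B :: "('b, 'm::fin_dim_inner) manifold" and N :: "('x, 'n::fin_dim_inner) manifold"
    and S :: "'x set" and E :: "('x, 'b, 'm, 'f::fin_dim_inner) vbundle"
  assumes base: "smooth_atlas B" and ambient: "smooth_atlas N" and subset: "S \<subseteq> points N"
    and smooth_bproj: "a \<in> points N \<Longrightarrow> smooth_at N B (bproj E) a"
    and vzero: "x \<in> points B \<Longrightarrow> vzero E x \<in> S" "x \<in> points B \<Longrightarrow> bproj E (vzero E x) = x"
    and vadd: "a \<in> S \<Longrightarrow> b \<in> S \<Longrightarrow> bproj E a = bproj E b \<Longrightarrow> vadd E a b \<in> S"
      "a \<in> S \<Longrightarrow> b \<in> S \<Longrightarrow> bproj E a = bproj E b \<Longrightarrow> bproj E (vadd E a b) = bproj E b"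
    and vscale: "a \<in> S \<Longrightarrow> vscale E r a \<in> S" "a \<in> S \<Longrightarrow> bproj E (vscale E r a) = bproj E a"
    and triv: "x \<in> points B \<Longrightarrow> \<exists>U G H. openin (mtop B) U \<and> x \<in> U \<and> local_triv B N S E U G H"

lemmas ambient_bundleD = ambient_bundle.base ambient_bundle.ambient ambient_bundle.subset
  ambient_bundle.smooth_bproj ambient_bundle.vzero ambient_bundle.vadd ambient_bundle.vscale
  ambient_bundle.triv

lemma ambient_bundle_bproj:
  "ambient_bundle B N S E \<Longrightarrow> a \<in> S \<Longrightarrow> bproj E a \<in> points B"
  using smooth_at_points(2) ambient_bundleD(1,2,3,4) by (metis subsetD)

text \<open>The chart pairs a base chart with the fibre coordinate \<open>G\<close>, and its inverse
  is \<open>H\<close> after the inverse base chart. Its domain consists of whole fibres, which is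
  used later: two points of a fibre share a chart, and covers of the base yield covers of the total
  space.\<close>

lemma ambient_bundle_chart:
  fixes B :: "('b, 'm::fin_dim_inner) manifold" and N :: "('x, 'n::fin_dim_inner) manifold"
    and E :: "('x, 'b, 'm, 'f::fin_dim_inner) vbundle"
  assumes E: "ambient_bundle B N S E" and x: "x \<in> points B"
  shows "\<exists>V c. openin (mtop B) V \<and> x \<in> V \<and> c \<in> charts (submanifold N S :: ('x, 'm \<times> 'f) manifold) \<and>
    fst c = {a \<in> S. bproj E a \<in> V}"
proof -
  note D = ambient_bundleD[OF E]
  obtain U G H where U: "openin (mtop B) U" "x \<in> U" and T: "local_triv B N S E U G H"
    using D(11)[OF x] by blast
  note T = local_trivD[OF T]
  obtain c where c: "c \<in> charts B" "x \<in> fst c"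
    by (rule smooth_atlas_chart[OF D(1) x])
  define V where "V = U \<inter> fst c"
  have V: "openin (mtop B) V" "x \<in> V"
    unfolding V_def using U c openin_mtop_chart[OF D(1) c(1)] by auto
  define A where "A = {a \<in> S. bproj E a \<in> V}"
  define k where "k = (\<lambda>a. (snd c (bproj E a), G a))"
  have "A = S \<inter> {a \<in> points N. bproj E a \<in> V}"
    using D(3) by (auto simp: A_def)
  moreover have "openin (mtop N) {a \<in> points N. bproj E a \<in> V}"
    by (rule smooth_at_open_preimage[OF D(2,1) openin_mtop_points[OF D(2)] D(4) V(1)])
  ultimately have W0: "\<exists>W. openin (mtop N) W \<and> A = S \<inter> W" by blast
  have kH: "H (cinv c (fst (k a))) (snd (k a)) = a" if "a \<in> A" for a
    using that D(1) c(1) T(2) by (auto simp: k_def A_def V_def)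
  then have inj: "inj_on k A" by (metis inj_onI)
  have img: "k ` A = snd c ` V \<times> UNIV"
  proof
    show "k ` A \<subseteq> snd c ` V \<times> UNIV" by (auto simp: k_def A_def)
    show "snd c ` V \<times> UNIV \<subseteq> k ` A"
    proof
      fix p :: "'m \<times> 'f"
      assume "p \<in> snd c ` V \<times> UNIV"
      then obtain y w where "y \<in> V" "p = (snd c y, w)" by auto
      then have "H y w \<in> A" "k (H y w) = p"
        using T(7,8,9) by (auto simp: k_def A_def V_def)
      then show "p \<in> k ` A" by blast
    qed
  qed
  have "V \<inter> fst c = V" by (auto simp: V_def)
  then have "open (snd c ` V)"
    using V(1) c(1) unfolding openin_mtop_atlas[OF D(1)] by metis
  then have op: "open (k ` A)"
    unfolding img by (intro open_Times open_UNIV)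
  \<comment> \<open>\<open>G\<close> and the projection are smooth at \<open>a\<close> with respect
    to \<open>N\<close>, so \<open>k\<close> is smooth on a neighbourhood in \<open>N\<close> and
    can serve as its own extension.\<close>
  have ext: "\<exists>W g. openin (mtop N) W \<and> a \<in> W \<and> (\<forall>y\<in>W. smooth_at N euclid g y) \<and> (\<forall>y\<in>A \<inter> W. g y = k y)"
    if a: "a \<in> A" for a
  proof -
    have "a \<in> S" "bproj E a \<in> U" "bproj E a \<in> fst c" "a \<in> points N"
      using a D(3) by (auto simp: A_def V_def)
    then have "smooth_at N euclid k a"
      unfolding k_def using T(1) D(4) c(1)
      by (intro smooth_at_Pair_euclid[OF D(2)] smooth_at_compose[OF D(2,1) smooth_atlas_euclid D(4)]
          smooth_at_chart[OF D(1)]) auto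
    then obtain W where "openin (mtop N) W" "a \<in> W" "\<And>y. y \<in> W \<Longrightarrow> smooth_at N euclid k y"
      using smooth_at_nhd[OF D(2)] by blast
    then show ?thesis by blast
  qed
  have inv: "smooth_at euclid N (inv_into A k) p" if p: "p \<in> k ` A" for p
  proof -
    have p1: "fst p \<in> snd c ` fst c" and pU: "cinv c (fst p) \<in> U"
      using p D(1) c(1) unfolding img by (auto simp: V_def)
    have 1: "smooth_at euclid euclid fst p" "smooth_at euclid euclid snd p"
      unfolding smooth_at_euclid_iff using smooth_on_fst smooth_on_snd by blast+
    have "smooth_at euclid B (\<lambda>p. cinv c (fst p)) p"
      by (rule smooth_at_compose[OF _ _ D(1) 1(1) smooth_at_cinv[OF D(1) c(1) p1]]) simp_all
    from smooth_at_Pair[OF smooth_atlas_euclid D(1) smooth_atlas_euclid this 1(2)]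
    have 2: "smooth_at euclid (prod_manifold B euclid) (\<lambda>p. (cinv c (fst p), snd p)) p" .
    have "smooth_at euclid N (\<lambda>p. H (cinv c (fst p)) (snd p)) p"
      using smooth_at_compose[OF smooth_atlas_euclid smooth_atlas_prod[OF D(1) smooth_atlas_euclid] D(2) 2 T(6)[OF pU]]
      by simp
    then show ?thesis
    proof (rule smooth_at_cong[OF smooth_atlas_euclid])
      show "openin (mtop euclid) (k ` A)" using op by simp
      show "H (cinv c (fst q)) (snd q) = inv_into A k q" if "q \<in> k ` A" for q
        using that kH inj by auto
    qed (rule p)
  qed
  have "(A, k) \<in> charts (submanifold N S :: ('x, 'm \<times> 'f) manifold)"
    unfolding charts_submanifold_iff[OF D(2)] fst_conv snd_conv
    by (intro conjI ballI W0 inj op ext inv)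
  with V show ?thesis
    by (intro exI[of _ V] exI[of _ "(A, k)"]) (simp add: A_def)
qed

lemma smooth_atlas_ambient_bundle:
  fixes B :: "('b, 'm::fin_dim_inner) manifold" and N :: "('x, 'n::fin_dim_inner) manifold"
    and E :: "('x, 'b, 'm, 'f::fin_dim_inner) vbundle"
  assumes E: "ambient_bundle B N S E"
  shows "smooth_atlas (submanifold N S :: ('x, 'm \<times> 'f) manifold)"
proof (rule smooth_atlas_submanifold[OF ambient_bundleD(2)[OF E]])
  show "S \<subseteq> (\<Union>c\<in>charts (submanifold N S :: ('x, 'm \<times> 'f) manifold). fst c)"
  proof
    fix a
    assume a: "a \<in> S"
    from ambient_bundle_chart[OF E ambient_bundle_bproj[OF E a]] a
    show "a \<in> (\<Union>c\<in>charts (submanifold N S :: ('x, 'm \<times> 'f) manifold). fst c)" by blast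
  qed
qed

text \<open>The same \<open>G\<close> and \<open>H\<close> trivialize with respect to the induced
  structure: \<open>G\<close> is restricted, and \<open>H\<close> takes values in \<open>S\<close>.
  Afterwards \<open>S\<close> is the full set of points, which is the form in which a bundle enters
  further constructions such as the Whitney sum.\<close>

lemma ambient_bundle_submanifold:
  fixes B :: "('b, 'm::fin_dim_inner) manifold" and N :: "('x, 'n::fin_dim_inner) manifold"
    and E :: "('x, 'b, 'm, 'f::fin_dim_inner) vbundle"
  assumes E: "ambient_bundle B N S E" and X: "X = (submanifold N S :: ('x, 'm \<times> 'f) manifold)"
  shows "ambient_bundle B X S E"
proof -
  note D = ambient_bundleD[OF E]
  have XA: "smooth_atlas X"
    unfolding X by (rule smooth_atlas_ambient_bundle[OF E])
  note BE = smooth_atlas_prod[OF D(1) smooth_atlas_euclid]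
  note restrict = smooth_at_restrict_submanifold[OF D(2) XA X]
  have lt: "local_triv B X S E U G H" if U: "openin (mtop B) U" and T: "local_triv B N S E U G H" for U G H
  proof -
    note T = local_trivD[OF T]
    have Hs: "smooth_at (prod_manifold B euclid) X (\<lambda>z. H (fst z) (snd z)) (y, w)" if y: "y \<in> U" for y w
    proof (rule smooth_at_into_submanifold[OF BE D(2) XA X T(6)[OF y]])
      show "openin (mtop (prod_manifold B euclid)) (U \<times> (UNIV :: 'f set))"
        by (rule openin_mtop_Times[OF D(1) _ U]) simp_all
      show "(y, w) \<in> U \<times> UNIV" using y by simp
      show "H (fst z) (snd z) \<in> S" if "z \<in> U \<times> (UNIV :: 'f set)" for z
        using T(7) that by auto
    qed
    have Gs: "smooth_at X euclid G a" if "a \<in> S" "bproj E a \<in> U" for a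
      by (rule restrict[OF smooth_atlas_euclid T(1)[OF that] that(1)])
    show ?thesis
      by (rule local_triv.intro) (fact Gs T Hs)+
  qed
  have loc: "\<exists>U G H. openin (mtop B) U \<and> x \<in> U \<and> local_triv B X S E U G H" if "x \<in> points B" for x
    using D(11)[OF that] lt by blast
  have pr: "smooth_at X B (bproj E) a" if "a \<in> points X" for a
    using restrict[OF D(1) D(4)] that D(3) X by auto
  have sub: "S \<subseteq> points X" by (simp add: X)
  show ?thesis
    by (rule ambient_bundle.intro) (fact D(1) XA sub pr D(5-10) loc)+
qed

text \<open>The topological axioms come from the base: the Hausdorff property by the fibrewise
  argument, second countability by the Lindelof property of \<open>B\<close>. The trivializations
  are the pairs of projection and fibre coordinate.\<close>

lemma vector_bundle_submanifold:
  fixes B :: "('b, 'm::fin_dim_inner) manifold" and N :: "('x, 'n::fin_dim_inner) manifold"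
    and E :: "('x, 'b, 'm, 'f::fin_dim_inner) vbundle"
  assumes B: "smooth_manifold B" and E: "ambient_bundle B N S E" and X: "tspace E = submanifold N S"
  shows "vector_bundle B E"
proof -
  have XE: "ambient_bundle B (tspace E) S E"
    by (rule ambient_bundle_submanifold[OF E X])
  note D = ambient_bundleD[OF XE]
  have pX: "points (tspace E) = S" by (simp add: X)
  have BH: "Hausdorff_space (mtop B)" "second_countable (mtop B)"
    using B by (simp_all add: smooth_manifold_iff_atlas)
  have "Hausdorff_space (mtop (tspace E))"
  proof (rule Hausdorff_space_mtop_fibred[OF D(2,1) BH(1), of "bproj E"])
    fix a b
    assume ab: "a \<in> points (tspace E)" "b \<in> points (tspace E)" "bproj E a = bproj E b"
    then have "bproj E a \<in> points B"
      using ambient_bundle_bproj[OF XE] by (simp add: pX)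
    from ambient_bundle_chart[OF E this] obtain V c where "bproj E a \<in> V" "c \<in> charts (tspace E)"
      "fst c = {a \<in> S. bproj E a \<in> V}"
      unfolding X by blast
    then show "\<exists>c\<in>charts (tspace E). a \<in> fst c \<and> b \<in> fst c"
      using ab by (intro bexI[of _ c]) (auto simp: pX)
  qed (rule D(4))
  moreover have "second_countable (mtop (tspace E))"
  proof -
    \<comment> \<open>Base sets over which a single chart contains all fibres. They cover
      \<open>B\<close>, so countably many of them do, and one chart chosen for each gives a
      countable atlas of the total space.\<close>
    let ?Q = "\<lambda>V c. openin (mtop B) V \<and> c \<in> charts (tspace E) \<and> fst c = {a \<in> S. bproj E a \<in> V}"
    let ?U = "{V. \<exists>c. ?Q V c}"
    have "x \<in> \<Union>?U" if "x \<in> points B" for x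
      using ambient_bundle_chart[OF E that] unfolding X by blast
    moreover have "\<Union>?U \<subseteq> points B"
      using openin_mtop_subset[OF D(1)] by blast
    ultimately have eq: "\<Union>?U = topspace (mtop B)"
      unfolding topspace_mtop[OF D(1)] by (intro subset_antisym subsetI) (erule (1) subsetD)
    have op: "openin (mtop B) V" if "V \<in> ?U" for V
      using that by blast
    have "\<exists>\<V>. countable \<V> \<and> \<V> \<subseteq> ?U \<and> \<Union>\<V> = topspace (mtop B)"
      by (rule Lindelof_spaceD[OF second_countable_imp_Lindelof_space[OF BH(2)] op eq])
    then obtain \<V> where V: "countable \<V>" "\<V> \<subseteq> ?U" "\<Union>\<V> = points B"
      unfolding topspace_mtop[OF D(1)] by (elim exE conjE)
    define k where "k V = (SOME c. ?Q V c)" for V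
    have k: "?Q V (k V)" if "V \<in> \<V>" for V
    proof -
      have "\<exists>c. ?Q V c" using that V(2) by blast
      from someI_ex[OF this] show ?thesis unfolding k_def .
    qed
    show ?thesis
    proof (rule second_countable_mtop[OF D(2), of "k ` \<V>"])
      show "countable (k ` \<V>)" using V(1) by simp
      show "k ` \<V> \<subseteq> charts (tspace E)" using k by blast
      show "points (tspace E) \<subseteq> (\<Union>c\<in>k ` \<V>. fst c)"
      proof
        fix a
        assume a: "a \<in> points (tspace E)"
        then have "bproj E a \<in> \<Union>\<V>"
          using ambient_bundle_bproj[OF XE] V(3) by (simp add: pX)
        then obtain V where "V \<in> \<V>" "bproj E a \<in> V" by blast
        then show "a \<in> (\<Union>c\<in>k ` \<V>. fst c)" using k[of V] a pX by auto
      qed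
    qed
  qed
  ultimately have XM: "smooth_manifold (tspace E)"
    using D(2) by (simp add: smooth_manifold_iff_atlas)
  have "smooth_map (tspace E) B (bproj E)"
    unfolding smooth_map_iff_smooth_at[OF D(2,1)] using D(4) by blast
  moreover have "\<exists>U \<Phi>. openin (mtop B) U \<and> x \<in> U \<and>
      diffeo (open_sub (tspace E) (bproj E -` U)) (prod_manifold (open_sub B U) (euclid :: ('f, 'f) manifold)) \<Phi> \<and>
      (\<forall>y\<in>U. snd (\<Phi> (vzero E y)) = 0 \<and>
         (\<forall>a\<in>fiber E y. fst (\<Phi> a) = y \<and>
            (\<forall>b\<in>fiber E y. snd (\<Phi> (vadd E a b)) = snd (\<Phi> a) + snd (\<Phi> b)) \<and>
            (\<forall>r. snd (\<Phi> (vscale E r a)) = r *\<^sub>R snd (\<Phi> a))))"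
    if x: "x \<in> points B" for x
  proof -
    obtain U G H where U: "openin (mtop B) U" "x \<in> U" and T: "local_triv B (tspace E) S E U G H"
      using D(11)[OF x] by blast
    note T = local_trivD[OF T]
    define \<Phi> where "\<Phi> a = (bproj E a, G a)" for a
    let ?X = "open_sub (tspace E) (bproj E -` U)"
    let ?B = "open_sub B U"
    let ?P = "prod_manifold ?B (euclid :: ('f, 'f) manifold)"
    note UB = openin_mtop_Int_points[OF D(1) U(1)]
    have BU: "openin (mtop B) (points B \<inter> U)" using U by (simp add: UB)
    have XU: "openin (mtop (tspace E)) (points (tspace E) \<inter> bproj E -` U)"
      by (rule smooth_openin_vimage[OF D(2) D(1) D(4) U(1)])
    note aX = smooth_atlas_open_sub[OF D(2) XU] and aB = smooth_atlas_open_sub[OF D(1) BU]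
    note aP = smooth_atlas_prod[OF aB smooth_atlas_euclid]
    note aBE = smooth_atlas_prod[OF D(1) smooth_atlas_euclid]
    have bij: "bij_betw \<Phi> (points ?X) (points ?P)"
      using T(2,7,8,9) by (intro bij_betw_byWitness[where f' = "\<lambda>p. H (fst p) (snd p)"])
        (auto simp: \<Phi>_def pX UB)
    have inv: "inv_into (points ?X) \<Phi> p = H (fst p) (snd p)" if "p \<in> points ?P" for p
      using that T(7,8,9) bij by (intro inv_into_f_eq) (auto simp: \<Phi>_def pX UB bij_betw_def)
    have "smooth_map ?X ?P \<Phi>"
      unfolding smooth_map_iff_smooth_at[OF aX aP]
    proof
      fix a
      assume "a \<in> points ?X"
      then have a: "a \<in> S" "bproj E a \<in> U" by (auto simp: pX)
      show "smooth_at ?X ?P \<Phi> a"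
        unfolding \<Phi>_def using a D(4)[of a] T(1)[OF a] pX
        by (intro smooth_at_Pair[OF aX aB smooth_atlas_euclid])
          (auto simp: smooth_at_open_sub_dom[OF D(2) XU] smooth_at_open_sub_cod[OF D(2,1) BU])
    qed
    moreover have "smooth_map ?P ?X (inv_into (points ?X) \<Phi>)"
      unfolding smooth_map_iff_smooth_at[OF aP aX]
    proof
      fix p
      assume p: "p \<in> points ?P"
      then have pU: "fst p \<in> U" by auto
      have "smooth_at ?P B fst p"
        using smooth_at_fst[OF aB smooth_atlas_euclid, of p] p smooth_at_open_sub_cod[OF aP D(1) BU] by auto
      moreover have "smooth_at ?P euclid snd p"
        using smooth_at_snd[OF aB smooth_atlas_euclid, of p] p by auto
      ultimately have "smooth_at ?P (prod_manifold B euclid) (\<lambda>p. (fst p, snd p)) p"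
        by (rule smooth_at_Pair[OF aP D(1) smooth_atlas_euclid])
      from smooth_at_compose[OF aP aBE D(2) this T(6)[OF pU]]
      have "smooth_at ?P (tspace E) (\<lambda>p. H (fst p) (snd p)) p" by simp
      moreover have "H (fst p) (snd p) \<in> bproj E -` U" using T(8) pU by simp
      ultimately have "smooth_at ?P ?X (\<lambda>p. H (fst p) (snd p)) p"
        by (simp add: smooth_at_open_sub_cod[OF aP D(2) XU])
      then show "smooth_at ?P ?X (inv_into (points ?X) \<Phi>) p"
        by (rule smooth_at_cong[OF aP _ openin_mtop_points[OF aP] p]) (simp only: inv)
    qed
    ultimately have "diffeo ?X ?P \<Phi>"
      unfolding diffeo_def using bij by blast
    moreover have "fst (\<Phi> a) = y \<and> (\<forall>b\<in>fiber E y. snd (\<Phi> (vadd E a b)) = snd (\<Phi> a) + snd (\<Phi> b)) \<and>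
            (\<forall>r. snd (\<Phi> (vscale E r a)) = r *\<^sub>R snd (\<Phi> a))" if "y \<in> U" "a \<in> fiber E y" for y a
      using that T(3,4) by (auto simp: fiber_def \<Phi>_def pX)
    moreover have "snd (\<Phi> (vzero E y)) = 0" if "y \<in> U" for y
      using T(5) that by (simp add: \<Phi>_def)
    ultimately show ?thesis
      using U by (intro exI[of _ U] exI[of _ \<Phi>]) blast
  qed
  moreover have "vzero E x \<in> fiber E x \<and>
       (\<forall>a\<in>fiber E x. (\<forall>b\<in>fiber E x. vadd E a b \<in> fiber E x) \<and> (\<forall>r. vscale E r a \<in> fiber E x))"
    if "x \<in> points B" for x
    using that D(5-10) by (auto simp: fiber_def pX)
  ultimately show ?thesis
    unfolding vector_bundle_def using B XM by blast
qed

text \<open>The reverse passage: a trivialization \<Phi> supplies \<open>G\<close> as its second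
  component and \<open>H\<close> as its inverse. Smoothness on the part over \<open>U\<close> is
  smoothness on the whole total space because that part is open.\<close>

lemma ambient_bundle_vector_bundle:
  fixes B :: "('b, 'm::fin_dim_inner) manifold" and E :: "('x, 'b, 'm, 'f::fin_dim_inner) vbundle"
  assumes E: "vector_bundle B E"
  shows "ambient_bundle B (tspace E) (points (tspace E)) E"
proof -
  have B: "smooth_atlas B" and X: "smooth_atlas (tspace E)"
    using E by (simp_all add: vector_bundle_def smooth_manifold_iff_atlas)
  have pr: "smooth_at (tspace E) B (bproj E) a" if "a \<in> points (tspace E)" for a
    using E that unfolding vector_bundle_def smooth_map_iff_smooth_at[OF X B] by blast
  have fib: "vzero E x \<in> fiber E x" "a \<in> fiber E x \<Longrightarrow> b \<in> fiber E x \<Longrightarrow> vadd E a b \<in> fiber E x"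
      "a \<in> fiber E x \<Longrightarrow> vscale E r a \<in> fiber E x" if "x \<in> points B" for x a b r
    using E that unfolding vector_bundle_def by blast+
  have "\<exists>U G H. openin (mtop B) U \<and> x \<in> U \<and> local_triv B (tspace E) (points (tspace E)) E U G H"
    if x: "x \<in> points B" for x
  proof -
    from E[unfolded vector_bundle_def, THEN conjunct2, THEN conjunct2, THEN conjunct2, THEN conjunct2, THEN bspec, OF x]
    obtain U \<Phi> where U: "openin (mtop B) U" "x \<in> U"
      and df: "diffeo (open_sub (tspace E) (bproj E -` U)) (prod_manifold (open_sub B U) (euclid :: ('f, 'f) manifold)) \<Phi>"
      and lin: "\<forall>y\<in>U. snd (\<Phi> (vzero E y)) = 0 \<and>
         (\<forall>a\<in>fiber E y. fst (\<Phi> a) = y \<and>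
            (\<forall>b\<in>fiber E y. snd (\<Phi> (vadd E a b)) = snd (\<Phi> a) + snd (\<Phi> b)) \<and>
            (\<forall>r. snd (\<Phi> (vscale E r a)) = r *\<^sub>R snd (\<Phi> a)))"
      by (elim exE conjE)
    let ?X = "open_sub (tspace E) (bproj E -` U)"
    let ?B = "open_sub B U"
    let ?P = "prod_manifold ?B (euclid :: ('f, 'f) manifold)"
    note UB = openin_mtop_Int_points[OF B U(1)]
    have BU: "openin (mtop B) (points B \<inter> U)" using U by (simp add: UB)
    have XU: "openin (mtop (tspace E)) (points (tspace E) \<inter> bproj E -` U)"
      by (rule smooth_openin_vimage[OF X B pr U(1)])
    note aX = smooth_atlas_open_sub[OF X XU] and aB = smooth_atlas_open_sub[OF B BU]
    note aP = smooth_atlas_prod[OF aB smooth_atlas_euclid]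
    note aBE = smooth_atlas_prod[OF B smooth_atlas_euclid]
    define G where "G a = snd (\<Phi> a)" for a
    define H where "H y w = inv_into (points ?X) \<Phi> (y, w)" for y w
    have bij: "bij_betw \<Phi> (points ?X) (points ?P)"
      and s1: "\<And>a. a \<in> points ?X \<Longrightarrow> smooth_at ?X ?P \<Phi> a"
      and s2: "\<And>p. p \<in> points ?P \<Longrightarrow> smooth_at ?P ?X (inv_into (points ?X) \<Phi>) p"
      using df unfolding diffeo_def smooth_map_iff_smooth_at[OF aX aP] smooth_map_iff_smooth_at[OF aP aX]
      by blast+
    have fstP: "fst (\<Phi> a) = bproj E a" if "a \<in> points ?X" for a
      using lin that by (auto simp: fiber_def)
    have Gs: "smooth_at (tspace E) euclid G a" and HG: "H (bproj E a) (G a) = a"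
      if a: "a \<in> points (tspace E)" "bproj E a \<in> U" for a
    proof -
      have aX': "a \<in> points ?X" using a by simp
      have "\<Phi> a \<in> points ?P" using bij aX' by (auto simp: bij_betw_def)
      then have "smooth_at ?P euclid snd (\<Phi> a)"
        using smooth_at_snd[OF aB smooth_atlas_euclid] by simp
      from smooth_at_compose[OF aX aP smooth_atlas_euclid s1[OF aX'] this]
      show "smooth_at (tspace E) euclid G a"
        by (simp add: smooth_at_open_sub_dom[OF X XU] G_def[abs_def])
      have "\<Phi> a = (bproj E a, G a)"
        using fstP[OF aX'] by (simp add: G_def prod_eq_iff)
      then show "H (bproj E a) (G a) = a"
        using bij aX' unfolding H_def by (metis bij_betw_imp_inj_on inv_into_f_f)
    qed
    have Hs: "smooth_at (prod_manifold B euclid) (tspace E) (\<lambda>z. H (fst z) (snd z)) (y, w)"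
      and HX: "H y w \<in> points (tspace E)" "bproj E (H y w) = y" "G (H y w) = w"
      if y: "y \<in> U" for y w
    proof -
      have p: "(y, w) \<in> points ?P" using y UB by auto
      have "H y w \<in> points ?X" and PH: "\<Phi> (H y w) = (y, w)"
        using p bij inv_into_into[of "(y, w)" \<Phi> "points ?X"] f_inv_into_f[of "(y, w)" \<Phi> "points ?X"]
        unfolding H_def bij_betw_def by blast+
      then show "H y w \<in> points (tspace E)" "bproj E (H y w) = y" "G (H y w) = w"
        using fstP[of "H y w"] by (auto simp: G_def)
      have yB: "(y, w) \<in> points B \<times> points (euclid :: ('f, 'f) manifold)" using y UB by auto
      have o: "openin (mtop (prod_manifold B euclid)) (U \<times> (UNIV :: 'f set))"
        by (rule openin_mtop_Times[OF B _ U(1)]) simp_all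
      have "smooth_at (prod_manifold B euclid) ?B fst (y, w)"
        using smooth_at_fst[OF B smooth_atlas_euclid yB] y by (simp add: smooth_at_open_sub_cod[OF aBE B BU])
      from smooth_at_Pair[OF aBE aB smooth_atlas_euclid this smooth_at_snd[OF B smooth_atlas_euclid yB]]
      have "smooth_at (prod_manifold B euclid) ?P (\<lambda>z. (fst z, snd z)) (y, w)" .
      from smooth_at_compose[OF aBE aP aX this] s2[OF p]
      have "smooth_at (prod_manifold B euclid) ?X (\<lambda>z. H (fst z) (snd z)) (y, w)"
        by (simp add: H_def)
      then show "smooth_at (prod_manifold B euclid) (tspace E) (\<lambda>z. H (fst z) (snd z)) (y, w)"
        by (simp add: smooth_at_open_sub_cod[OF aBE X XU])
    qed
    have "local_triv B (tspace E) (points (tspace E)) E U G H"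
      using Gs HG Hs HX lin by (intro local_triv.intro) (auto simp: fiber_def G_def)
    with U show ?thesis by blast
  qed
  moreover have "vzero E x \<in> points (tspace E)" "bproj E (vzero E x) = x" if "x \<in> points B" for x
    using fib(1)[OF that] by (auto simp: fiber_def)
  moreover have "vadd E a b \<in> points (tspace E) \<and> bproj E (vadd E a b) = bproj E a"
    if "a \<in> points (tspace E)" "b \<in> points (tspace E)" "bproj E a = bproj E b" for a b
    using fib(2)[OF smooth_at_points(2)[OF X B pr[OF that(1)]], of a b] that by (auto simp: fiber_def)
  moreover have "vscale E r a \<in> points (tspace E) \<and> bproj E (vscale E r a) = bproj E a"
    if "a \<in> points (tspace E)" for a r
    using fib(3)[OF smooth_at_points(2)[OF X B pr[OF that(1)]], of a r] that by (auto simp: fiber_def)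
  ultimately show ?thesis
    using B X pr by (intro ambient_bundle.intro) auto
qed

section \<open>Tangent bundles\<close>

lemma chart_rep_has_derivative:
  assumes "smooth_rep_at c d f x"
  shows "(chart_rep c d f has_derivative frechet_derivative (chart_rep c d f) (at (snd c x))) (at (snd c x))"
  using assms unfolding smooth_rep_at_def by (blast intro: smooth_on_has_derivative)

text \<open>Near the point \<open>f\<close> stays in the domain of \<open>d\<close>, so there the
  representation of the composite is the composite of the representations and the ordinary chain
  rule applies.\<close>

lemma frechet_chart_rep_compose:
  assumes M: "smooth_atlas M" and N: "smooth_atlas N" and P: "smooth_atlas P"
    and f: "smooth_at M N f x" and g: "smooth_at N P g (f x)"
    and c: "c \<in> charts M" "x \<in> fst c" and d: "d \<in> charts N" "f x \<in> fst d"
    and e: "e \<in> charts P" "g (f x) \<in> fst e"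
  shows "frechet_derivative (chart_rep c e (\<lambda>x. g (f x))) (at (snd c x)) v =
    frechet_derivative (chart_rep d e g) (at (snd d (f x)))
      (frechet_derivative (chart_rep c d f) (at (snd c x)) v)"
proof -
  have f': "smooth_rep_at c d f x" by (rule smooth_at_chartsD[OF M N f c d])
  have g': "smooth_rep_at d e g (f x)" by (rule smooth_at_chartsD[OF N P g d e])
  from f' obtain U where U: "open U" "snd c x \<in> U" "\<forall>y\<in>U. f (cinv c y) \<in> fst d"
    unfolding smooth_rep_at_def by blast
  have "chart_rep c d f (snd c x) = snd d (f x)"
    using M c by (simp add: chart_rep_def)
  then have "((\<lambda>y. chart_rep d e g (chart_rep c d f y)) has_derivative
      (\<lambda>v. frechet_derivative (chart_rep d e g) (at (snd d (f x)))
        (frechet_derivative (chart_rep c d f) (at (snd c x)) v))) (at (snd c x))"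
    using chart_rep_has_derivative[OF g']
    by (intro has_derivative_compose[OF chart_rep_has_derivative[OF f']]) simp
  moreover have "chart_rep d e g (chart_rep c d f y) = chart_rep c e (\<lambda>x. g (f x)) y" if "y \<in> U" for y
    using U(3) that N d(1) by (simp add: chart_rep_def)
  ultimately have "(chart_rep c e (\<lambda>x. g (f x)) has_derivative
      (\<lambda>v. frechet_derivative (chart_rep d e g) (at (snd d (f x)))
        (frechet_derivative (chart_rep c d f) (at (snd c x)) v))) (at (snd c x))"
    by (rule has_derivative_transform_within_open[OF _ U(1,2)])
  from fun_cong[OF frechet_derivative_at[OF this], of v] show ?thesis by simp
qed

lemma frechet_chart_rep_ident:
  assumes M: "smooth_atlas M" and c: "c \<in> charts M" "x \<in> fst c"
  shows "frechet_derivative (chart_rep c c id) (at (snd c x)) v = v"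
proof -
  have "(chart_rep c c id has_derivative (\<lambda>v. v)) (at (snd c x))"
    by (rule has_derivative_transform_within_open[OF has_derivative_ident smooth_atlasD(2)[OF M c(1)]])
      (use M c in \<open>auto simp: chart_rep_def\<close>)
  from fun_cong[OF frechet_derivative_at[OF this], of v] show ?thesis by simp
qed

lemma smooth_at_id: "smooth_atlas M \<Longrightarrow> x \<in> points M \<Longrightarrow> smooth_at M M id x"
  using smooth_at_ident by (simp add: id_def)

text \<open>The tangent vector at \<open>x\<close> with component \<open>u\<close> in the chart
  \<open>c\<close>; the other components are forced by the Jacobians of the transition maps. For
  fixed \<open>c\<close> this inverts a chart of the tangent bundle.\<close>

definition tlift :: "('a, 'e::real_normed_vector) manifold \<Rightarrow> ('a, 'e) chart \<Rightarrow> 'a \<Rightarrow> 'e \<Rightarrow> ('a, 'e) tvec"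
  where "tlift M c x u = (x, \<lambda>d. if d \<in> charts_at M x
    then frechet_derivative (chart_rep c d id) (at (snd c x)) u else 0)"

lemma fst_tlift [simp]: "fst (tlift M c x u) = x"
  by (simp add: tlift_def)

lemma tvecs_iff:
  "v \<in> tvecs M \<longleftrightarrow> fst v \<in> points M \<and> (\<forall>c. c \<notin> charts_at M (fst v) \<longrightarrow> snd v c = 0) \<and>
    (\<forall>c\<in>charts_at M (fst v). \<forall>d\<in>charts_at M (fst v).
       snd v d = frechet_derivative (chart_rep c d id) (at (snd c (fst v))) (snd v c))"
  by (simp add: tvecs_def split_beta)

lemma tvecsD:
  assumes "v \<in> tvecs M"
  shows "fst v \<in> points M" "c \<notin> charts_at M (fst v) \<Longrightarrow> snd v c = 0"
    "c \<in> charts_at M (fst v) \<Longrightarrow> d \<in> charts_at M (fst v) \<Longrightarrow>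
      snd v d = frechet_derivative (chart_rep c d id) (at (snd c (fst v))) (snd v c)"
  using assms unfolding tvecs_iff by blast+

lemma tvecsI:
  assumes "fst v \<in> points M" "\<And>c. c \<notin> charts_at M (fst v) \<Longrightarrow> snd v c = 0"
    "\<And>c d. c \<in> charts_at M (fst v) \<Longrightarrow> d \<in> charts_at M (fst v) \<Longrightarrow>
      snd v d = frechet_derivative (chart_rep c d id) (at (snd c (fst v))) (snd v c)"
  shows "v \<in> tvecs M"
  using assms unfolding tvecs_iff by blast

lemma tlift_in_tvecs:
  assumes M: "smooth_atlas M" and c: "c \<in> charts M" "x \<in> fst c"
  shows "tlift M c x u \<in> tvecs M"
proof -
  have x: "x \<in> points M" using smooth_atlasD(3)[OF M c(1)] c(2) by blast
  \<comment> \<open>The cocycle law of the Jacobians: the chain rule applied to the identity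
    composed with itself.\<close>
  have chain: "frechet_derivative (chart_rep c e id) (at (snd c x)) u =
    frechet_derivative (chart_rep d e id) (at (snd d x)) (frechet_derivative (chart_rep c d id) (at (snd c x)) u)"
    if "d \<in> charts_at M x" "e \<in> charts_at M x" for d e
    using frechet_chart_rep_compose[OF M M M smooth_at_id[OF M x] smooth_at_id[OF M], of c d e] that c x
    by (simp add: charts_at_def id_def)
  show ?thesis
  proof (rule tvecsI)
    fix d e
    assume "d \<in> charts_at M (fst (tlift M c x u))" "e \<in> charts_at M (fst (tlift M c x u))"
    then have de: "d \<in> charts_at M x" "e \<in> charts_at M x" by simp_all
    from chain[OF de] de show "snd (tlift M c x u) e =
        frechet_derivative (chart_rep d e id) (at (snd d (fst (tlift M c x u)))) (snd (tlift M c x u) d)"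
      by (simp add: tlift_def)
  qed (simp_all add: tlift_def x)
qed

lemma snd_tlift:
  assumes "smooth_atlas M" "c \<in> charts M" "x \<in> fst c"
  shows "snd (tlift M c x u) c = u"
  using frechet_chart_rep_ident[OF assms] assms(2,3) by (simp add: tlift_def charts_at_def)

lemma tlift_component:
  assumes "v \<in> tvecs M" "c \<in> charts M" "fst v \<in> fst c"
  shows "tlift M c (fst v) (snd v c) = v"
proof (rule prod_eqI)
  show "snd (tlift M c (fst v) (snd v c)) = snd v"
  proof
    fix d
    have c: "c \<in> charts_at M (fst v)" using assms by (simp add: charts_at_def)
    show "snd (tlift M c (fst v) (snd v c)) d = snd v d"
      using tvecsD(2)[OF assms(1), of d] tvecsD(3)[OF assms(1) c, of d, symmetric]
      by (cases "d \<in> charts_at M (fst v)") (simp_all add: tlift_def)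
  qed
qed simp

text \<open>Each vector is the \<open>tlift\<close> of its component in \<open>c\<close>. Equations
  between tangent vectors are thereby checked in one chart.\<close>

lemma tvecs_eqI:
  assumes "v \<in> tvecs M" "w \<in> tvecs M" "fst v = fst w" "c \<in> charts M" "fst v \<in> fst c" "snd v c = snd w c"
  shows "v = w"
  using tlift_component[OF assms(1,4,5)] tlift_component[OF assms(2,4)] assms(3,5,6) by simp

text \<open>The charts from the definition of the tangent bundle, written with projections in place
  of pattern matching on pairs.\<close>

definition tchart :: "('a, 'e::real_normed_vector) manifold \<Rightarrow> ('a, 'e) chart \<Rightarrow> (('a, 'e) tvec, 'e \<times> 'e) chart"
  where "tchart M c = ({v \<in> tvecs M. fst v \<in> fst c}, \<lambda>v. (snd c (fst v), snd v c))"

abbreviation TB :: "('a, 'e::real_normed_vector) manifold \<Rightarrow> (('a, 'e) tvec, 'e \<times> 'e) manifold"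
  where "TB M \<equiv> tspace (tangent_bundle M)"

lemma points_tangent_bundle [simp]: "points (TB M) = tvecs M"
  by (simp add: tangent_bundle_def)

lemma charts_tangent_bundle: "charts (TB M) = tchart M ` charts M"
proof -
  have "tchart M = (\<lambda>c. ({(x, v) \<in> tvecs M. x \<in> fst c}, \<lambda>(x, v). (snd c x, v c)))"
    by (auto simp: tchart_def fun_eq_iff)
  then show ?thesis by (simp add: tangent_bundle_def)
qed

lemma tangent_bundle_simps [simp]:
  "bproj (tangent_bundle M) = fst"
  "vadd (tangent_bundle M) v w = (fst v, \<lambda>c. snd v c + snd w c)"
  "vscale (tangent_bundle M) r v = (fst v, \<lambda>c. r *\<^sub>R snd v c)"
  "vzero (tangent_bundle M) x = (x, \<lambda>_. 0)"
  by (simp_all add: tangent_bundle_def split_beta)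

lemma tchart_image:
  fixes M :: "('a, 'e::fin_dim_inner) manifold"
  assumes M: "smooth_atlas M" and c: "c \<in> charts M" and A: "A \<subseteq> fst c"
  shows "snd (tchart M c) ` {v \<in> tvecs M. fst v \<in> A} = snd c ` A \<times> UNIV"
proof
  show "snd (tchart M c) ` {v \<in> tvecs M. fst v \<in> A} \<subseteq> snd c ` A \<times> UNIV"
    by (auto simp: tchart_def)
  show "snd c ` A \<times> UNIV \<subseteq> snd (tchart M c) ` {v \<in> tvecs M. fst v \<in> A}"
  proof
    fix p :: "'e \<times> 'e"
    assume "p \<in> snd c ` A \<times> UNIV"
    then obtain x u where x: "x \<in> A" "p = (snd c x, u)" by auto
    then have "p = snd (tchart M c) (tlift M c x u)" "tlift M c x u \<in> tvecs M"
      using A snd_tlift[OF M c] tlift_in_tvecs[OF M c] by (auto simp: tchart_def)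
    then show "p \<in> snd (tchart M c) ` {v \<in> tvecs M. fst v \<in> A}"
      using x(1) by (intro image_eqI[of _ _ "tlift M c x u"]) auto
  qed
qed

lemma inj_on_tchart:
  assumes M: "smooth_atlas M" and c: "c \<in> charts M"
  shows "inj_on (snd (tchart M c)) (fst (tchart M c))"
proof (rule inj_onI)
  fix v w
  assume vw: "v \<in> fst (tchart M c)" "w \<in> fst (tchart M c)" "snd (tchart M c) v = snd (tchart M c) w"
  then have "fst v = fst w"
    using smooth_atlasD(1)[OF M c] by (auto simp: tchart_def dest: inj_onD)
  with vw show "v = w"
    using c by (intro tvecs_eqI[of v M w c]) (auto simp: tchart_def)
qed

lemma cinv_tchart:
  assumes M: "smooth_atlas M" and c: "c \<in> charts M" "x \<in> fst c"
  shows "cinv (tchart M c) (snd c x, u) = tlift M c x u"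
  using tlift_in_tvecs[OF M c] snd_tlift[OF M c] c(2)
  by (intro inv_into_f_eq inj_on_tchart[OF M c(1)]) (auto simp: tchart_def)

text \<open>A transition map of the tangent bundle consists of the transition map of
  \<open>M\<close> and its derivative, and the latter is jointly smooth in point and
  direction.\<close>

lemma smooth_atlas_tangent_bundle:
  fixes M :: "('a, 'e::fin_dim_inner) manifold"
  assumes M: "smooth_atlas M"
  shows "smooth_atlas (TB M)"
proof -
  have fstc: "fst (tchart M c) = {v \<in> tvecs M. fst v \<in> fst c}" for c
    by (simp add: tchart_def)
  have int: "fst (tchart M c) \<inter> fst (tchart M d) = {v \<in> tvecs M. fst v \<in> fst c \<inter> fst d}" for c d
    by (auto simp: tchart_def)
  have 1: "open (snd (tchart M c) ` fst (tchart M c))" if c: "c \<in> charts M" for c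
    unfolding fstc tchart_image[OF M c subset_refl]
    by (intro open_Times open_UNIV smooth_atlasD(2)[OF M c])
  have 2: "open (snd (tchart M c) ` (fst (tchart M c) \<inter> fst (tchart M d)))"
    and 3: "smooth_on (snd (tchart M c) ` (fst (tchart M c) \<inter> fst (tchart M d))) (chart_rep (tchart M c) (tchart M d) id)"
    if c: "c \<in> charts M" and d: "d \<in> charts M" for c d
  proof -
    let ?A = "snd c ` (fst c \<inter> fst d)"
    have img: "snd (tchart M c) ` (fst (tchart M c) \<inter> fst (tchart M d)) = ?A \<times> UNIV"
      unfolding int by (rule tchart_image[OF M c]) simp
    have o: "open (?A \<times> (UNIV :: 'e set))"
      by (intro open_Times open_UNIV smooth_atlasD(4)[OF M c d])
    show "open (snd (tchart M c) ` (fst (tchart M c) \<inter> fst (tchart M d)))"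
      unfolding img by (rule o)
    have "smooth_on (?A \<times> UNIV) (\<lambda>z. (chart_rep c d id (fst z), frechet_derivative (chart_rep c d id) (at (fst z)) (snd z)))"
      by (rule smooth_on_Pair[OF smooth_on_compose[OF smooth_on_subset[OF smooth_on_fst] smooth_atlasD(5)[OF M c d] o smooth_atlasD(4)[OF M c d]]
            smooth_on_derivative[OF smooth_atlasD(5)[OF M c d] smooth_atlasD(4)[OF M c d]] o]) auto
    then have "smooth_on (?A \<times> UNIV) (chart_rep (tchart M c) (tchart M d) id)"
    proof (rule smooth_on_cong[OF _ o])
      fix z
      assume "z \<in> ?A \<times> (UNIV :: 'e set)"
      then obtain x u where z: "x \<in> fst c" "x \<in> fst d" "z = (snd c x, u)" by auto
      then have "chart_rep (tchart M c) (tchart M d) id z = snd (tchart M d) (tlift M c x u)"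
        by (simp add: chart_rep_def cinv_tchart[OF M c])
      also have "\<dots> = (snd d x, frechet_derivative (chart_rep c d id) (at (snd c x)) u)"
        using z d by (simp add: tchart_def tlift_def charts_at_def)
      finally show "(chart_rep c d id (fst z), frechet_derivative (chart_rep c d id) (at (fst z)) (snd z)) =
          chart_rep (tchart M c) (tchart M d) id z"
        using z M c by (simp add: chart_rep_def)
    qed
    then show "smooth_on (snd (tchart M c) ` (fst (tchart M c) \<inter> fst (tchart M d))) (chart_rep (tchart M c) (tchart M d) id)"
      unfolding img .
  qed
  have "\<exists>c\<in>charts M. v \<in> fst (tchart M c)" if v: "v \<in> tvecs M" for v
  proof -
    have "fst v \<in> points M" using v by (simp add: tvecs_iff)
    then obtain c where "c \<in> charts M" "fst v \<in> fst c" by (rule smooth_atlas_chart[OF M])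
    with v show ?thesis by (auto simp: fstc)
  qed
  then have "(\<Union>c\<in>charts M. fst (tchart M c)) = tvecs M"
    by (auto simp: fstc)
  then show ?thesis
    unfolding smooth_atlas_def charts_tangent_bundle points_tangent_bundle
    using 1 2 3 inj_on_tchart[OF M] by simp
qed

lemma smooth_at_tangent_proj:
  assumes M: "smooth_atlas M" and v: "v \<in> tvecs M"
  shows "smooth_at (TB M) M fst v"
proof -
  note TM = smooth_atlas_tangent_bundle[OF M]
  have "fst v \<in> points M" using v by (simp add: tvecs_iff)
  then obtain c where c: "c \<in> charts M" "fst v \<in> fst c" by (rule smooth_atlas_chart[OF M])
  have tc: "tchart M c \<in> charts (TB M)" "v \<in> fst (tchart M c)"
    using c v by (auto simp: charts_tangent_bundle tchart_def)
  have "smooth_at (TB M) euclid (\<lambda>v. fst (snd (tchart M c) v)) v"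
    by (rule smooth_at_compose_smooth_on[OF TM smooth_at_chart[OF TM tc] smooth_on_fst]) auto
  then have "smooth_at (TB M) euclid (\<lambda>v. snd c (fst v)) v"
    by (simp add: tchart_def)
  from smooth_at_compose[OF TM smooth_atlas_euclid M this smooth_at_cinv[OF M c(1)]] c(2)
  have "smooth_at (TB M) M (\<lambda>v. cinv c (snd c (fst v))) v" by simp
  then show ?thesis
    by (rule smooth_at_cong[OF TM _ openin_mtop_chart[OF TM tc(1)] tc(2)])
      (use M c in \<open>auto simp: tchart_def\<close>)
qed

lemma smooth_at_tangent_component:
  assumes M: "smooth_atlas M" and v: "v \<in> tvecs M" and c: "c \<in> charts M" "fst v \<in> fst c"
  shows "smooth_at (TB M) euclid (\<lambda>v. snd v c) v"
proof -
  note TM = smooth_atlas_tangent_bundle[OF M]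
  have tc: "tchart M c \<in> charts (TB M)" "v \<in> fst (tchart M c)"
    using c v by (auto simp: charts_tangent_bundle tchart_def)
  have "smooth_at (TB M) euclid (\<lambda>v. snd (snd (tchart M c) v)) v"
    by (rule smooth_at_compose_smooth_on[OF TM smooth_at_chart[OF TM tc] smooth_on_snd]) auto
  then show ?thesis by (simp add: tchart_def)
qed

lemma smooth_at_tlift:
  assumes M: "smooth_atlas M" and X: "smooth_atlas X" and c: "c \<in> charts M" "f x \<in> fst c"
    and f: "smooth_at X M f x" and u: "smooth_at X euclid u x"
  shows "smooth_at X (TB M) (\<lambda>x. tlift M c (f x) (u x)) x"
proof -
  note TM = smooth_atlas_tangent_bundle[OF M]
  have tc: "tchart M c \<in> charts (TB M)"
    using c by (auto simp: charts_tangent_bundle)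
  obtain W where W: "openin (mtop X) W" "x \<in> W" "\<And>y. y \<in> W \<Longrightarrow> f y \<in> fst c"
    using smooth_at_continuous[OF X M f openin_mtop_chart[OF M c(1)] c(2)] by blast
  have "snd (tchart M c) ` fst (tchart M c) = snd c ` fst c \<times> UNIV"
    using tchart_image[OF M c(1) subset_refl] by (simp add: tchart_def)
  then have img: "(snd c (f x), u x) \<in> snd (tchart M c) ` fst (tchart M c)"
    using c(2) by simp
  have "smooth_at X euclid (\<lambda>x. (snd c (f x), u x)) x"
    by (rule smooth_at_Pair_euclid[OF X smooth_at_compose[OF X M smooth_atlas_euclid f smooth_at_chart[OF M c]] u])
  from smooth_at_compose[OF X smooth_atlas_euclid TM this smooth_at_cinv[OF TM tc img]]
  have "smooth_at X (TB M) (\<lambda>x. cinv (tchart M c) (snd c (f x), u x)) x" .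
  then show ?thesis
    by (rule smooth_at_cong[OF X _ W(1,2)]) (use cinv_tchart[OF M c(1)] W(3) in blast)
qed

text \<open>Where the values are tangent vectors based in the domain of \<open>c\<close>,
  \<open>f\<close> equals the \<open>tlift\<close> of its base point and its component in
  \<open>c\<close>, so smoothness of these two suffices.\<close>

lemma smooth_at_into_tangent_bundle:
  assumes M: "smooth_atlas M" and X: "smooth_atlas X" and c: "c \<in> charts M" "fst (f x) \<in> fst c"
    and f: "smooth_at X M (\<lambda>x. fst (f x)) x" "smooth_at X euclid (\<lambda>x. snd (f x) c) x"
    and V: "openin (mtop X) V" "x \<in> V" "\<And>y. y \<in> V \<Longrightarrow> f y \<in> tvecs M"
  shows "smooth_at X (TB M) f x"
proof -
  obtain W where W: "openin (mtop X) W" "x \<in> W" "\<And>y. y \<in> W \<Longrightarrow> fst (f y) \<in> fst c"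
    using smooth_at_continuous[OF X M f(1) openin_mtop_chart[OF M c(1)] c(2)] by blast
  have "smooth_at X (TB M) (\<lambda>x. tlift M c (fst (f x)) (snd (f x) c)) x"
    by (rule smooth_at_tlift[OF M X c f])
  then show ?thesis
  proof (rule smooth_at_cong[OF X])
    show "openin (mtop X) (V \<inter> W)" "x \<in> V \<inter> W" using V W by auto
    show "tlift M c (fst (f y)) (snd (f y) c) = f y" if "y \<in> V \<inter> W" for y
      using that V(3) W(3) by (intro tlift_component c(1)) auto
  qed
qed

section \<open>Fibrewise operations on tangent vectors\<close>

lemma linear_frechet_transition:
  assumes M: "smooth_atlas M" and cd: "c \<in> charts_at M x" "d \<in> charts_at M x"
  shows "linear (frechet_derivative (chart_rep c d id) (at (snd c x)))"
proof -
  have x: "x \<in> points M" using smooth_atlasD(3)[OF M, of c] cd by (auto simp: charts_at_def)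
  have "smooth_rep_at c d id x"
    using cd by (intro smooth_at_chartsD[OF M M smooth_at_id[OF M x]]) (auto simp: charts_at_def)
  from has_derivative_linear[OF chart_rep_has_derivative[OF this]] show ?thesis .
qed

lemma vadd_in_tvecs:
  assumes M: "smooth_atlas M" and v: "v \<in> tvecs M" and w: "w \<in> tvecs M" and eq: "fst v = fst w"
  shows "(fst w, \<lambda>c. snd v c + snd w c) \<in> tvecs M"
proof (rule tvecsI)
  fix c d
  assume "c \<in> charts_at M (fst (fst w, \<lambda>c. snd v c + snd w c))" "d \<in> charts_at M (fst (fst w, \<lambda>c. snd v c + snd w c))"
  then have cd: "c \<in> charts_at M (fst w)" "d \<in> charts_at M (fst w)" by simp_all
  from tvecsD(3)[OF v, of c d, unfolded eq, OF cd] tvecsD(3)[OF w cd]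
  show "snd (fst w, \<lambda>c. snd v c + snd w c) d = frechet_derivative (chart_rep c d id)
      (at (snd c (fst (fst w, \<lambda>c. snd v c + snd w c)))) (snd (fst w, \<lambda>c. snd v c + snd w c) c)"
    by (simp add: linear_add[OF linear_frechet_transition[OF M cd]])
qed (use tvecsD(1,2)[OF w] tvecsD(2)[OF v] eq in simp_all)

lemma vscale_in_tvecs:
  assumes M: "smooth_atlas M" and v: "v \<in> tvecs M"
  shows "(fst v, \<lambda>c. r *\<^sub>R snd v c) \<in> tvecs M"
proof (rule tvecsI)
  fix c d
  assume "c \<in> charts_at M (fst (fst v, \<lambda>c. r *\<^sub>R snd v c))" "d \<in> charts_at M (fst (fst v, \<lambda>c. r *\<^sub>R snd v c))"
  then have cd: "c \<in> charts_at M (fst v)" "d \<in> charts_at M (fst v)" by simp_all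
  from tvecsD(3)[OF v cd]
  show "snd (fst v, \<lambda>c. r *\<^sub>R snd v c) d = frechet_derivative (chart_rep c d id)
      (at (snd c (fst (fst v, \<lambda>c. r *\<^sub>R snd v c)))) (snd (fst v, \<lambda>c. r *\<^sub>R snd v c) c)"
    by (simp add: linear_cmul[OF linear_frechet_transition[OF M cd]])
qed (use tvecsD(1,2)[OF v] in simp_all)

lemma vzero_in_tvecs:
  assumes M: "smooth_atlas M" and x: "x \<in> points M"
  shows "(x, \<lambda>_. 0) \<in> tvecs M"
  using x linear_0[OF linear_frechet_transition[OF M]]
  unfolding tvecs_iff by simp

text \<open>Over the domain of a chart \<open>c\<close> the fibre coordinate is the component in
  \<open>c\<close>, with inverse \<open>tlift M c\<close>.\<close>

lemma ambient_bundle_tangent_bundle: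
  fixes M :: "('a, 'e::fin_dim_inner) manifold"
  assumes M: "smooth_atlas M"
  shows "ambient_bundle M (TB M) (tvecs M) (tangent_bundle M)"
proof (rule ambient_bundle.intro)
  note TM = smooth_atlas_tangent_bundle[OF M]
  show "smooth_atlas M" by (rule M)
  show "smooth_atlas (TB M)" by (rule TM)
  fix x
  assume x: "x \<in> points M"
  obtain c where c: "c \<in> charts M" "x \<in> fst c" by (rule smooth_atlas_chart[OF M x])
  have "local_triv M (TB M) (tvecs M) (tangent_bundle M) (fst c) (\<lambda>v. snd v c) (tlift M c)"
  proof (rule local_triv.intro)
    fix y and w :: 'e
    assume y: "y \<in> fst c"
    then have yw: "(y, w) \<in> points M \<times> points (euclid :: ('e, 'e) manifold)"
      using smooth_atlasD(3)[OF M c(1)] by auto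
    show "smooth_at (prod_manifold M euclid) (TB M) (\<lambda>z. tlift M c (fst z) (snd z)) (y, w)"
      using y by (intro smooth_at_tlift[OF M smooth_atlas_prod[OF M smooth_atlas_euclid] c(1) _
            smooth_at_fst[OF M smooth_atlas_euclid yw] smooth_at_snd[OF M smooth_atlas_euclid yw]]) simp
  qed (use c(1) in \<open>simp_all add: smooth_at_tangent_component[OF M] tlift_component tlift_in_tvecs[OF M] snd_tlift[OF M]\<close>)
  then show "\<exists>U G H. openin (mtop M) U \<and> x \<in> U \<and>
      local_triv M (TB M) (tvecs M) (tangent_bundle M) U G H"
    using openin_mtop_chart[OF M c(1)] c(2) by blast
qed (simp_all add: smooth_at_tangent_proj[OF M] vadd_in_tvecs[OF M] vscale_in_tvecs[OF M] vzero_in_tvecs[OF M])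

section \<open>Tangent maps\<close>

lemma fst_tangent_map [simp]: "fst (tangent_map M N f v) = f (fst v)"
  by (simp add: tangent_map_def split_beta)

text \<open>Frees \<open>tangent_map\<close> from the chart picked by \<open>SOME\<close>: the chain
  rule moves the derivative from that chart \<open>b\<close> to \<open>c\<close>, and the
  transformation law of \<open>v\<close> absorbs the Jacobian.\<close>

lemma snd_tangent_map:
  assumes M: "smooth_atlas M" and N: "smooth_atlas N" and v: "v \<in> tvecs M"
    and f: "smooth_at M N f (fst v)" and c: "c \<in> charts M" "fst v \<in> fst c" and d: "d \<in> charts N" "f (fst v) \<in> fst d"
  shows "snd (tangent_map M N f v) d = frechet_derivative (chart_rep c d f) (at (snd c (fst v))) (snd v c)"
proof -
  define b where "b = (SOME c. c \<in> charts_at M (fst v))"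
  have cv: "c \<in> charts_at M (fst v)" using c by (simp add: charts_at_def)
  then have bv: "b \<in> charts_at M (fst v)" unfolding b_def by (rule someI)
  have x: "fst v \<in> points M" using v by (simp add: tvecs_iff)
  have "snd (tangent_map M N f v) d = frechet_derivative (chart_rep b d f) (at (snd b (fst v))) (snd v b)"
    using d by (simp add: tangent_map_def split_beta b_def charts_at_def Let_def)
  also have "\<dots> = frechet_derivative (chart_rep c d f) (at (snd c (fst v)))
      (frechet_derivative (chart_rep b c id) (at (snd b (fst v))) (snd v b))"
    using frechet_chart_rep_compose[OF M M N smooth_at_id[OF M x], of f b c d] f bv c d
    by (simp add: charts_at_def)
  also have "frechet_derivative (chart_rep b c id) (at (snd b (fst v))) (snd v b) = snd v c"
    using v bv cv unfolding tvecs_iff by metis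
  finally show ?thesis .
qed

lemma tangent_map_in_tvecs:
  assumes M: "smooth_atlas M" and N: "smooth_atlas N" and v: "v \<in> tvecs M" and f: "smooth_at M N f (fst v)"
  shows "tangent_map M N f v \<in> tvecs N"
proof -
  have x: "fst v \<in> points M" using v by (simp add: tvecs_iff)
  then obtain c where c: "c \<in> charts M" "fst v \<in> fst c" by (rule smooth_atlas_chart[OF M])
  have fx: "f (fst v) \<in> points N" by (rule smooth_at_points(2)[OF M N f])
  have "snd (tangent_map M N f v) e =
      frechet_derivative (chart_rep d e id) (at (snd d (f (fst v)))) (snd (tangent_map M N f v) d)"
    if "d \<in> charts_at N (f (fst v))" "e \<in> charts_at N (f (fst v))" for d e
    using that snd_tangent_map[OF M N v f c]
      frechet_chart_rep_compose[OF M N N f smooth_at_id[OF N fx] c, of d e]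
    by (simp add: charts_at_def id_def)
  moreover have "snd (tangent_map M N f v) d = 0" if "d \<notin> charts_at N (f (fst v))" for d
    using that by (simp add: tangent_map_def split_beta)
  ultimately show ?thesis
    unfolding tvecs_iff fst_tangent_map using fx by blast
qed

text \<open>Both sides are tangent vectors at the same point, so they are compared in one chart,
  where the tangent map is a Frechet derivative and hence linear.\<close>

lemma tangent_map_linear:
  assumes M: "smooth_atlas M" and N: "smooth_atlas N" and v: "v \<in> tvecs M" and f: "smooth_at M N f (fst v)"
  shows "w \<in> tvecs M \<Longrightarrow> fst w = fst v \<Longrightarrow>
      tangent_map M N f (vadd (tangent_bundle M) v w) =
      vadd (tangent_bundle N) (tangent_map M N f v) (tangent_map M N f w)"
    and "tangent_map M N f (vscale (tangent_bundle M) r v) = vscale (tangent_bundle N) r (tangent_map M N f v)"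
proof -
  have x: "fst v \<in> points M" using v by (simp add: tvecs_iff)
  then obtain c where c: "c \<in> charts M" "fst v \<in> fst c" by (rule smooth_atlas_chart[OF M])
  have fx: "f (fst v) \<in> points N" by (rule smooth_at_points(2)[OF M N f])
  then obtain d where d: "d \<in> charts N" "f (fst v) \<in> fst d" by (rule smooth_atlas_chart[OF N])
  have lin: "linear (frechet_derivative (chart_rep c d f) (at (snd c (fst v))))"
    by (rule has_derivative_linear[OF chart_rep_has_derivative[OF smooth_at_chartsD[OF M N f c d]]])
  note comp = snd_tangent_map[OF M N _ _ c(1) _ d(1)] and tan = tangent_map_in_tvecs[OF M N]
  show "tangent_map M N f (vadd (tangent_bundle M) v w) =
      vadd (tangent_bundle N) (tangent_map M N f v) (tangent_map M N f w)"
    if w: "w \<in> tvecs M" and eq: "fst w = fst v"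
  proof (rule tvecs_eqI[OF _ _ _ d(1)])
    have vw: "(fst v, \<lambda>c. snd v c + snd w c) \<in> tvecs M"
      using vadd_in_tvecs[OF M v w] eq by simp
    show "tangent_map M N f (vadd (tangent_bundle M) v w) \<in> tvecs N"
      using vw f by (simp add: tan)
    show "vadd (tangent_bundle N) (tangent_map M N f v) (tangent_map M N f w) \<in> tvecs N"
      using vadd_in_tvecs[OF N tan[OF v f] tan[OF w]] f eq by simp
    show "snd (tangent_map M N f (vadd (tangent_bundle M) v w)) d =
        snd (vadd (tangent_bundle N) (tangent_map M N f v) (tangent_map M N f w)) d"
      using comp[OF vw] comp[OF v f] comp[OF w] eq f c d by (simp add: linear_add[OF lin])
  qed (use d in simp_all)
  show "tangent_map M N f (vscale (tangent_bundle M) r v) = vscale (tangent_bundle N) r (tangent_map M N f v)"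
  proof (rule tvecs_eqI[OF _ _ _ d(1)])
    have rv: "(fst v, \<lambda>c. r *\<^sub>R snd v c) \<in> tvecs M"
      by (rule vscale_in_tvecs[OF M v])
    show "tangent_map M N f (vscale (tangent_bundle M) r v) \<in> tvecs N"
      using rv f by (simp add: tan)
    show "vscale (tangent_bundle N) r (tangent_map M N f v) \<in> tvecs N"
      using vscale_in_tvecs[OF N tan[OF v f]] by simp
    show "snd (tangent_map M N f (vscale (tangent_bundle M) r v)) d =
        snd (vscale (tangent_bundle N) r (tangent_map M N f v)) d"
      using comp[OF rv] comp[OF v f] f c d by (simp add: linear_cmul[OF lin])
  qed (use d in simp_all)
qed

text \<open>\<open>vadd\<close> keeps the base point of its first argument, so the sum is a tangent
  vector only where the base points agree; agreement is therefore assumed on a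
  neighbourhood.\<close>

lemma smooth_at_vadd_tangent:
  assumes M: "smooth_atlas M" and X: "smooth_atlas X"
    and f: "smooth_at X (TB M) f x" and g: "smooth_at X (TB M) g x"
    and V: "openin (mtop X) V" "x \<in> V" "\<And>y. y \<in> V \<Longrightarrow> fst (f y) = fst (g y)"
  shows "smooth_at X (TB M) (\<lambda>x. vadd (tangent_bundle M) (f x) (g x)) x"
proof -
  note TM = smooth_atlas_tangent_bundle[OF M]
  have fg: "f x \<in> tvecs M" "g x \<in> tvecs M"
    using smooth_at_points(2)[OF X TM f] smooth_at_points(2)[OF X TM g] by simp_all
  have eq: "fst (f x) = fst (g x)" using V by blast
  obtain c where c: "c \<in> charts M" "fst (f x) \<in> fst c"
    by (rule smooth_atlas_chart[OF M tvecsD(1)[OF fg(1)]])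
  obtain Wf where Wf: "openin (mtop X) Wf" "x \<in> Wf" "\<And>y. y \<in> Wf \<Longrightarrow> f y \<in> tvecs M"
    using smooth_at_continuous[OF X TM f openin_mtop_points[OF TM]] fg by (metis points_tangent_bundle)
  obtain Wg where Wg: "openin (mtop X) Wg" "x \<in> Wg" "\<And>y. y \<in> Wg \<Longrightarrow> g y \<in> tvecs M"
    using smooth_at_continuous[OF X TM g openin_mtop_points[OF TM]] fg by (metis points_tangent_bundle)
  show ?thesis
  proof (rule smooth_at_into_tangent_bundle[OF M X c(1)])
    show "smooth_at X M (\<lambda>x. fst (vadd (tangent_bundle M) (f x) (g x))) x"
      using smooth_at_compose[OF X TM M f smooth_at_tangent_proj[OF M fg(1)]] by simp
    show "smooth_at X euclid (\<lambda>x. snd (vadd (tangent_bundle M) (f x) (g x)) c) x"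
      using smooth_at_add[OF X smooth_at_compose[OF X TM _ f smooth_at_tangent_component[OF M fg(1) c]]
          smooth_at_compose[OF X TM _ g smooth_at_tangent_component[OF M fg(2) c(1)]]] c(2) eq by simp
    show "openin (mtop X) (V \<inter> Wf \<inter> Wg)" "x \<in> V \<inter> Wf \<inter> Wg"
      using V Wf Wg by auto
    show "vadd (tangent_bundle M) (f y) (g y) \<in> tvecs M" if "y \<in> V \<inter> Wf \<inter> Wg" for y
      using vadd_in_tvecs[OF M Wf(3) Wg(3), of y y] V(3)[of y] that by simp
  qed (use c in simp)
qed

lemma smooth_at_vscale_tangent:
  assumes M: "smooth_atlas M" and X: "smooth_atlas X"
    and f: "smooth_at X (TB M) f x"
  shows "smooth_at X (TB M) (\<lambda>x. vscale (tangent_bundle M) r (f x)) x"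
proof -
  note TM = smooth_atlas_tangent_bundle[OF M]
  have fx: "f x \<in> tvecs M"
    using smooth_at_points(2)[OF X TM f] by simp
  obtain c where c: "c \<in> charts M" "fst (f x) \<in> fst c"
    by (rule smooth_atlas_chart[OF M tvecsD(1)[OF fx]])
  obtain Wf where Wf: "openin (mtop X) Wf" "x \<in> Wf" "\<And>y. y \<in> Wf \<Longrightarrow> f y \<in> tvecs M"
    using smooth_at_continuous[OF X TM f openin_mtop_points[OF TM]] fx by (metis points_tangent_bundle)
  show ?thesis
  proof (rule smooth_at_into_tangent_bundle[OF M X c(1) _ _ _ Wf(1,2)])
    show "smooth_at X M (\<lambda>x. fst (vscale (tangent_bundle M) r (f x))) x"
      using smooth_at_compose[OF X TM M f smooth_at_tangent_proj[OF M fx]] by simp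
    show "smooth_at X euclid (\<lambda>x. snd (vscale (tangent_bundle M) r (f x)) c) x"
      using smooth_at_scaleR[OF X smooth_at_compose[OF X TM _ f smooth_at_tangent_component[OF M fx c]]] by simp
    show "vscale (tangent_bundle M) r (f y) \<in> tvecs M" if "y \<in> Wf" for y
      using vscale_in_tvecs[OF M Wf(3)[OF that]] by simp
  qed (use c in simp)
qed

section \<open>The tangent bundle of a fiber bundle\<close>

lemma smooth_on_if_smooth_at:
  "(\<And>x. x \<in> S \<Longrightarrow> smooth_at euclid euclid f x) \<Longrightarrow> smooth_on S f"
  by (rule smooth_on_locally) (simp add: smooth_at_euclid_iff)

text \<open>Differentiation of \<open>g (f x) = x\<close> on an open set. Applied in both orders it
  makes the derivatives of a coordinate change and of its inverse mutually inverse.\<close>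

lemma frechet_derivative_left_inverse:
  assumes "smooth_on A f" "smooth_on B g" "open A" "x \<in> A" "f x \<in> B" "\<And>x. x \<in> A \<Longrightarrow> g (f x) = x"
  shows "frechet_derivative g (at (f x)) (frechet_derivative f (at x) v) = v"
proof -
  have "((\<lambda>x. g (f x)) has_derivative (\<lambda>v. frechet_derivative g (at (f x)) (frechet_derivative f (at x) v))) (at x)"
    by (rule has_derivative_compose[OF smooth_on_has_derivative[OF assms(1,4)] smooth_on_has_derivative[OF assms(2,5)]])
  from has_derivative_transform_within_open[OF this assms(3,4,6)]
  have "((\<lambda>x. x) has_derivative (\<lambda>v. frechet_derivative g (at (f x)) (frechet_derivative f (at x) v))) (at x)" .
  from fun_cong[OF has_derivative_unique[OF this has_derivative_ident], of v] show ?thesis .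
qed

lemma fiber_bundleD:
  assumes "fiber_bundle N M F p"
  shows "smooth_atlas N" "smooth_atlas M" "y \<in> points N \<Longrightarrow> smooth_at N M p y"
    "y \<in> points N \<Longrightarrow> p y \<in> points M" "v \<in> tvecs N \<Longrightarrow> smooth_at N M p (fst v)"
proof -
  show N: "smooth_atlas N" and M: "smooth_atlas M"
    using assms by (simp_all add: fiber_bundle_def smooth_manifold_iff_atlas)
  show p: "smooth_at N M p y" if "y \<in> points N" for y
    using assms that unfolding fiber_bundle_def smooth_map_iff_smooth_at[OF N M] by blast
  show "p y \<in> points M" if "y \<in> points N"
    by (rule smooth_at_points(2)[OF N M p[OF that]])
  show "smooth_at N M p (fst v)" if "v \<in> tvecs N"
    by (rule p[OF tvecsD(1)[OF that]])
qed

text \<open>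
  A local trivialization of \<open>p\<close> identifies a piece of \<open>N\<close> with an open subset of \<open>'m \<times> 'k\<close>, such that
  \<open>p\<close> becomes the first projection; \<open>r\<close> gives the components of tangent vectors of \<open>N\<close> in these
  coordinates and \<open>s\<close> is its inverse.
\<close>

locale tangent_triv =
  fixes N :: "('b, 'n::fin_dim_inner) manifold" and M :: "('a, 'm::fin_dim_inner) manifold"
    and p :: "'b \<Rightarrow> 'a" and U :: "'b set" and d :: "('a, 'm) chart"
    and r :: "('b, 'n) tvec \<Rightarrow> 'm \<times> 'k::fin_dim_inner" and s :: "'b \<Rightarrow> 'm \<times> 'k \<Rightarrow> ('b, 'n) tvec"
  assumes domain: "openin (mtop N) U" and base_chart: "d \<in> charts M" "y \<in> U \<Longrightarrow> p y \<in> fst d"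
    and smooth: "v \<in> tvecs N \<Longrightarrow> fst v \<in> U \<Longrightarrow> smooth_at (TB N) euclid r v"
    and fst_coordinate: "v \<in> tvecs N \<Longrightarrow> fst v \<in> U \<Longrightarrow> fst (r v) = snd (tangent_map N M p v) d"
    and inverse: "v \<in> tvecs N \<Longrightarrow> fst v \<in> U \<Longrightarrow> s (fst v) (r v) = v"
    and vadd: "fst v \<in> U \<Longrightarrow> fst w = fst v \<Longrightarrow> r (vadd (tangent_bundle N) v w) = r v + r w"
    and vscale: "fst v \<in> U \<Longrightarrow> r (vscale (tangent_bundle N) t v) = t *\<^sub>R r v"
    and vzero: "y \<in> U \<Longrightarrow> r (vzero (tangent_bundle N) y) = 0"
    and inverse_in: "y \<in> U \<Longrightarrow> s y z \<in> tvecs N"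
    and fst_inverse: "y \<in> U \<Longrightarrow> fst (s y z) = y"
    and coordinate_inverse: "y \<in> U \<Longrightarrow> r (s y z) = z"
    and smooth_inverse: "y \<in> U \<Longrightarrow>
      smooth_at (prod_manifold N euclid) (TB N) (\<lambda>t. s (fst t) (snd t)) (y, z)"

lemmas tangent_trivD = tangent_triv.domain tangent_triv.base_chart tangent_triv.smooth
  tangent_triv.fst_coordinate tangent_triv.inverse tangent_triv.vadd tangent_triv.vscale
  tangent_triv.vzero tangent_triv.inverse_in tangent_triv.fst_inverse
  tangent_triv.coordinate_inverse tangent_triv.smooth_inverse

text \<open>The coordinates \<open>g\<close> combine a chart \<open>d\<close> of the base with a
  chart \<open>e\<close> of the typical fibre, the latter after the product trivialization \<Psi>.
  Seen through a chart \<open>c\<close> of \<open>N\<close>, \<open>g\<close> and its inverse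
  \<open>k\<close> become \<psi> and \<kappa>, smooth maps between open sets of \<open>'n\<close>
  and \<open>'m \<times> 'k\<close>; \<open>r\<close> and \<open>s\<close> are their derivatives,
  transported to tangent vectors by \<open>c\<close>.\<close>

lemma fiber_bundle_tangent_triv:
  fixes N :: "('b, 'n::fin_dim_inner) manifold" and M :: "('a, 'm::fin_dim_inner) manifold"
    and F :: "('d, 'k::fin_dim_inner) manifold"
  assumes FB: "fiber_bundle N M F p" and y0: "y0 \<in> points N"
  obtains U d and r :: "('b, 'n) tvec \<Rightarrow> 'm \<times> 'k" and s where "tangent_triv N M p U d r s" "y0 \<in> U"
proof -
  note N = fiber_bundleD(1)[OF FB] and M = fiber_bundleD(2)[OF FB] and p = fiber_bundleD(3)[OF FB]
  have F: "smooth_atlas F"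
    using FB by (simp add: fiber_bundle_def smooth_manifold_iff_atlas)
  note py0 = fiber_bundleD(4)[OF FB y0]
  from FB py0 obtain U1 \<Psi> where U1: "openin (mtop M) U1" "p y0 \<in> U1"
    and df: "diffeo (open_sub N (p -` U1)) (prod_manifold (open_sub M U1) F) \<Psi>"
    and fs: "\<And>y. y \<in> points N \<inter> p -` U1 \<Longrightarrow> fst (\<Psi> y) = p y"
    unfolding fiber_bundle_def by meson
  note UM = openin_mtop_Int_points[OF M U1(1)]
  have BU: "openin (mtop M) (points M \<inter> U1)" using U1 by (simp add: UM)
  define N1 where "N1 = points N \<inter> p -` U1"
  have N1: "openin (mtop N) N1"
    unfolding N1_def by (rule smooth_openin_vimage[OF N M p U1(1)])
  note aX = smooth_atlas_open_sub[OF N N1[unfolded N1_def]] and aB = smooth_atlas_open_sub[OF M BU]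
  note aP = smooth_atlas_prod[OF aB F]
  have pX: "points (open_sub N (p -` U1)) = N1" by (simp add: N1_def)
  have pP: "points (prod_manifold (open_sub M U1) F) = U1 \<times> points F" by (simp add: UM)
  have bij: "bij_betw \<Psi> N1 (U1 \<times> points F)"
    and s1: "\<And>a. a \<in> N1 \<Longrightarrow> smooth_at (open_sub N (p -` U1)) (prod_manifold (open_sub M U1) F) \<Psi> a"
    and s2: "\<And>q. q \<in> U1 \<times> points F \<Longrightarrow>
        smooth_at (prod_manifold (open_sub M U1) F) (open_sub N (p -` U1)) (inv_into N1 \<Psi>) q"
    using df unfolding diffeo_def smooth_map_iff_smooth_at[OF aX aP] smooth_map_iff_smooth_at[OF aP aX] pX pP
    by blast+
  have \<Psi>F: "\<Psi> y \<in> U1 \<times> points F" if "y \<in> N1" for y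
    using bij that by (auto simp: bij_betw_def)
  have s\<Psi>: "smooth_at N F (\<lambda>y. snd (\<Psi> y)) y" if y: "y \<in> N1" for y
  proof -
    have "\<Psi> y \<in> points (open_sub M U1) \<times> points F" using \<Psi>F[OF y] UM by auto
    from smooth_at_compose[OF aX aP F s1[OF y] smooth_at_snd[OF aB F this]]
    show ?thesis by (simp add: smooth_at_open_sub_dom[OF N N1[unfolded N1_def]])
  qed
  have y01: "y0 \<in> N1" using y0 U1 by (simp add: N1_def)
  obtain c where c: "c \<in> charts N" "y0 \<in> fst c" by (rule smooth_atlas_chart[OF N y0])
  obtain d where d: "d \<in> charts M" "p y0 \<in> fst d" by (rule smooth_atlas_chart[OF M py0])
  have "snd (\<Psi> y0) \<in> points F" using \<Psi>F[OF y01] by auto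
  then obtain e where e: "e \<in> charts F" "snd (\<Psi> y0) \<in> fst e" by (rule smooth_atlas_chart[OF F])
  \<comment> \<open>All of \<open>c\<close>, \<open>d\<close>, \<open>e\<close> and \<Psi> are
    available here; openness comes from continuity of \<open>p\<close> and of the fibre component of
    \<Psi>.\<close>
  define U where "U = fst c \<inter> {y \<in> N1. p y \<in> fst d} \<inter> {y \<in> N1. snd (\<Psi> y) \<in> fst e}"
  have U: "openin (mtop N) U"
    unfolding U_def
    using openin_mtop_chart[OF N c(1)]
      smooth_at_open_preimage[OF N M N1 p openin_mtop_chart[OF M d(1)]]
      smooth_at_open_preimage[OF N F N1 s\<Psi> openin_mtop_chart[OF F e(1)]]
    by (auto simp: N1_def)
  have UN: "y \<in> N1" "y \<in> fst c" "p y \<in> fst d" "snd (\<Psi> y) \<in> fst e" "y \<in> points N" if "y \<in> U" for y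
    using that by (auto simp: U_def N1_def)
  define g where "g y = (snd d (p y), snd e (snd (\<Psi> y)))" for y
  define k where "k z = inv_into N1 \<Psi> (cinv d (fst z), cinv e (snd z))" for z
  define Q where "Q = snd d ` (U1 \<inter> fst d) \<times> snd e ` fst e"
  have Q: "open Q"
    unfolding Q_def using U1(1) d(1) smooth_atlasD(2)[OF F e(1)]
    by (intro open_Times) (simp_all add: openin_mtop_atlas[OF M])
  have gU: "g y \<in> Q" if "y \<in> U" for y
    using UN[OF that] by (auto simp: g_def Q_def N1_def)
  have cin: "cinv d (fst z) \<in> U1 \<inter> fst d" "cinv e (snd z) \<in> fst e" "cinv e (snd z) \<in> points F"
    "(snd d (cinv d (fst z)), snd e (cinv e (snd z))) = z" if "z \<in> Q" for z
    using that M F d(1) e(1) smooth_atlasD(3)[OF F e(1)] by (auto simp: Q_def)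
  have \<Psi>k: "\<Psi> (k z) = (cinv d (fst z), cinv e (snd z))" and kN1: "k z \<in> N1" if "z \<in> Q" for z
    using cin[OF that] bij f_inv_into_f[of "(cinv d (fst z), cinv e (snd z))" \<Psi> N1]
      inv_into_into[of "(cinv d (fst z), cinv e (snd z))" \<Psi> N1]
    unfolding k_def bij_betw_def by auto
  have pk: "p (k z) = cinv d (fst z)" if "z \<in> Q" for z
    using fs[of "k z"] kN1[OF that] \<Psi>k[OF that] by (simp add: N1_def)
  have gk: "g (k z) = z" if "z \<in> Q" for z
    using cin(4)[OF that] by (simp add: g_def pk[OF that] \<Psi>k[OF that])
  have kg: "k (g y) = y" if "y \<in> U" for y
  proof -
    have "(cinv d (fst (g y)), cinv e (snd (g y))) = (p y, snd (\<Psi> y))"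
      using UN[OF that] M F d(1) e(1) by (simp add: g_def)
    also have "\<dots> = \<Psi> y" using fs[of y] UN(1)[OF that] by (simp add: prod_eq_iff N1_def)
    finally show ?thesis
      unfolding k_def using bij UN(1)[OF that] by (simp add: bij_betw_def)
  qed
  have sk: "smooth_at euclid N k z" if z: "z \<in> Q" for z
  proof -
    have pr: "smooth_at euclid euclid fst z" "smooth_at euclid euclid snd z"
      unfolding smooth_at_euclid_iff using smooth_on_fst smooth_on_snd by blast+
    have zd: "fst z \<in> snd d ` fst d" "snd z \<in> snd e ` fst e" using z by (auto simp: Q_def)
    have "smooth_at euclid M (\<lambda>z. cinv d (fst z)) z"
      by (rule smooth_at_compose[OF _ _ M pr(1) smooth_at_cinv[OF M d(1) zd(1)]]) simp_all
    then have "smooth_at euclid (open_sub M U1) (\<lambda>z. cinv d (fst z)) z"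
      using cin(1)[OF z] by (simp add: smooth_at_open_sub_cod[OF _ M BU])
    moreover have "smooth_at euclid F (\<lambda>z. cinv e (snd z)) z"
      by (rule smooth_at_compose[OF _ _ F pr(2) smooth_at_cinv[OF F e(1) zd(2)]]) simp_all
    ultimately have "smooth_at euclid (prod_manifold (open_sub M U1) F) (\<lambda>z. (cinv d (fst z), cinv e (snd z))) z"
      by (rule smooth_at_Pair[OF smooth_atlas_euclid aB F])
    from smooth_at_compose[OF smooth_atlas_euclid aP aX this s2] cin[OF z]
    have "smooth_at euclid (open_sub N (p -` U1)) k z"
      by (simp add: k_def[abs_def])
    then show ?thesis by (simp add: smooth_at_open_sub_cod[OF _ N N1[unfolded N1_def]])
  qed
  have sg: "smooth_at N euclid g y" if y: "y \<in> U" for y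
    unfolding g_def using UN[OF y] d(1) e(1)
    by (intro smooth_at_Pair_euclid[OF N] smooth_at_compose[OF N M smooth_atlas_euclid p]
        smooth_at_compose[OF N F smooth_atlas_euclid s\<Psi>] smooth_at_chart[OF M] smooth_at_chart[OF F])
  \<comment> \<open>\<open>k\<close> may leave the domain of \<open>c\<close>; restricting to
    \<open>Q'\<close> is what makes \<kappa> smooth and keeps \<open>k\<close> in
    \<open>U\<close>.\<close>
  define Q' where "Q' = {z \<in> Q. k z \<in> fst c}"
  have "openin (mtop euclid) Q'"
    unfolding Q'_def using smooth_at_open_preimage[OF smooth_atlas_euclid N _ sk openin_mtop_chart[OF N c(1)]] Q
    by simp
  then have Q': "open Q'" by simp
  have gQ': "g y \<in> Q'" if "y \<in> U" for y
    using gU[OF that] kg[OF that] UN(2)[OF that] by (simp add: Q'_def)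
  have kU: "k z \<in> U" if "z \<in> Q'" for z
    using that kN1[of z] pk[of z] \<Psi>k[of z] cin[of z] by (simp add: Q'_def U_def)
  define \<psi> where "\<psi> t = g (cinv c t)" for t
  define \<kappa> where "\<kappa> z = snd c (k z)" for z
  have cU: "open (snd c ` U)"
  proof -
    have "U \<inter> fst c = U" by (auto simp: U_def)
    then show ?thesis using U c(1) unfolding openin_mtop_atlas[OF N] by metis
  qed
  have cc: "cinv c (snd c y) = y" if "y \<in> U" for y
    using UN(2)[OF that] N c(1) by simp
  have \<psi>: "smooth_on (snd c ` U) \<psi>"
  proof (rule smooth_on_if_smooth_at)
    fix t
    assume "t \<in> snd c ` U"
    then obtain y where y: "y \<in> U" "t = snd c y" by blast
    then have "t \<in> snd c ` fst c" using UN(2) by blast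
    from smooth_at_compose[OF smooth_atlas_euclid N smooth_atlas_euclid smooth_at_cinv[OF N c(1) this]] sg[OF y(1)] cc[OF y(1)] y(2)
    show "smooth_at euclid euclid \<psi> t" by (simp add: \<psi>_def[abs_def])
  qed
  have \<kappa>: "smooth_on Q' \<kappa>"
  proof (rule smooth_on_if_smooth_at)
    fix z
    assume "z \<in> Q'"
    then have z: "z \<in> Q" "k z \<in> fst c" by (simp_all add: Q'_def)
    from smooth_at_compose[OF _ N _ sk[OF z(1)] smooth_at_chart[OF N c(1) z(2)]]
    show "smooth_at euclid euclid \<kappa> z" by (simp add: \<kappa>_def[abs_def])
  qed
  have \<kappa>\<psi>: "frechet_derivative \<kappa> (at (g y)) (frechet_derivative \<psi> (at (snd c y)) v) = v"
    if y: "y \<in> U" for y v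
  proof -
    have "\<kappa> (\<psi> t) = t" if "t \<in> snd c ` U" for t
      using that cc kg by (auto simp: \<kappa>_def \<psi>_def)
    moreover have "\<psi> (snd c y) = g y" using cc[OF y] by (simp add: \<psi>_def)
    ultimately show ?thesis
      using frechet_derivative_left_inverse[OF \<psi> \<kappa> cU, of "snd c y" v] y gQ'[OF y] by simp
  qed
  have \<psi>\<kappa>: "frechet_derivative \<psi> (at (snd c y)) (frechet_derivative \<kappa> (at (g y)) z) = z"
    if y: "y \<in> U" for y z
  proof -
    have "\<psi> (\<kappa> z) = z" if "z \<in> Q'" for z
      using that cc[OF kU[OF that]] gk[of z] by (simp add: \<kappa>_def \<psi>_def Q'_def)
    moreover have "\<kappa> (g y) = snd c y" using kg[OF y] by (simp add: \<kappa>_def)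
    ultimately show ?thesis
      using frechet_derivative_left_inverse[OF \<kappa> \<psi> Q' gQ'[OF y], of z] y by simp
  qed
  define r where "r v = frechet_derivative \<psi> (at (snd c (fst v))) (snd v c)" for v :: "('b, 'n) tvec"
  define s where "s y z = tlift N c y (frechet_derivative \<kappa> (at (g y)) z)" for y z
  note TN = smooth_atlas_tangent_bundle[OF N]
  note NE = smooth_atlas_prod[OF N smooth_atlas_euclid]
  have lin: "linear (frechet_derivative \<psi> (at (snd c y)))" if "y \<in> U" for y
    using that by (intro has_derivative_linear[OF smooth_on_has_derivative[OF \<psi>]]) simp
  have "tangent_triv N M p U d r s"
  proof (rule tangent_triv.intro)
    show "openin (mtop N) U" by (rule U)
    show "d \<in> charts M" by (rule d)
    show "p y \<in> fst d" if "y \<in> U" for y by (rule UN(3)[OF that])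
    show "smooth_at (TB N) euclid r v" if v: "v \<in> tvecs N" "fst v \<in> U" for v
    proof -
      have "smooth_at (TB N) euclid (\<lambda>v. (snd c (fst v), snd v c)) v"
        by (intro smooth_at_Pair_euclid[OF TN] smooth_at_tangent_component[OF N v(1) c(1) UN(2)[OF v(2)]]
            smooth_at_compose[OF TN N smooth_atlas_euclid smooth_at_tangent_proj[OF N v(1)]]
            smooth_at_chart[OF N c(1) UN(2)[OF v(2)]])
      from smooth_at_compose_smooth_on[OF TN this smooth_on_derivative[OF \<psi> cU] open_Times[OF cU open_UNIV]] v(2)
      show ?thesis by (simp add: r_def[abs_def])
    qed
    show "fst (r v) = snd (tangent_map N M p v) d" if v: "v \<in> tvecs N" "fst v \<in> U" for v
    proof -
      \<comment> \<open>In these coordinates \<open>p\<close> is the first projection, so the first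
        component of \<open>r\<close> is the derivative of \<open>p\<close>.\<close>
      have "chart_rep c d p = (\<lambda>t. fst (\<psi> t))"
        by (simp add: chart_rep_def \<psi>_def g_def fun_eq_iff)
      moreover have "((\<lambda>t. fst (\<psi> t)) has_derivative (\<lambda>u. fst (frechet_derivative \<psi> (at (snd c (fst v))) u))) (at (snd c (fst v)))"
        using v(2) by (intro has_derivative_fst smooth_on_has_derivative[OF \<psi>]) simp
      ultimately have "(chart_rep c d p has_derivative (\<lambda>u. fst (frechet_derivative \<psi> (at (snd c (fst v))) u))) (at (snd c (fst v)))"
        by simp
      from fun_cong[OF frechet_derivative_at[OF this], of "snd v c"]
      have "frechet_derivative (chart_rep c d p) (at (snd c (fst v))) (snd v c) = fst (r v)"
        by (simp add: r_def)
      with snd_tangent_map[OF N M v(1) p[OF UN(5)] c(1) UN(2) d(1) UN(3)] v(2) show ?thesis by simp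
    qed
    show "s (fst v) (r v) = v" if v: "v \<in> tvecs N" "fst v \<in> U" for v
      using \<kappa>\<psi>[OF v(2)] tlift_component[OF v(1) c(1) UN(2)[OF v(2)]] by (simp add: s_def r_def)
    show "r (vadd (tangent_bundle N) v w) = r v + r w" if "fst v \<in> U" "fst w = fst v" for v w
      using that by (simp add: r_def linear_add[OF lin])
    show "r (vscale (tangent_bundle N) t v) = t *\<^sub>R r v" if "fst v \<in> U" for v t
      using that by (simp add: r_def linear_cmul[OF lin])
    show "r (vzero (tangent_bundle N) y) = 0" if "y \<in> U" for y
      using that by (simp add: r_def linear_0[OF lin])
    fix y z
    assume y: "y \<in> U"
    show "s y z \<in> tvecs N" unfolding s_def by (rule tlift_in_tvecs[OF N c(1) UN(2)[OF y]])
    show "fst (s y z) = y" by (simp add: s_def)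
    show "r (s y z) = z"
      using \<psi>\<kappa>[OF y] by (simp add: r_def s_def snd_tlift[OF N c(1) UN(2)[OF y]])
    have yz: "(y, z) \<in> points N \<times> points (euclid :: ('m \<times> 'k, 'm \<times> 'k) manifold)"
      using UN(5)[OF y] by simp
    have sf: "smooth_at (prod_manifold N euclid) N fst (y, z)"
      by (rule smooth_at_fst[OF N smooth_atlas_euclid yz])
    have "smooth_at (prod_manifold N euclid) euclid (\<lambda>t. (g (fst t), snd t)) (y, z)"
      by (rule smooth_at_Pair_euclid[OF NE smooth_at_compose[OF NE N smooth_atlas_euclid sf]
            smooth_at_snd[OF N smooth_atlas_euclid yz]]) (simp add: sg[OF y])
    from smooth_at_compose_smooth_on[OF NE this smooth_on_derivative[OF \<kappa> Q'] open_Times[OF Q' open_UNIV]] gQ'[OF y]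
    have "smooth_at (prod_manifold N euclid) euclid (\<lambda>t. frechet_derivative \<kappa> (at (g (fst t))) (snd t)) (y, z)"
      by simp
    then show "smooth_at (prod_manifold N euclid) (TB N) (\<lambda>t. s (fst t) (snd t)) (y, z)"
      unfolding s_def using UN(2)[OF y] by (intro smooth_at_tlift[OF N NE c(1) _ sf]) simp
  qed
  moreover have "y0 \<in> U" using c(2) d(2) e(2) y01 by (simp add: U_def)
  ultimately show ?thesis by (rule that)
qed

section \<open>Pullbacks, Whitney sums, vertical and prolongation bundles\<close>

lemma vb_morphismD:
  assumes E: "smooth_atlas (tspace E)" and E': "smooth_atlas (tspace E')" and \<phi>: "vb_morphism E E' \<phi>"
  shows "a \<in> points (tspace E) \<Longrightarrow> smooth_at (tspace E) (tspace E') \<phi> a"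
    "a \<in> points (tspace E) \<Longrightarrow> \<phi> a \<in> points (tspace E')"
    "a \<in> points (tspace E) \<Longrightarrow> bproj E' (\<phi> a) = bproj E a"
    "a \<in> points (tspace E) \<Longrightarrow> b \<in> points (tspace E) \<Longrightarrow> bproj E a = bproj E b \<Longrightarrow>
      \<phi> (vadd E a b) = vadd E' (\<phi> a) (\<phi> b)"
    "a \<in> points (tspace E) \<Longrightarrow> \<phi> (vscale E r a) = vscale E' r (\<phi> a)"
proof -
  show s: "smooth_at (tspace E) (tspace E') \<phi> a" if "a \<in> points (tspace E)" for a
    using \<phi> that unfolding vb_morphism_def smooth_map_iff_smooth_at[OF E E'] by blast
  show "\<phi> a \<in> points (tspace E')" if "a \<in> points (tspace E)"
    by (rule smooth_at_points(2)[OF E E' s[OF that]])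
qed (use \<phi> in \<open>simp_all add: vb_morphism_def fiber_def\<close>)

lemma smooth_at_prod_snd_map:
  fixes l :: "'f::fin_dim_inner \<Rightarrow> 'g::fin_dim_inner"
  assumes B: "smooth_atlas B" and y: "y \<in> points B" and l: "smooth_on UNIV l"
  shows "smooth_at (prod_manifold B euclid) (prod_manifold B euclid) (\<lambda>z. (fst z, l (snd z))) (y, w)"
proof -
  note BE = smooth_atlas_prod[OF B smooth_atlas_euclid]
  have yw: "(y, w) \<in> points B \<times> points (euclid :: ('f, 'f) manifold)" using y by simp
  show ?thesis
    by (rule smooth_at_Pair[OF BE B smooth_atlas_euclid smooth_at_fst[OF B smooth_atlas_euclid yw]
          smooth_at_compose_smooth_on[OF BE smooth_at_snd[OF B smooth_atlas_euclid yw] l]]) auto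
qed

text \<open>Both vectors have fibre coordinate 0 over the same base point. Bundle morphisms are only
  required to respect sums and multiples, so this is how they are seen to respect zero.\<close>

lemma ambient_bundle_vscale_0:
  assumes E: "ambient_bundle B N S E" and a: "a \<in> S"
  shows "vscale E 0 a = vzero E (bproj E a)"
proof -
  note D = ambient_bundleD[OF E]
  have x: "bproj E a \<in> points B" by (rule ambient_bundle_bproj[OF E a])
  obtain U G H where U: "bproj E a \<in> U" and T: "local_triv B N S E U G H"
    using D(11)[OF x] by blast
  note T = local_trivD[OF T]
  have "vscale E 0 a = H (bproj E a) 0"
    using T(2)[OF D(9)[OF a, of 0]] T(4)[OF a U, of 0] D(10)[OF a, of 0] U by simp
  moreover have "vzero E (bproj E a) = H (bproj E a) 0"
    using T(2)[OF D(5)[OF x]] T(5)[OF U] D(6)[OF x] U by simp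
  ultimately show ?thesis by simp
qed

text \<open>The fibre coordinate of \<open>E\<close> at the second entry is used over the preimage
  of \<open>U\<close>; its inverse over \<open>y\<close> is the inverse of \<open>E\<close> over
  \<open>p y\<close>, paired with \<open>y\<close>.\<close>

lemma ambient_bundle_pullback:
  fixes N :: "('b, 'n::fin_dim_inner) manifold" and M :: "('a, 'm::fin_dim_inner) manifold"
    and E :: "('x, 'a, 'm, 'f::fin_dim_inner) vbundle"
  assumes N: "smooth_atlas N" and p: "\<And>y. y \<in> points N \<Longrightarrow> smooth_at N M p y"
    and E: "ambient_bundle M (tspace E) (points (tspace E)) E"
  shows "ambient_bundle N (prod_manifold N (tspace E))
    {(x, a) \<in> points N \<times> points (tspace E). p x = bproj E a} (pullback_bundle N p E)"
proof -
  note D = ambient_bundleD[OF E]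
  note NE = smooth_atlas_prod[OF N D(2)]
  note NF = smooth_atlas_prod[OF N smooth_atlas_euclid]
  have simps: "bproj (pullback_bundle N p E) = fst"
    "vadd (pullback_bundle N p E) = (\<lambda>(x, a) (_, b). (x, vadd E a b))"
    "vscale (pullback_bundle N p E) = (\<lambda>r (x, a). (x, vscale E r a))"
    "vzero (pullback_bundle N p E) = (\<lambda>x. (x, vzero E (p x)))"
    by (simp_all add: pullback_bundle_def)
  have pM: "p y \<in> points M" if "y \<in> points N" for y
    by (rule smooth_at_points(2)[OF N D(1) p[OF that]])
  let ?S = "{(x, a) \<in> points N \<times> points (tspace E). p x = bproj E a}"
  show ?thesis
  proof (rule ambient_bundle.intro)
    show "smooth_atlas N" by (rule N)
    show "smooth_atlas (prod_manifold N (tspace E))" by (rule NE)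
    show "smooth_at (prod_manifold N (tspace E)) N (bproj (pullback_bundle N p E)) z"
      if "z \<in> points (prod_manifold N (tspace E))" for z
      using that smooth_at_fst[OF N D(2)] by (simp add: simps)
    fix x
    assume x: "x \<in> points N"
    obtain U G H where U: "openin (mtop M) U" "p x \<in> U"
      and T: "local_triv M (tspace E) (points (tspace E)) E U G H"
      using D(11)[OF pM[OF x]] by blast
    note T = local_trivD[OF T]
    define W where "W = {y \<in> points N. p y \<in> U}"
    have W: "openin (mtop N) W" "x \<in> W"
      unfolding W_def using smooth_at_open_preimage[OF N D(1) openin_mtop_points[OF N] p U(1)] x U(2) by auto
    have "local_triv N (prod_manifold N (tspace E)) ?S (pullback_bundle N p E) W
        (\<lambda>z. G (snd z)) (\<lambda>y w. (y, H (p y) w))"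
    proof (rule local_triv.intro)
      show "smooth_at (prod_manifold N (tspace E)) euclid (\<lambda>z. G (snd z)) z"
        if "z \<in> ?S" "bproj (pullback_bundle N p E) z \<in> W" for z
        using that T(1)[of "snd z"]
        by (intro smooth_at_compose[OF NE D(2) smooth_atlas_euclid smooth_at_snd[OF N D(2)]])
          (auto simp: simps W_def)
      fix y and w :: 'f
      assume y: "y \<in> W"
      then have yN: "y \<in> points N" and pU: "p y \<in> U" by (simp_all add: W_def)
      have yw: "(y, w) \<in> points N \<times> points (euclid :: ('f, 'f) manifold)" using yN by simp
      note f = smooth_at_fst[OF N smooth_atlas_euclid yw] and s = smooth_at_snd[OF N smooth_atlas_euclid yw]
      have "smooth_at (prod_manifold N euclid) M (\<lambda>z. p (fst z)) (y, w)"
        by (rule smooth_at_compose[OF NF N D(1) f]) (simp add: p yN)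
      from smooth_at_Pair[OF NF D(1) smooth_atlas_euclid this s]
      have "smooth_at (prod_manifold N euclid) (prod_manifold M euclid) (\<lambda>z. (p (fst z), snd z)) (y, w)" .
      from smooth_at_compose[OF NF smooth_atlas_prod[OF D(1) smooth_atlas_euclid] D(2) this, where g = "\<lambda>z. H (fst z) (snd z)"] T(6)[OF pU]
      have "smooth_at (prod_manifold N euclid) (tspace E) (\<lambda>z. H (p (fst z)) (snd z)) (y, w)" by simp
      from smooth_at_Pair[OF NF N D(2) f this]
      show "smooth_at (prod_manifold N euclid) (prod_manifold N (tspace E))
          (\<lambda>z. (fst z, H (p (fst z)) (snd z))) (y, w)" .
    qed (auto simp: simps W_def T(2-5,7-9))
    with W show "\<exists>U G H. openin (mtop N) U \<and> x \<in> U \<and>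
        local_triv N (prod_manifold N (tspace E)) ?S (pullback_bundle N p E) U G H" by blast
  qed (auto simp: simps D(5-10) pM)
qed

text \<open>Over the intersection of two trivializing sets the fibre coordinates are placed side by
  side. Both summands are taken with their own total spaces, as in the definition of the Whitney
  sum.\<close>

lemma ambient_bundle_whitney_sum:
  fixes N :: "('b, 'n::fin_dim_inner) manifold"
    and E :: "('x, 'b, 'n, 'f::fin_dim_inner) vbundle" and E' :: "('y, 'b, 'n, 'g::fin_dim_inner) vbundle"
  assumes E: "ambient_bundle N (tspace E) (points (tspace E)) E"
    and E': "ambient_bundle N (tspace E') (points (tspace E')) E'"
  shows "ambient_bundle N (prod_manifold (tspace E) (tspace E'))
    {(a, b) \<in> points (tspace E) \<times> points (tspace E'). bproj E a = bproj E' b} (whitney_sum E E')"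
proof -
  note D = ambient_bundleD[OF E] and D' = ambient_bundleD[OF E']
  note EE = smooth_atlas_prod[OF D(2) D'(2)]
  note NF = smooth_atlas_prod[OF D(1) smooth_atlas_euclid]
  have simps: "bproj (whitney_sum E E') = (\<lambda>z. bproj E (fst z))"
    "vadd (whitney_sum E E') = (\<lambda>(a, b) (a', b'). (vadd E a a', vadd E' b b'))"
    "vscale (whitney_sum E E') = (\<lambda>r (a, b). (vscale E r a, vscale E' r b))"
    "vzero (whitney_sum E E') = (\<lambda>x. (vzero E x, vzero E' x))"
    by (simp_all add: whitney_sum_def split_beta fun_eq_iff)
  let ?S = "{(a, b) \<in> points (tspace E) \<times> points (tspace E'). bproj E a = bproj E' b}"
  show ?thesis
  proof (rule ambient_bundle.intro)
    show "smooth_atlas N" by (rule D(1))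
    show "smooth_atlas (prod_manifold (tspace E) (tspace E'))" by (rule EE)
    show "smooth_at (prod_manifold (tspace E) (tspace E')) N (bproj (whitney_sum E E')) z"
      if "z \<in> points (prod_manifold (tspace E) (tspace E'))" for z
      unfolding simps using that
      by (intro smooth_at_compose[OF EE D(2,1) smooth_at_fst[OF D(2) D'(2)] D(4)]) auto
    fix x
    assume x: "x \<in> points N"
    obtain U G H where U: "openin (mtop N) U" "x \<in> U"
      and T: "local_triv N (tspace E) (points (tspace E)) E U G H"
      using D(11)[OF x] by blast
    obtain U' G' H' where U': "openin (mtop N) U'" "x \<in> U'"
      and T': "local_triv N (tspace E') (points (tspace E')) E' U' G' H'"
      using D'(11)[OF x] by blast
    note T = local_trivD[OF T] and T' = local_trivD[OF T']
    have "local_triv N (prod_manifold (tspace E) (tspace E')) ?S (whitney_sum E E') (U \<inter> U')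
        (\<lambda>z. (G (fst z), G' (snd z))) (\<lambda>y w. (H y (fst w), H' y (snd w)))"
    proof (rule local_triv.intro)
      fix z
      assume z: "z \<in> ?S" "bproj (whitney_sum E E') z \<in> U \<inter> U'"
      then have zp: "z \<in> points (tspace E) \<times> points (tspace E')" by auto
      show "smooth_at (prod_manifold (tspace E) (tspace E')) euclid (\<lambda>z. (G (fst z), G' (snd z))) z"
        using z T(1)[of "fst z"] T'(1)[of "snd z"]
        by (intro smooth_at_Pair_euclid[OF EE]
            smooth_at_compose[OF EE D(2) smooth_atlas_euclid smooth_at_fst[OF D(2) D'(2) zp]]
            smooth_at_compose[OF EE D'(2) smooth_atlas_euclid smooth_at_snd[OF D(2) D'(2) zp]])
          (auto simp: simps)
      show "(H (bproj (whitney_sum E E') z) (fst (G (fst z), G' (snd z))),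
          H' (bproj (whitney_sum E E') z) (snd (G (fst z), G' (snd z)))) = z"
        using z T(2)[of "fst z"] T'(2)[of "snd z"] by (auto simp: simps)
    next
      fix y and w :: "'f \<times> 'g"
      assume y: "y \<in> U \<inter> U'"
      then have yN: "y \<in> points N" using openin_mtop_subset[OF D(1) U(1)] by blast
      have 1: "smooth_at (prod_manifold N euclid) (tspace E) (\<lambda>z. H (fst z) (fst (snd z))) (y, w)"
        using smooth_at_compose[OF NF NF D(2) smooth_at_prod_snd_map[OF D(1) yN smooth_on_fst, of w], where g = "\<lambda>z. H (fst z) (snd z)"] T(6) y by auto
      have 2: "smooth_at (prod_manifold N euclid) (tspace E') (\<lambda>z. H' (fst z) (snd (snd z))) (y, w)"
        using smooth_at_compose[OF NF NF D'(2) smooth_at_prod_snd_map[OF D(1) yN smooth_on_snd, of w], where g = "\<lambda>z. H' (fst z) (snd z)"] T'(6) y by auto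
      from smooth_at_Pair[OF NF D(2) D'(2) 1 2]
      show "smooth_at (prod_manifold N euclid) (prod_manifold (tspace E) (tspace E'))
          (\<lambda>z. (H (fst z) (fst (snd z)), H' (fst z) (snd (snd z)))) (y, w)" .
    qed (auto simp: simps zero_prod_def T(3-5,7-9) T'(3-5,7-9))
    then show "\<exists>U G H. openin (mtop N) U \<and> x \<in> U \<and>
        local_triv N (prod_manifold (tspace E) (tspace E')) ?S (whitney_sum E E') U G H"
      using U U' openin_Int by blast
  qed (auto simp: simps D(5-10) D'(5-10))
qed

text \<open>The first component of \<open>r v\<close> is that of the image of \<open>v\<close> under
  the tangent map, so \<open>v\<close> is vertical over \<open>U\<close> exactly if it vanishes. The
  second component is then a fibre coordinate, with inverse \<open>s y (0, w)\<close>.\<close>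

lemma ambient_bundle_vertical:
  fixes N :: "('b, 'n::fin_dim_inner) manifold" and M :: "('a, 'm::fin_dim_inner) manifold"
    and F :: "('d, 'k::fin_dim_inner) manifold"
  assumes FB: "fiber_bundle N M F p"
  shows "ambient_bundle N (TB N)
    {v \<in> tvecs N. tangent_map N M p v = vzero (tangent_bundle M) (p (fst v))}
    (vertical_bundle N M p :: (('b, 'n) tvec, 'b, 'n, 'k) vbundle)"
proof -
  let ?E = "vertical_bundle N M p :: (('b, 'n) tvec, 'b, 'n, 'k) vbundle"
  note N = fiber_bundleD(1)[OF FB] and M = fiber_bundleD(2)[OF FB] and p = fiber_bundleD(3)[OF FB]
    and pM = fiber_bundleD(4)[OF FB] and pv = fiber_bundleD(5)[OF FB]
  note D = ambient_bundleD[OF ambient_bundle_tangent_bundle[OF N]]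
  note TN = D(2)
  have simps: "bproj ?E = fst" "vadd ?E = vadd (tangent_bundle N)" "vscale ?E = vscale (tangent_bundle N)"
    "vzero ?E = vzero (tangent_bundle N)"
    by (simp_all add: vertical_bundle_def)
  let ?S = "{v \<in> tvecs N. tangent_map N M p v = vzero (tangent_bundle M) (p (fst v))}"
  have add: "vadd (tangent_bundle N) v w \<in> ?S" if "v \<in> ?S" "w \<in> ?S" "fst v = fst w" for v w
    using that tangent_map_linear(1)[OF N M _ pv, of v w] vadd_in_tvecs[OF N, of v w] by simp
  have scale: "vscale (tangent_bundle N) r v \<in> ?S" if "v \<in> ?S" for r v
    using that tangent_map_linear(2)[OF N M _ pv, of v r] vscale_in_tvecs[OF N, of v r] by simp
  have zero: "vzero (tangent_bundle N) x \<in> ?S" if "x \<in> points N" for x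
  proof -
    have z: "vzero (tangent_bundle N) x \<in> tvecs N" using vzero_in_tvecs[OF N that] by simp
    \<comment> \<open>The zero vector is 0 times itself, so homogeneity gives its image.\<close>
    from tangent_map_linear(2)[OF N M z pv[OF z], of 0] z show ?thesis by simp
  qed
  show ?thesis
  proof (rule ambient_bundle.intro)
    show "smooth_atlas N" by (rule N)
    show "smooth_atlas (TB N)" by (rule TN)
    show "smooth_at (TB N) N (bproj ?E) v" if "v \<in> points (TB N)" for v
      using smooth_at_tangent_proj[OF N] that by (simp add: simps)
    fix x
    assume x: "x \<in> points N"
    obtain U d and r :: "('b, 'n) tvec \<Rightarrow> 'm \<times> 'k" and s where tt: "tangent_triv N M p U d r s" and "x \<in> U"
      by (rule fiber_bundle_tangent_triv[OF FB x])
    note tt = tangent_trivD[OF tt]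
    note U = tt(1) \<open>x \<in> U\<close> and d = tt(2) and pd = tt(3) and r = tt(4-9) and s = tt(10-13)
    have "local_triv N (TB N) ?S ?E U (\<lambda>v. snd (r v)) (\<lambda>y w. s y (0, w))"
    proof (rule local_triv.intro)
      fix v
      assume "v \<in> ?S" "bproj ?E v \<in> U"
      then have v: "v \<in> tvecs N" "fst v \<in> U" and vert: "tangent_map N M p v = vzero (tangent_bundle M) (p (fst v))"
        by (simp_all add: simps)
      show "smooth_at (TB N) euclid (\<lambda>v. snd (r v)) v"
        by (rule smooth_at_compose_smooth_on[OF TN r(1)[OF v] smooth_on_snd]) auto
      have "r v = (0, snd (r v))"
        using r(2)[OF v] vert by (simp add: prod_eq_iff)
      then show "s (bproj ?E v) (0, snd (r v)) = v"
        using r(3)[OF v] by (simp add: simps)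
    next
      fix y and w :: 'k
      assume y: "y \<in> U"
      then have yN: "y \<in> points N" using openin_mtop_subset[OF N U(1)] by blast
      note NE = smooth_atlas_prod[OF N smooth_atlas_euclid]
      have "smooth_on UNIV (\<lambda>w :: 'k. (0 :: 'm, w))"
        by (intro smooth_on_bounded_linear bounded_linear_Pair bounded_linear_zero bounded_linear_ident)
      from smooth_at_compose[OF NE NE TN smooth_at_prod_snd_map[OF N yN this, of w], where g = "\<lambda>z. s (fst z) (snd z)"] s(4)[OF y]
      show "smooth_at (prod_manifold N euclid) (TB N) (\<lambda>z. s (fst z) (0, snd z)) (y, w)"
        by simp
      let ?v = "s y (0, w)"
      have v: "?v \<in> tvecs N" "fst ?v \<in> U" using s(1,2)[OF y] y by simp_all
      \<comment> \<open>The two vectors agree in the chart \<open>d\<close>, since the first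
        coordinate of \<open>?v\<close> is 0 by construction; one chart decides.\<close>
      have "tangent_map N M p ?v = vzero (tangent_bundle M) (p (fst ?v))"
      proof (rule tvecs_eqI[OF _ _ _ d])
        show "tangent_map N M p ?v \<in> tvecs M" by (rule tangent_map_in_tvecs[OF N M v(1) pv[OF v(1)]])
        show "vzero (tangent_bundle M) (p (fst ?v)) \<in> tvecs M"
          using vzero_in_tvecs[OF M pM[OF yN]] s(2)[OF y] by simp
        show "snd (tangent_map N M p ?v) d = snd (vzero (tangent_bundle M) (p (fst ?v))) d"
          using r(2)[OF v] s(3)[OF y] by simp
      qed (use pd[OF y] s(2)[OF y] in simp_all)
      with v show "s y (0, w) \<in> ?S" by simp
      show "bproj ?E (s y (0, w)) = y" "snd (r (s y (0, w))) = w"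
        using s(2,3)[OF y] by (simp_all add: simps)
    qed (use r(4-6) in \<open>simp_all add: simps del: tangent_bundle_simps(2-4)\<close>)
    with U show "\<exists>U G H. openin (mtop N) U \<and> x \<in> U \<and> local_triv N (TB N) ?S ?E U G H"
      by blast
  next
    show "?S \<subseteq> points (TB N)" by auto
    show "vzero ?E x \<in> ?S" if "x \<in> points N" for x
      unfolding simps by (rule zero[OF that])
    show "vadd ?E v w \<in> ?S" if "v \<in> ?S" "w \<in> ?S" "bproj ?E v = bproj ?E w" for v w
      using add that unfolding simps by blast
    show "vscale ?E r v \<in> ?S" if "v \<in> ?S" for v r
      unfolding simps by (rule scale[OF that])
  qed (simp_all add: simps)
qed

text \<open>The fibre coordinates are that of \<open>a\<close> in \<open>A\<close> and the free
  component of \<open>v\<close>. The inverse recovers \<open>a\<close> first (\<open>K\<close>) and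
  then uses its anchor to complete \<open>v\<close> (\<open>L\<close>); smoothness of the inverse
  thus rests on smoothness of \<rho>.\<close>

lemma ambient_bundle_prolongation:
  fixes N :: "('b, 'n::fin_dim_inner) manifold" and M :: "('a, 'm::fin_dim_inner) manifold"
    and F :: "('d, 'k::fin_dim_inner) manifold" and A :: "('x, 'a, 'm, 'f::fin_dim_inner) vbundle"
  assumes FB: "fiber_bundle N M F p" and A: "vector_bundle M A" and \<rho>: "vb_morphism A (tangent_bundle M) \<rho>"
  shows "ambient_bundle N (prod_manifold (tspace A) (TB N))
    {(a, v) \<in> points (tspace A) \<times> tvecs N. \<rho> a = tangent_map N M p v}
    (prolongation_bundle N M p A \<rho> :: ('x \<times> ('b, 'n) tvec, 'b, 'n, 'f \<times> 'k) vbundle)"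
proof -
  let ?E = "prolongation_bundle N M p A \<rho> :: ('x \<times> ('b, 'n) tvec, 'b, 'n, 'f \<times> 'k) vbundle"
  note N = fiber_bundleD(1)[OF FB] and M = fiber_bundleD(2)[OF FB] and p = fiber_bundleD(3)[OF FB]
    and pM = fiber_bundleD(4)[OF FB] and pv = fiber_bundleD(5)[OF FB]
  note AB = ambient_bundle_vector_bundle[OF A]
  note DA = ambient_bundleD[OF AB]
  note TN = smooth_atlas_tangent_bundle[OF N] and TM = smooth_atlas_tangent_bundle[OF M]
  note NE = smooth_atlas_prod[OF N smooth_atlas_euclid]
  note \<rho>D = vb_morphismD[OF DA(2) TM \<rho>]
  note s\<rho> = \<rho>D(1) and \<rho>T = \<rho>D(2)[simplified] and f\<rho> = \<rho>D(3)[simplified] and \<rho>_add = \<rho>D(4) and \<rho>_scale = \<rho>D(5)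
  have simps: "bproj ?E = (\<lambda>z. fst (snd z))"
    "vadd ?E = (\<lambda>(a, v) (b, w). (vadd A a b, vadd (tangent_bundle N) v w))"
    "vscale ?E = (\<lambda>r (a, v). (vscale A r a, vscale (tangent_bundle N) r v))"
    "vzero ?E = (\<lambda>x. (vzero A (p x), vzero (tangent_bundle N) x))"
    by (simp_all add: prolongation_bundle_def split_beta fun_eq_iff)
  let ?X = "prod_manifold (tspace A) (TB N)"
  note XA = smooth_atlas_prod[OF DA(2) TN]
  let ?S = "{(a, v) \<in> points (tspace A) \<times> tvecs N. \<rho> a = tangent_map N M p v}"
  have SD: "a \<in> points (tspace A)" "v \<in> tvecs N" "\<rho> a = tangent_map N M p v" "bproj A a = p (fst v)"
    if "(a, v) \<in> ?S" for a v
    using that f\<rho>[of a] by auto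
  have add: "(vadd A a b, vadd (tangent_bundle N) v w) \<in> ?S"
    if "(a, v) \<in> ?S" "(b, w) \<in> ?S" "fst v = fst w" for a b v w
  proof -
    note v = SD[OF that(1)] and w = SD[OF that(2)]
    have "bproj A a = bproj A b" using v w that by simp
    with v w \<rho>_add[of a b] DA(7)[of a b] tangent_map_linear(1)[OF N M v(2) pv[OF v(2)], of w]
      vadd_in_tvecs[OF N, of v w] that(3)
    show ?thesis by simp
  qed
  have scale: "(vscale A r a, vscale (tangent_bundle N) r v) \<in> ?S" if "(a, v) \<in> ?S" for a v r
    using SD[OF that] \<rho>_scale[of a r] DA(9)[of a r] tangent_map_linear(2)[OF N M _ pv, of v r]
      vscale_in_tvecs[OF N, of v r] by simp
  have zero: "(vzero A (p x), vzero (tangent_bundle N) x) \<in> ?S" if "x \<in> points N" for x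
  proof -
    have z: "vzero (tangent_bundle N) x \<in> tvecs N" using vzero_in_tvecs[OF N that] by simp
    note a = DA(5,6)[OF pM[OF that]]
    \<comment> \<open>The anchor respects multiples, so the zero vector is written as 0 times
      itself.\<close>
    have "\<rho> (vzero A (p x)) = (p x, \<lambda>_. 0)"
      using \<rho>_scale[OF a(1), of 0] ambient_bundle_vscale_0[OF AB a(1)] a(2) f\<rho>[OF a(1)] by simp
    moreover have "tangent_map N M p (vzero (tangent_bundle N) x) = (p x, \<lambda>_. 0)"
      using tangent_map_linear(2)[OF N M z pv[OF z], of 0] by simp
    ultimately show ?thesis using a z by simp
  qed
  show ?thesis
  proof (rule ambient_bundle.intro)
    show "smooth_atlas N" by (rule N)
    show "smooth_atlas ?X" by (rule XA)
    show "smooth_at ?X N (bproj ?E) z" if "z \<in> points ?X" for z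
      unfolding simps using that
      by (intro smooth_at_compose[OF XA TN N smooth_at_snd[OF DA(2) TN] smooth_at_tangent_proj[OF N]]) auto
    fix x
    assume x: "x \<in> points N"
    obtain U d and r :: "('b, 'n) tvec \<Rightarrow> 'm \<times> 'k" and s where tt: "tangent_triv N M p U d r s" and "x \<in> U"
      by (rule fiber_bundle_tangent_triv[OF FB x])
    note tt = tangent_trivD[OF tt]
    note U = tt(1) \<open>x \<in> U\<close> and d = tt(2) and pd = tt(3) and r = tt(4-9) and s = tt(10-13)
    obtain UA G H where UA: "openin (mtop M) UA" "p x \<in> UA"
      and T: "local_triv M (tspace A) (points (tspace A)) A UA G H"
      using DA(11)[OF pM[OF x]] by blast
    note T = local_trivD[OF T]
    define W where "W = {y \<in> U. p y \<in> UA}"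
    have UN: "U \<subseteq> points N" by (rule openin_mtop_subset[OF N U(1)])
    have W: "openin (mtop N) W" "x \<in> W"
      unfolding W_def using smooth_at_open_preimage[OF N M U(1) p UA(1)] UN U(2) UA(2) by auto
    define K where "K y w = H (p y) (fst w)" for y and w :: "'f \<times> 'k"
    \<comment> \<open>The first slot of \<open>s\<close> is the component of the tangent map in
      \<open>d\<close>, so it has to be that of the anchor of \<open>K y w\<close>. With this entry
      the defining equation of the prolongation bundle holds automatically.\<close>
    define L where "L y w = s y (snd (\<rho> (K y w)) d, snd w)" for y and w :: "'f \<times> 'k"
    have K: "K y w \<in> points (tspace A)" "bproj A (K y w) = p y" "G (K y w) = fst w" if "y \<in> W" for y w
      using that T(7-9) by (simp_all add: K_def W_def)
    have L: "L y w \<in> tvecs N" "fst (L y w) = y" "r (L y w) = (snd (\<rho> (K y w)) d, snd w)" if "y \<in> W" for y w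
      using that s(1-3) by (simp_all add: L_def W_def)
    have "local_triv N ?X ?S ?E W (\<lambda>z. (G (fst z), snd (r (snd z)))) (\<lambda>y w. (K y w, L y w))"
    proof (rule local_triv.intro)
      fix z
      assume z: "z \<in> ?S" "bproj ?E z \<in> W"
      obtain a v where av: "z = (a, v)" by (cases z)
      note S = SD[OF z(1)[unfolded av]]
      have v: "fst v \<in> U" "p (fst v) \<in> UA" using z(2) by (simp_all add: simps W_def av)
      have zp: "z \<in> points (tspace A) \<times> points (TB N)"
        using S by (simp add: av)
      show "smooth_at ?X euclid (\<lambda>z. (G (fst z), snd (r (snd z)))) z"
      proof (rule smooth_at_Pair_euclid[OF XA])
        show "smooth_at ?X euclid (\<lambda>z. G (fst z)) z"
          using T(1)[OF S(1)] S(4) v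
          by (intro smooth_at_compose[OF XA DA(2) smooth_atlas_euclid smooth_at_fst[OF DA(2) TN zp]]) (simp add: av)
        have "smooth_at ?X euclid (\<lambda>z. r (snd z)) z"
          using r(1)[OF S(2) v(1)]
          by (intro smooth_at_compose[OF XA TN smooth_atlas_euclid smooth_at_snd[OF DA(2) TN zp]]) (simp add: av)
        from smooth_at_compose_smooth_on[OF XA this smooth_on_snd]
        show "smooth_at ?X euclid (\<lambda>z. snd (r (snd z))) z" by simp
      qed
      have Ka: "K (fst v) (G a, snd (r v)) = a"
        using T(2)[OF S(1)] S(4) v by (simp add: K_def)
      moreover have "(snd (\<rho> a) d, snd (r v)) = r v"
        using r(2)[OF S(2) v(1)] S(3) by (simp add: prod_eq_iff)
      then have "L (fst v) (G a, snd (r v)) = v"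
        using r(3)[OF S(2) v(1)] by (simp add: L_def Ka)
      ultimately show "(K (bproj ?E z) (G (fst z), snd (r (snd z))), L (bproj ?E z) (G (fst z), snd (r (snd z)))) = z"
        by (simp add: av simps)
      show "(G (fst (vscale ?E t z)), snd (r (snd (vscale ?E t z)))) = t *\<^sub>R (G (fst z), snd (r (snd z)))" for t
        using T(4)[OF S(1), of t] S(4) v r(5)[OF v(1), of t] by (simp add: simps av del: tangent_bundle_simps)
      fix z'
      assume z': "z' \<in> ?S" "bproj ?E z' = bproj ?E z"
      obtain a' v' where av': "z' = (a', v')" by (cases z')
      note S' = SD[OF z'(1)[unfolded av']]
      have eq: "fst v' = fst v" using z'(2) by (simp add: simps av av')
      show "(G (fst (vadd ?E z z')), snd (r (snd (vadd ?E z z')))) =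
          (G (fst z), snd (r (snd z))) + (G (fst z'), snd (r (snd z')))"
        using T(3)[OF S(1) _ S'(1)] S(4) S'(4) v r(4)[OF v(1) eq] eq
        by (simp add: simps av av' del: tangent_bundle_simps)
    next
      fix y and w :: "'f \<times> 'k"
      assume y: "y \<in> W"
      then have yU: "y \<in> U" "p y \<in> UA" and yN: "y \<in> points N" using UN by (auto simp: W_def)
      have yw: "(y, w) \<in> points N \<times> points (euclid :: ('f \<times> 'k, 'f \<times> 'k) manifold)" using yN by simp
      note f = smooth_at_fst[OF N smooth_atlas_euclid yw] and sn = smooth_at_snd[OF N smooth_atlas_euclid yw]
      have s1: "smooth_at (prod_manifold N euclid) euclid (\<lambda>z. fst (snd z)) (y, w)"
        "smooth_at (prod_manifold N euclid) euclid (\<lambda>z. snd (snd z)) (y, w)"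
        using smooth_at_compose_smooth_on[OF NE sn smooth_on_fst] smooth_at_compose_smooth_on[OF NE sn smooth_on_snd]
        by simp_all
      have "smooth_at (prod_manifold N euclid) M (\<lambda>z. p (fst z)) (y, w)"
        by (rule smooth_at_compose[OF NE N M f]) (simp add: p yN)
      from smooth_at_Pair[OF NE M smooth_atlas_euclid this s1(1)]
      have "smooth_at (prod_manifold N euclid) (prod_manifold M euclid) (\<lambda>z. (p (fst z), fst (snd z))) (y, w)" .
      from smooth_at_compose[OF NE smooth_atlas_prod[OF M smooth_atlas_euclid] DA(2) this, where g = "\<lambda>z. H (fst z) (snd z)"] T(6)[OF yU(2)]
      have Ks: "smooth_at (prod_manifold N euclid) (tspace A) (\<lambda>z. K (fst z) (snd z)) (y, w)"
        by (simp add: K_def)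
      note Ky = K[OF y, of w]
      have "smooth_at (tspace A) euclid (\<lambda>a. snd (\<rho> a) d) (K y w)"
        using f\<rho>[OF Ky(1)] Ky(2) pd[OF yU(1)]
        by (intro smooth_at_compose[OF DA(2) TM smooth_atlas_euclid s\<rho>[OF Ky(1)]]
            smooth_at_tangent_component[OF M \<rho>T[OF Ky(1)] d]) simp
      then have "smooth_at (prod_manifold N euclid) euclid (\<lambda>z. snd (\<rho> (K (fst z) (snd z))) d) (y, w)"
        by (intro smooth_at_compose[OF NE DA(2) smooth_atlas_euclid Ks]) simp
      from smooth_at_Pair[OF NE N smooth_atlas_euclid f smooth_at_Pair_euclid[OF NE this s1(2)]]
      have "smooth_at (prod_manifold N euclid) (prod_manifold N euclid)
          (\<lambda>z. (fst z, (snd (\<rho> (K (fst z) (snd z))) d, snd (snd z)))) (y, w)" .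
      from smooth_at_compose[OF NE smooth_atlas_prod[OF N smooth_atlas_euclid] TN this, where g = "\<lambda>z. s (fst z) (snd z)"] s(4)[OF yU(1)]
      have "smooth_at (prod_manifold N euclid) (TB N) (\<lambda>z. L (fst z) (snd z)) (y, w)"
        by (simp add: L_def)
      from smooth_at_Pair[OF NE DA(2) TN Ks this]
      show "smooth_at (prod_manifold N euclid) ?X (\<lambda>z. (K (fst z) (snd z), L (fst z) (snd z))) (y, w)" .
      note Ly = L[OF y, of w]
      \<comment> \<open>Both vectors are based at \<open>p y\<close>, which lies in the domain of
        \<open>d\<close>, and \<open>L\<close> was built so that their components in
        \<open>d\<close> coincide.\<close>
      have "\<rho> (K y w) = tangent_map N M p (L y w)"
      proof (rule tvecs_eqI[OF \<rho>T[OF Ky(1)] tangent_map_in_tvecs[OF N M Ly(1) pv[OF Ly(1)]] _ d])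
        show "fst (\<rho> (K y w)) = fst (tangent_map N M p (L y w))"
          using f\<rho>[OF Ky(1)] Ky(2) Ly(2) by simp
        show "fst (\<rho> (K y w)) \<in> fst d"
          using f\<rho>[OF Ky(1)] Ky(2) pd[OF yU(1)] by simp
        show "snd (\<rho> (K y w)) d = snd (tangent_map N M p (L y w)) d"
          using r(2)[OF Ly(1)] Ly(2,3) yU(1) by simp
      qed
      then show "(K y w, L y w) \<in> ?S" using Ky Ly by simp
      show "bproj ?E (K y w, L y w) = y" using Ly by (simp add: simps)
      show "(G (fst (K y w, L y w)), snd (r (snd (K y w, L y w)))) = w" using Ky Ly by simp
    next
      fix y
      assume y: "y \<in> W"
      then show "(G (fst (vzero ?E y)), snd (r (snd (vzero ?E y)))) = 0"
        using T(5) r(6) by (simp add: simps W_def zero_prod_def del: tangent_bundle_simps)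
    qed
    with W show "\<exists>U G H. openin (mtop N) U \<and> x \<in> U \<and> local_triv N ?X ?S ?E U G H" by blast
  next
    show "vzero ?E x \<in> ?S" if "x \<in> points N" for x
      using zero[OF that] by (simp add: simps)
    show "vadd ?E z z' \<in> ?S" if "z \<in> ?S" "z' \<in> ?S" "bproj ?E z = bproj ?E z'" for z z'
      using that add[of "fst z" "snd z" "fst z'" "snd z'"] by (simp add: simps split_beta del: tangent_bundle_simps)
    show "vscale ?E r z \<in> ?S" if "z \<in> ?S" for z r
      using that scale[of "fst z" "snd z" r] by (simp add: simps split_beta del: tangent_bundle_simps)
  qed (auto simp: simps)
qed

section \<open>The splitting determined by a connection\<close>

theorem proposition1:
  fixes M :: "('a, 'm::fin_dim_inner) manifold"
    and Mbar :: "('b, 'n::fin_dim_inner) manifold"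
    and F :: "('d, 'k::fin_dim_inner) manifold"
    and p :: "'b \<Rightarrow> 'a"
    and A :: "('x, 'a, 'm, 'f::fin_dim_inner) vbundle"
    and br :: "('a \<Rightarrow> 'x) \<Rightarrow> ('a \<Rightarrow> 'x) \<Rightarrow> ('a \<Rightarrow> 'x)"
    and \<rho> :: "'x \<Rightarrow> ('a, 'm) tvec"
    and h :: "'b \<times> ('a, 'm) tvec \<Rightarrow> ('b, 'n) tvec"
  assumes "fiber_bundle Mbar M F p"
    and "lie_algebroid M A br \<rho>"
    and "ehresmann_connection Mbar M p h"
  shows "\<exists>\<Phi>. vb_iso Mbar
           (prolongation_bundle Mbar M p A \<rho> :: ('x \<times> ('b, 'n) tvec, 'b, 'n, 'f \<times> 'k) vbundle)
           (whitney_sum (pullback_bundle Mbar p A)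
              (vertical_bundle Mbar M p :: (('b, 'n) tvec, 'b, 'n, 'k) vbundle)) \<Phi> \<and>
         (\<forall>z\<in>points (tspace (prolongation_bundle Mbar M p A \<rho> :: ('x \<times> ('b, 'n) tvec, 'b, 'n, 'f \<times> 'k) vbundle)).
            \<Phi> z = connection_splitting Mbar \<rho> h z)"
proof -
  let ?T = "tangent_bundle Mbar" and ?TM = "tangent_bundle M"
  let ?E = "prolongation_bundle Mbar M p A \<rho> :: ('x \<times> ('b, 'n) tvec, 'b, 'n, 'f \<times> 'k) vbundle"
  let ?P = "pullback_bundle Mbar p A" and ?PT = "pullback_bundle Mbar p ?TM"
  let ?V = "vertical_bundle Mbar M p :: (('b, 'n) tvec, 'b, 'n, 'k) vbundle"
  let ?W = "whitney_sum ?P ?V"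
  have A: "vector_bundle M A" and \<rho>: "vb_morphism A ?TM \<rho>"
    using assms(2) by (simp_all add: lie_algebroid_def)
  have NM: "smooth_manifold Mbar"
    using assms(1) by (simp add: fiber_bundle_def)
  note FB = fiber_bundleD[OF assms(1)]
  note N = FB(1) and M = FB(2) and p = FB(3) and pv = FB(5)
  note TN = smooth_atlas_tangent_bundle[OF N] and TM = smooth_atlas_tangent_bundle[OF M]
  note AB = ambient_bundle_vector_bundle[OF A]
  note AA = ambient_bundleD(2)[OF AB]

  note \<rho>D = vb_morphismD[OF AA TM \<rho>]
  note s\<rho> = \<rho>D(1) and \<rho>T = \<rho>D(2)[simplified] and f\<rho> = \<rho>D(3)[simplified] and \<rho>_add = \<rho>D(4) and \<rho>_scale = \<rho>D(5)

  define SE where "SE = {(a, v) \<in> points (tspace A) \<times> tvecs Mbar. \<rho> a = tangent_map Mbar M p v}"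
  define SP where "SP = {(x, a) \<in> points Mbar \<times> points (tspace A). p x = bproj A a}"
  define SPT where "SPT = {(x, u) \<in> points Mbar \<times> tvecs M. p x = fst u}"
  define SV where "SV = {v \<in> tvecs Mbar. tangent_map Mbar M p v = vzero ?TM (p (fst v))}"
  define SW where "SW = {(z, v) \<in> SP \<times> SV. fst z = fst v}"
  have tE: "tspace ?E = submanifold (prod_manifold (tspace A) (tspace ?T)) SE"
    by (simp add: prolongation_bundle_def SE_def)
  have tP: "tspace ?P = submanifold (prod_manifold Mbar (tspace A)) SP"
    by (simp add: pullback_bundle_def SP_def)
  have tPT: "tspace ?PT = submanifold (prod_manifold Mbar (tspace ?TM)) SPT"
    by (simp add: pullback_bundle_def SPT_def)
  have tV: "tspace ?V = submanifold (tspace ?T) SV"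
    by (simp add: vertical_bundle_def SV_def)
  have bP: "bproj ?P = fst" and bV: "bproj ?V = fst" and bPT: "bproj ?PT = fst"
    by (simp_all add: pullback_bundle_def vertical_bundle_def)
  have pP: "points (tspace ?P) = SP" and pPT: "points (tspace ?PT) = SPT"
    and pV: "points (tspace ?V) = SV" and pE: "points (tspace ?E) = SE"
    by (simp_all only: tP tPT tV tE points_submanifold)
  have tW: "tspace ?W = submanifold (prod_manifold (tspace ?P) (tspace ?V)) SW"
    by (simp add: whitney_sum_def SW_def pP pV bP bV)
  have pW: "points (tspace ?W) = SW"
    by (simp only: tW points_submanifold)

  note ambP = ambient_bundle_pullback[OF N p AB, folded SP_def]
  have "ambient_bundle M (tspace ?TM) (points (tspace ?TM)) ?TM"
    using ambient_bundle_tangent_bundle[OF M] by simp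
  from ambient_bundle_pullback[OF N p this]
  have ambPT: "ambient_bundle Mbar (prod_manifold Mbar (tspace ?TM)) SPT ?PT"
    by (simp add: SPT_def)
  note ambV = ambient_bundle_vertical[OF assms(1), folded SV_def]
  note ambE = ambient_bundle_prolongation[OF assms(1) A \<rho>, folded SE_def]
  \<comment> \<open>The summands of the Whitney sum carry induced structures themselves, so their
    descriptions are first moved from the surrounding manifolds to their own total spaces.\<close>
  have "ambient_bundle Mbar (tspace ?P) (points (tspace ?P)) ?P"
    using ambient_bundle_submanifold[OF ambP tP] by (simp only: pP)
  moreover have "ambient_bundle Mbar (tspace ?V) (points (tspace ?V)) ?V"
    using ambient_bundle_submanifold[OF ambV tV] by (simp only: pV)
  ultimately have ambW: "ambient_bundle Mbar (prod_manifold (tspace ?P) (tspace ?V)) SW ?W"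
    using ambient_bundle_whitney_sum[of Mbar ?P ?V] by (simp add: SW_def pP pV bP bV)
  have aP: "smooth_atlas (tspace ?P)"
    unfolding tP by (rule smooth_atlas_ambient_bundle[OF ambP])
  have aPT: "smooth_atlas (tspace ?PT)"
    unfolding tPT by (rule smooth_atlas_ambient_bundle[OF ambPT])
  have aV: "smooth_atlas (tspace ?V)"
    unfolding tV by (rule smooth_atlas_ambient_bundle[OF ambV])
  have aE: "smooth_atlas (tspace ?E)"
    unfolding tE by (rule smooth_atlas_ambient_bundle[OF ambE])
  have aW: "smooth_atlas (tspace ?W)"
    unfolding tW by (rule smooth_atlas_ambient_bundle[OF ambW])
  have vE: "vector_bundle Mbar ?E"
    by (rule vector_bundle_submanifold[OF NM ambE tE])
  have vW: "vector_bundle Mbar ?W"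
    by (rule vector_bundle_submanifold[OF NM ambW tW])
  note aAT = smooth_atlas_prod[OF AA TN] and aNA = smooth_atlas_prod[OF N AA]
    and aNTM = smooth_atlas_prod[OF N TM] and aPV = smooth_atlas_prod[OF aP aV]

  have hm: "vb_morphism ?PT ?T h" and hT: "\<And>z. z \<in> SPT \<Longrightarrow> tangent_map Mbar M p (h z) = snd z"
    using assms(3) unfolding ehresmann_connection_def pPT by auto
  note hD = vb_morphismD[OF aPT TN hm, unfolded pPT]
  note sh = hD(1) and hN = hD(2)[simplified] and fh = hD(3)[unfolded bPT, simplified]
  have h_add: "h (x, vadd ?TM u u') = vadd ?T (h (x, u)) (h (x, u'))"
    if "(x, u) \<in> SPT" "(x, u') \<in> SPT" for x u u'
    using hD(4)[OF that] by (simp add: pullback_bundle_def)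
  have h_scale: "h (x, vscale ?TM r u) = vscale ?T r (h (x, u))" if "(x, u) \<in> SPT" for x u r
    using hD(5)[OF that, of r] by (simp add: pullback_bundle_def)

  \<comment> \<open>\<open>connection_splitting\<close> written with projections, so that its two
    entries can be treated separately.\<close>
  define \<Phi> where "\<Phi> z = ((fst (snd z), fst z),
      vadd ?T (snd z) (vscale ?T (- 1) (h (fst (snd z), \<rho> (fst z)))))" for z
  \<comment> \<open>The candidate inverse restores the horizontal lift that \<Phi>
    subtracts.\<close>
  define \<Psi> where "\<Psi> z = (snd (fst z), vadd ?T (snd z) (h (fst (fst z), \<rho> (snd (fst z)))))" for z
  have \<Phi>_eq: "\<Phi> z = connection_splitting Mbar \<rho> h z" for z
    by (simp add: \<Phi>_def connection_splitting_def split_beta)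

  have SED: "fst z \<in> points (tspace A)" "snd z \<in> tvecs Mbar" "\<rho> (fst z) = tangent_map Mbar M p (snd z)"
    "fst (snd z) \<in> points Mbar" "p (fst (snd z)) = bproj A (fst z)" "(fst (snd z), \<rho> (fst z)) \<in> SPT"
    if "z \<in> SE" for z
  proof -
    show 1: "fst z \<in> points (tspace A)" "snd z \<in> tvecs Mbar" "\<rho> (fst z) = tangent_map Mbar M p (snd z)"
      using that by (auto simp: SE_def)
    show "fst (snd z) \<in> points Mbar" by (rule tvecsD(1)[OF 1(2)])
    show "p (fst (snd z)) = bproj A (fst z)" using f\<rho>[OF 1(1)] 1(3) by simp
    then show "(fst (snd z), \<rho> (fst z)) \<in> SPT"
      using tvecsD(1)[OF 1(2)] \<rho>T[OF 1(1)] f\<rho>[OF 1(1)] by (simp add: SPT_def)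
  qed
  have SWD: "fst z \<in> SP" "snd z \<in> SV" "fst (fst z) = fst (snd z)" "snd (fst z) \<in> points (tspace A)"
    "fst (fst z) \<in> points Mbar" "p (fst (fst z)) = bproj A (snd (fst z))" "snd z \<in> tvecs Mbar"
    "tangent_map Mbar M p (snd z) = vzero ?TM (p (fst (snd z)))" "(fst (fst z), \<rho> (snd (fst z))) \<in> SPT"
    if "z \<in> SW" for z
  proof -
    show 1: "fst z \<in> SP" "snd z \<in> SV" "fst (fst z) = fst (snd z)" using that by (auto simp: SW_def)
    show 2: "snd (fst z) \<in> points (tspace A)" "fst (fst z) \<in> points Mbar" "p (fst (fst z)) = bproj A (snd (fst z))"
      "snd z \<in> tvecs Mbar" "tangent_map Mbar M p (snd z) = vzero ?TM (p (fst (snd z)))"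
      using 1 by (auto simp: SP_def SV_def)
    show "(fst (fst z), \<rho> (snd (fst z))) \<in> SPT"
      using 2 \<rho>T[OF 2(1)] f\<rho>[OF 2(1)] by (simp add: SPT_def)
  qed

  have \<Phi>W: "\<Phi> z \<in> SW" if z: "z \<in> SE" for z
  proof -
    note D = SED[OF z]
    let ?w = "vscale ?T (- 1) (h (fst (snd z), \<rho> (fst z)))"
    have w: "?w \<in> tvecs Mbar" using vscale_in_tvecs[OF N hN[OF D(6)], of "- 1"] by simp
    have fw: "fst ?w = fst (snd z)" using fh[OF D(6)] by simp
    have "tangent_map Mbar M p ?w = vscale ?TM (- 1) (\<rho> (fst z))"
      using tangent_map_linear(2)[OF N M hN[OF D(6)] pv[OF hN[OF D(6)]], of "- 1"] hT[OF D(6)] by simp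
    \<comment> \<open>\<open>snd z\<close> maps to the anchor by membership in the prolongation
      bundle, its horizontal part because \<open>h\<close> splits the tangent map; so the difference
      is vertical.\<close>
    then have "tangent_map Mbar M p (vadd ?T (snd z) ?w) = (p (fst (snd z)), \<lambda>_. 0)"
      using tangent_map_linear(1)[OF N M D(2) pv[OF D(2)] w fw] D(3)[symmetric] f\<rho>[OF D(1)] D(5) by simp
    moreover have "vadd ?T (snd z) ?w \<in> tvecs Mbar"
      using vadd_in_tvecs[OF N D(2) w] fw by simp
    ultimately show ?thesis
      using D by (simp add: \<Phi>_def SW_def SP_def SV_def)
  qed
  have \<Psi>E: "\<Psi> z \<in> SE" if z: "z \<in> SW" for z
  proof -
    note D = SWD[OF z]
    let ?w = "h (fst (fst z), \<rho> (snd (fst z)))"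
    have fw: "fst ?w = fst (snd z)" using fh[OF D(9)] D(3) by simp
    \<comment> \<open>The vertical summand contributes zero, and the lift maps back to the
      anchor.\<close>
    have "tangent_map Mbar M p (vadd ?T (snd z) ?w) = \<rho> (snd (fst z))"
      using tangent_map_linear(1)[OF N M D(7) pv[OF D(7)] hN[OF D(9)] fw] hT[OF D(9)] D(8) D(3,6) f\<rho>[OF D(4)]
      by (simp add: prod_eq_iff)
    moreover have "vadd ?T (snd z) ?w \<in> tvecs Mbar"
      using vadd_in_tvecs[OF N D(7) hN[OF D(9)]] fw by simp
    ultimately show ?thesis
      using D(4) by (simp add: \<Psi>_def SE_def)
  qed
  \<comment> \<open>\<Phi> keeps the base point and \<open>a\<close>, hence the same lift is
    subtracted and added in each chart component.\<close>
  have \<Psi>\<Phi>: "\<Psi> (\<Phi> z) = z" if "z \<in> SE" for z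
    by (simp add: \<Psi>_def \<Phi>_def prod_eq_iff)
  \<comment> \<open>An element of the Whitney sum stores its base point twice; the two copies agree
    on \<open>SW\<close>, so \<Phi> takes the lift at the point used by \<Psi>.\<close>
  have \<Phi>\<Psi>: "\<Phi> (\<Psi> z) = z" if "z \<in> SW" for z
    using SWD(3)[OF that] by (simp add: \<Psi>_def \<Phi>_def prod_eq_iff)
  have bij: "bij_betw \<Phi> SE SW"
    using \<Phi>W \<Psi>E \<Psi>\<Phi> \<Phi>\<Psi> by (intro bij_betw_byWitness[of _ \<Psi>]) auto
  have inv: "inv_into SE \<Phi> z = \<Psi> z" if "z \<in> SW" for z
    using \<Psi>E[OF that] \<Phi>\<Psi>[OF that] bij by (intro inv_into_f_eq) (auto simp: bij_betw_def)

  \<comment> \<open>\<open>h\<close> is smooth only on the pullback of the tangent bundle with its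
    induced structure. The pair is therefore smooth into the product first, then into that
    submanifold, and only then composed with \<open>h\<close>. The statement covers both total
    spaces, which have the same model space.\<close>
  have sh\<rho>: "smooth_at X (tspace ?T) (\<lambda>z. h (f z, \<rho> (g z))) z"
    if X: "smooth_atlas X" and f: "smooth_at X Mbar f z" and g: "smooth_at X (tspace A) g z"
      and fg: "\<And>z. z \<in> points X \<Longrightarrow> (f z, \<rho> (g z)) \<in> SPT" and z: "z \<in> points X"
    for X :: "('z, 'n \<times> 'f \<times> 'k) manifold" and f g z
  proof -
    have gA: "g z \<in> points (tspace A)" by (rule smooth_at_points(2)[OF X AA g])
    have "smooth_at X (prod_manifold Mbar (tspace ?TM)) (\<lambda>z. (f z, \<rho> (g z))) z"
      by (rule smooth_at_Pair[OF X N TM f smooth_at_compose[OF X AA TM g s\<rho>[OF gA]]])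
    then have "smooth_at X (tspace ?PT) (\<lambda>z. (f z, \<rho> (g z))) z"
      by (rule smooth_at_into_submanifold[OF X aNTM aPT tPT _ openin_mtop_points[OF X] z fg])
    from smooth_at_compose[OF X aPT TN this sh[OF fg[OF z]]] show ?thesis .
  qed
  have s\<Phi>: "smooth_at (tspace ?E) (tspace ?W) \<Phi> z" if z: "z \<in> SE" for z
  proof -
    note oE = openin_mtop_points[OF aE]
    have zp: "z \<in> points (tspace ?E)" using z by (simp only: pE)
    have zAT: "z \<in> points (tspace A) \<times> points (tspace ?T)" using SED(1,2)[OF z] by (simp add: mem_Times_iff)
    have 1: "smooth_at (tspace ?E) (tspace A) fst z"
      by (rule smooth_at_restrict_submanifold[OF aAT aE tE AA smooth_at_fst[OF AA TN zAT] z])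
    have 2: "smooth_at (tspace ?E) (tspace ?T) snd z"
      by (rule smooth_at_restrict_submanifold[OF aAT aE tE TN smooth_at_snd[OF AA TN zAT] z])
    have 3: "smooth_at (tspace ?E) Mbar (\<lambda>z. fst (snd z)) z"
      by (rule smooth_at_compose[OF aE TN N 2 smooth_at_tangent_proj[OF N SED(2)[OF z]]])
    have 4: "smooth_at (tspace ?E) (tspace ?T) (\<lambda>z. h (fst (snd z), \<rho> (fst z))) z"
      by (rule sh\<rho>[OF aE 3 1 _ zp]) (simp only: pE SED(6))
    have 5: "smooth_at (tspace ?E) (tspace ?T) (\<lambda>z. snd (\<Phi> z)) z"
      unfolding \<Phi>_def snd_conv
      by (rule smooth_at_vadd_tangent[OF N aE 2 smooth_at_vscale_tangent[OF N aE 4] oE zp])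
        (use fh SED(6) pE in simp)
    \<comment> \<open>The codomain changes from the tangent bundle to the vertical bundle, which is
      possible because all values are vertical.\<close>
    have 6: "smooth_at (tspace ?E) (tspace ?V) (\<lambda>z. snd (\<Phi> z)) z"
      by (rule smooth_at_into_submanifold[OF aE TN aV tV 5 oE zp]) (use SWD(2)[OF \<Phi>W] pE in blast)
    have "smooth_at (tspace ?E) (prod_manifold Mbar (tspace A)) (\<lambda>z. (fst (snd z), fst z)) z"
      by (rule smooth_at_Pair[OF aE N AA 3 1])
    then have 7: "smooth_at (tspace ?E) (prod_manifold Mbar (tspace A)) (\<lambda>z. fst (\<Phi> z)) z"
      by (simp add: \<Phi>_def)
    have 8: "smooth_at (tspace ?E) (tspace ?P) (\<lambda>z. fst (\<Phi> z)) z"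
      by (rule smooth_at_into_submanifold[OF aE aNA aP tP 7 oE zp]) (use SWD(1)[OF \<Phi>W] pE in blast)
    have "smooth_at (tspace ?E) (prod_manifold (tspace ?P) (tspace ?V)) \<Phi> z"
      using smooth_at_Pair[OF aE aP aV 8 6] by simp
    then show ?thesis
      by (rule smooth_at_into_submanifold[OF aE aPV aW tW _ oE zp]) (use \<Phi>W pE in blast)
  qed
  have s\<Psi>: "smooth_at (tspace ?W) (tspace ?E) \<Psi> z" if z: "z \<in> SW" for z
  proof -
    note oW = openin_mtop_points[OF aW]
    note D = SWD[OF z]
    have zp: "z \<in> points (tspace ?W)" using z by (simp only: pW)
    have zPV: "z \<in> points (tspace ?P) \<times> points (tspace ?V)" using D(1,2) by (simp add: mem_Times_iff pP pV)
    have zNA: "fst z \<in> points Mbar \<times> points (tspace A)" using D(4,5) by (simp add: mem_Times_iff)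
    have 1: "smooth_at (tspace ?W) (tspace ?P) fst z"
      by (rule smooth_at_restrict_submanifold[OF aPV aW tW aP smooth_at_fst[OF aP aV zPV] z])
    have 2: "smooth_at (tspace ?W) (tspace ?V) snd z"
      by (rule smooth_at_restrict_submanifold[OF aPV aW tW aV smooth_at_snd[OF aP aV zPV] z])
    have 3: "smooth_at (tspace ?W) Mbar (\<lambda>z. fst (fst z)) z"
      by (rule smooth_at_compose[OF aW aP N 1
            smooth_at_restrict_submanifold[OF aNA aP tP N smooth_at_fst[OF N AA zNA] D(1)]])
    have 4: "smooth_at (tspace ?W) (tspace A) (\<lambda>z. snd (fst z)) z"
      by (rule smooth_at_compose[OF aW aP AA 1
            smooth_at_restrict_submanifold[OF aNA aP tP AA smooth_at_snd[OF N AA zNA] D(1)]])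
    have 5: "smooth_at (tspace ?W) (tspace ?T) (\<lambda>z. h (fst (fst z), \<rho> (snd (fst z)))) z"
      by (rule sh\<rho>[OF aW 3 4 _ zp]) (simp only: pW SWD(9))
    have 6: "smooth_at (tspace ?W) (tspace ?T) snd z"
      by (rule smooth_at_compose[OF aW aV TN 2 smooth_at_submanifold_inclusion[OF TN aV tV D(2)]])
    have 7: "smooth_at (tspace ?W) (tspace ?T) (\<lambda>z. snd (\<Psi> z)) z"
      unfolding \<Psi>_def snd_conv
      by (rule smooth_at_vadd_tangent[OF N aW 6 5 oW zp]) (use fh SWD(9,3) pW in simp)
    from smooth_at_Pair[OF aW AA TN 4 7]
    have "smooth_at (tspace ?W) (prod_manifold (tspace A) (tspace ?T)) \<Psi> z"
      by (simp add: \<Psi>_def[abs_def])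
    then show ?thesis
      by (rule smooth_at_into_submanifold[OF aW aAT aE tE _ oW zp]) (use \<Psi>E pW in blast)
  qed
  have m\<Phi>: "smooth_map (tspace ?E) (tspace ?W) \<Phi>"
    unfolding smooth_map_iff_smooth_at[OF aE aW] pE using s\<Phi> by blast
  \<comment> \<open>\<open>diffeo\<close> speaks of \<open>inv_into\<close>, which agrees with
    \<Psi> on the open set of all points of the Whitney sum.\<close>
  have "smooth_at (tspace ?W) (tspace ?E) (inv_into SE \<Phi>) z" if z: "z \<in> SW" for z
    by (rule smooth_at_cong[OF aW s\<Psi>[OF z] openin_mtop_points[OF aW]]) (use z inv pW in auto)
  then have "smooth_map (tspace ?W) (tspace ?E) (inv_into SE \<Phi>)"
    unfolding smooth_map_iff_smooth_at[OF aW aE] pW by blast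
  with m\<Phi> bij have df: "diffeo (tspace ?E) (tspace ?W) \<Phi>"
    by (simp only: diffeo_def pE pW)

  have opE: "bproj ?E z = fst (snd z)"
    "vadd ?E z z' = (vadd A (fst z) (fst z'), vadd ?T (snd z) (snd z'))"
    "vscale ?E r z = (vscale A r (fst z), vscale ?T r (snd z))" for z z' r
    by (simp_all add: prolongation_bundle_def split_beta)
  have opW: "bproj ?W ((x, a), v) = x"
    "vadd ?W ((x, a), v) ((x', a'), v') = ((x, vadd A a a'), vadd ?T v v')"
    "vscale ?W r ((x, a), v) = ((x, vscale A r a), vscale ?T r v)" for x a v x' a' v' r
    by (simp_all add: whitney_sum_def pullback_bundle_def vertical_bundle_def)
  have "vb_morphism ?E ?W \<Phi>"
    unfolding vb_morphism_def pE
  proof (intro conjI ballI allI m\<Phi>)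
    fix z
    assume z: "z \<in> SE"
    note D = SED[OF z]
    show "bproj ?W (\<Phi> z) = bproj ?E z"
      unfolding \<Phi>_def opW opE ..
    show "\<Phi> (vscale ?E r z) = vscale ?W r (\<Phi> z)" for r
      using \<rho>_scale[OF D(1), of r] h_scale[OF D(6), of r]
      by (simp add: \<Phi>_def opE opW scaleR_diff_right)
    fix z'
    assume "z' \<in> fiber ?E (bproj ?E z)"
    then have z': "z' \<in> SE" and eq: "fst (snd z') = fst (snd z)"
      by (simp_all add: fiber_def pE opE)
    note D' = SED[OF z']
    have "bproj A (fst z) = bproj A (fst z')" using D(5) D'(5) eq by simp
    note r = \<rho>_add[OF D(1) D'(1) this]
    \<comment> \<open>The lift for \<open>z'\<close> has to be taken at the base point of
      \<open>z\<close> before additivity of \<open>h\<close> applies; together with additivity of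
      \<rho> the lift of the sum becomes the sum of the lifts.\<close>
    have "(fst (snd z), \<rho> (fst z')) \<in> SPT" using D'(6) eq by simp
    from h_add[OF D(6) this] r
    show "\<Phi> (vadd ?E z z') = vadd ?W (\<Phi> z) (\<Phi> z')"
      by (simp add: \<Phi>_def opE opW eq fun_eq_iff)
  qed
  with vE vW df have "vb_iso Mbar ?E ?W \<Phi>"
    by (simp add: vb_iso_def)
  with \<Phi>_eq show ?thesis by blast
qed

end
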